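(* If $H$ is a quasi-Hopf algebra and $F\in H\otimes H$ is any cochain twist based on $H$, then ${}^H\mathscr{M}$ and ${}^{H_F}\mathscr{M}$ are equivalent as closed monoidal categories.
   Context: Fix a commutative ring $k$ with unit; $\otimes=\otimes_k$. A quasi-bialgebra is an associative unital $k$-algebra $H$ with algebra homomorphisms $\Delta:H\to H\otimes H$, $\epsilon:H\to k$ and an invertible $\phi\in H^{\otimes 3}$ such that for all $h\in H$: $(\epsilon\otimes\mathrm{id})\Delta(h)=h=(\mathrm{id}\otimes\epsilon)\Delta(h)$; $(\mathrm{id}\otimes\Delta)\Delta(h)\cdot\phi=\phi\cdot(\Delta\otimes\mathrm{id})\Delta(h)$; $(\mathrm{id}\otimes\mathrm{id}\otimes\Delta)(\phi)\cdot(\Delta\otimes\mathrm{id}\otimes\mathrm{id})(\phi)=(1\otimes\phi)\cdot(\mathrm{id}\otimes\Delta\otimes\mathrm{id})(\phi)\cdot(\phi\otimes1)$; $(\mathrm{id}\otimes\epsilon\otimes\mathrm{id})(\phi)=1\otimes1$. Notation (summation understood): $\Delta(h)=h_{(1)}\otimes h_{(2)}$, $\phi=\phi^{(1)}\otimes\phi^{(2)}\otimes\phi^{(3)}$, $\phi^{-1}=\phi^{(-1)}\otimes\phi^{(-2)}\otimes\phi^{(-3)}$. A quasi-Hopf algebra is a quasi-bialgebra with a quasi-antipode $(S,\alpha,\beta)$: an algebra anti-automorphism $S:H\to H$ and $\alpha,\beta\in H$ with $S(h_{(1)})\alpha h_{(2)}=\epsilon(h)\alpha$, $h_{(1)}\beta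 S(h_{(2)})=\epsilon(h)\beta$ for all $h$, $\phi^{(1)}\beta S(\phi^{(2)})\alpha\phi^{(3)}=1$, $S(\phi^{(-1)})\alpha\phi^{(-2)}\beta S(\phi^{(-3)})=1$. ${}^H\mathscr{M}$ is the category of left $H$-modules (action $\triangleright$) and $H$-equivariant $k$-linear maps. It is monoidal with $h\triangleright(v\otimes w)=(h_{(1)}\triangleright v)\otimes(h_{(2)}\triangleright w)$, unit $I=k$ (action via $\epsilon$), associator $\Phi_{V,W,X}((v\otimes w)\otimes x)=(\phi^{(1)}\triangleright v)\otimes((\phi^{(2)}\triangleright w)\otimes(\phi^{(3)}\triangleright x))$ and the usual unitors. It is closed with internal hom $\hom(V,W)=\mathrm{Hom}_k(V,W)$, $h\triangleright L=(h_{(1)}\triangleright\cdot)\circ L\circ(S(h_{(2)})\triangleright\cdot)$, $\hom(f^{\mathrm{op}},g)(L)=g\circ L\circ f$. A cochain twist based on $H$ is an invertible $F=F^{(1)}\otimes F^{(2)}\in H\otimes H$ with $(\epsilon\otimes\mathrm{id})(F)=1=(\mathrm{id}\otimes\epsilon)(F)$; write $F^{-1}=F^{(-1)}\otimes F^{(-2)}$. The twisted quasi-Hopf algebra $H_F$ is the algebra $H$ with counit $\epsilon$, coproduct $\Delta_F(h)=F\Delta(h)F^{-1}$, associator $\phi_F=(1\otimes F)(\mathrm{id}\otimes\Delta)(F)\,\phi\,(\Delta\otimes\mathrm{id})(F^{-1})(F^{-1}\otimes1)$ and quasi-antipode $S_F=S$, $\alpha_F=S(F^{(-1)})\alpha F^{(-2)}$,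 $\beta_F=F^{(1)}\beta S(F^{(2)})$. Structures for $H_F$ are decorated with $F$ ($\otimes_F$, $I_F$, $\hom_F$). The equivalence meant is the functor $\mathcal{F}:{}^H\mathscr{M}\to{}^{H_F}\mathscr{M}$ which is the identity on underlying modules and maps ($H_F=H$ as algebras). An equivalence of closed monoidal categories means an equivalence of categories which is a (strong) monoidal functor, here with coherence isomorphisms $\varphi_{V,W}:\mathcal{F}(V)\otimes_F\mathcal{F}(W)\to\mathcal{F}(V\otimes W)$, $v\otimes_F w\mapsto(F^{(-1)}\triangleright v)\otimes(F^{(-2)}\triangleright w)$ and $\psi=\mathrm{id}:I_F\to\mathcal{F}(I)$, and which respects internal homs through a natural isomorphism $\hom_F\circ(\mathcal{F}^{\mathrm{op}}\times\mathcal{F})\Rightarrow\mathcal{F}\circ\hom$, here with components $\gamma_{V,W}:\hom_F(\mathcal{F}(V),\mathcal{F}(W))\to\mathcal{F}(\hom(V,W))$, $L\mapsto(F^{(-1)}\triangleright\cdot)\circ L\circ(S(F^{(-2)})\triangleright\cdot)$. *)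

theory Defs
  imports "HOL-Algebra.Module" "HOL-Algebra.Free_Abelian_Groups"
begin

section \<open>Linear maps and tensor products over a commutative ring\<close>

definition linear_map ::
    "('k, 'r) ring_scheme \<Rightarrow> ('k, 'v, 'm) module_scheme \<Rightarrow> ('k, 'w, 'n) module_scheme \<Rightarrow> ('v \<Rightarrow> 'w) \<Rightarrow> bool"
  where "linear_map R V W f \<longleftrightarrow>
    f \<in> carrier V \<rightarrow> carrier W \<and>
    (\<forall>x\<in>carrier V. \<forall>y\<in>carrier V. f (x \<oplus>\<^bsub>V\<^esub> y) = f x \<oplus>\<^bsub>W\<^esub> f y) \<and>
    (\<forall>r\<in>carrier R. \<forall>x\<in>carrier V. f (r \<odot>\<^bsub>V\<^esub> x) = r \<odot>\<^bsub>W\<^esub> f x)"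

text \<open>Linear maps are taken in the extensional function space, so that two of them are equal
  iff they agree on the carrier of the domain.\<close>

definition lin_hom ::
    "('k, 'r) ring_scheme \<Rightarrow> ('k, 'v, 'm) module_scheme \<Rightarrow> ('k, 'w, 'n) module_scheme \<Rightarrow> ('v \<Rightarrow> 'w) set"
  where "lin_hom R V W = {f \<in> extensional (carrier V). linear_map R V W f}"

text \<open>\<open>V \<otimes>\<^sub>R W\<close> is the free abelian group on \<open>V \<times> W\<close> modulo the usual relations; its elements
  are cosets of formal integer combinations of pairs.\<close>

type_synonym ('v, 'w) tens = "(('v \<times> 'w) \<Rightarrow>\<^sub>0 int) set"

definition tensor_relations ::
    "('k, 'r) ring_scheme \<Rightarrow> ('k, 'v, 'm) module_scheme \<Rightarrow> ('k, 'w, 'n) module_scheme \<Rightarrow> ('v, 'w) tens"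
  where "tensor_relations R V W =
    {frag_of (v \<oplus>\<^bsub>V\<^esub> v', w) - frag_of (v, w) - frag_of (v', w) | v v' w.
       v \<in> carrier V \<and> v' \<in> carrier V \<and> w \<in> carrier W} \<union>
    {frag_of (v, w \<oplus>\<^bsub>W\<^esub> w') - frag_of (v, w) - frag_of (v, w') | v w w'.
       v \<in> carrier V \<and> w \<in> carrier W \<and> w' \<in> carrier W} \<union>
    {frag_of (r \<odot>\<^bsub>V\<^esub> v, w) - frag_of (v, r \<odot>\<^bsub>W\<^esub> w) | r v w.
       r \<in> carrier R \<and> v \<in> carrier V \<and> w \<in> carrier W}"

definition tensor_kernel ::
    "('k, 'r) ring_scheme \<Rightarrow> ('k, 'v, 'm) module_scheme \<Rightarrow> ('k, 'w, 'n) module_scheme \<Rightarrow> ('v, 'w) tens"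
  where "tensor_kernel R V W =
    generate (free_Abelian_group (carrier V \<times> carrier W)) (tensor_relations R V W)"

definition tensor_class ::
    "('k, 'r) ring_scheme \<Rightarrow> ('k, 'v, 'm) module_scheme \<Rightarrow> ('k, 'w, 'n) module_scheme
      \<Rightarrow> (('v \<times> 'w) \<Rightarrow>\<^sub>0 int) \<Rightarrow> ('v, 'w) tens"
  where "tensor_class R V W p =
    tensor_kernel R V W #>\<^bsub>free_Abelian_group (carrier V \<times> carrier W)\<^esub> p"

definition pure_tensor ::
    "('k, 'r) ring_scheme \<Rightarrow> ('k, 'v, 'm) module_scheme \<Rightarrow> ('k, 'w, 'n) module_scheme
      \<Rightarrow> 'v \<Rightarrow> 'w \<Rightarrow> ('v, 'w) tens"
  where "pure_tensor R V W v w = tensor_class R V W (frag_of (v, w))"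

text \<open>The library's record of modules extends that of rings; the fields \<open>mult\<close> and \<open>one\<close>
  carry no meaning for a mere module. In \<open>smult\<close> the union is over representatives, all of
  which give the same coset.\<close>

definition tensor_mod ::
    "('k, 'r) ring_scheme \<Rightarrow> ('k, 'v, 'm) module_scheme \<Rightarrow> ('k, 'w, 'n) module_scheme
      \<Rightarrow> ('k, ('v, 'w) tens) module"
  where "tensor_mod R V W =
    (let Q = free_Abelian_group (carrier V \<times> carrier W) Mod tensor_kernel R V W
     in \<lparr>carrier = carrier Q, monoid.mult = undefined, one = undefined,
         ring.zero = one Q, add = monoid.mult Q,
         smult = (\<lambda>r t. \<Union>p\<in>t. tensor_class R V W
                     (frag_extend (\<lambda>(v, w). frag_of (r \<odot>\<^bsub>V\<^esub> v, w)) p))\<rparr>)"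

text \<open>\<open>tensor_lift R V W M b\<close> is the linear map on \<open>V \<otimes> W\<close> given by \<open>v \<otimes> w \<mapsto> b v w\<close>; it is only
  used for bilinear \<open>b\<close>. A Sweedler-type expression such as \<open>S(h\<^sub>1) \<alpha> h\<^sub>2\<close>
  is the lift of \<open>(a, b) \<mapsto> S(a) \<alpha> b\<close> evaluated at \<open>\<Delta>(h)\<close>.\<close>

definition tensor_lift ::
    "('k, 'r) ring_scheme \<Rightarrow> ('k, 'v, 'm) module_scheme \<Rightarrow> ('k, 'w, 'n) module_scheme
      \<Rightarrow> ('k, 'x, 'l) module_scheme \<Rightarrow> ('v \<Rightarrow> 'w \<Rightarrow> 'x) \<Rightarrow> ('v, 'w) tens \<Rightarrow> 'x"
  where "tensor_lift R V W M b =
    (THE g. g \<in> lin_hom R (tensor_mod R V W) M \<and>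
       (\<forall>v\<in>carrier V. \<forall>w\<in>carrier W. g (pure_tensor R V W v w) = b v w))"

definition tensor_map ::
    "('k, 'r) ring_scheme \<Rightarrow> ('k, 'v, 'm) module_scheme \<Rightarrow> ('k, 'w, 'n) module_scheme
      \<Rightarrow> ('k, 'x, 'l) module_scheme \<Rightarrow> ('k, 'y, 'p) module_scheme
      \<Rightarrow> ('v \<Rightarrow> 'x) \<Rightarrow> ('w \<Rightarrow> 'y) \<Rightarrow> ('v, 'w) tens \<Rightarrow> ('x, 'y) tens"
  where "tensor_map R V W X Y f g =
    tensor_lift R V W (tensor_mod R X Y) (\<lambda>v w. pure_tensor R X Y (f v) (g w))"

text \<open>The canonical map \<open>(U \<otimes> V) \<otimes> W \<rightarrow> U \<otimes> (V \<otimes> W)\<close>. Iterated tensor products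
  are bracketed to the right below, and this map makes the identifications explicit.\<close>

definition tensor_reassoc ::
    "('k, 'r) ring_scheme \<Rightarrow> ('k, 'u, 'l) module_scheme \<Rightarrow> ('k, 'v, 'm) module_scheme
      \<Rightarrow> ('k, 'w, 'n) module_scheme \<Rightarrow> (('u, 'v) tens, 'w) tens \<Rightarrow> ('u, ('v, 'w) tens) tens"
  where "tensor_reassoc R U V W =
    (let T = tensor_mod R U (tensor_mod R V W)
     in tensor_lift R (tensor_mod R U V) W T
          (\<lambda>t w. tensor_lift R U V T
             (\<lambda>u v. pure_tensor R U (tensor_mod R V W) u (pure_tensor R V W v w)) t))"

text \<open>Given bilinear actions \<open>\<rho>\<close> of \<open>A\<close> on \<open>V\<close> and \<open>\<sigma>\<close> of \<open>B\<close> on \<open>W\<close>, the action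
  \<open>(a \<otimes> b) \<cdot> (v \<otimes> w) = \<rho>(a, v) \<otimes> \<sigma>(b, w)\<close> of \<open>A \<otimes> B\<close> on \<open>V \<otimes> W\<close>.
  Left multiplications give the product of the algebra \<open>A \<otimes> B\<close>.\<close>

definition tensor_act ::
    "('k, 'r) ring_scheme \<Rightarrow> ('k, 'a, 'i) module_scheme \<Rightarrow> ('k, 'b, 'j) module_scheme
      \<Rightarrow> ('k, 'v, 'm) module_scheme \<Rightarrow> ('k, 'w, 'n) module_scheme
      \<Rightarrow> ('a \<Rightarrow> 'v \<Rightarrow> 'v) \<Rightarrow> ('b \<Rightarrow> 'w \<Rightarrow> 'w)
      \<Rightarrow> ('a, 'b) tens \<Rightarrow> ('v, 'w) tens \<Rightarrow> ('v, 'w) tens"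
  where "tensor_act R A B V W \<rho> \<sigma> t x =
    tensor_lift R A B (tensor_mod R V W) (\<lambda>a b. tensor_map R V W V W (\<rho> a) (\<sigma> b) x) t"

definition tensor_alg ::
    "('k, 'r) ring_scheme \<Rightarrow> ('k, 'a, 'i) module_scheme \<Rightarrow> ('k, 'b, 'j) module_scheme
      \<Rightarrow> ('k, ('a, 'b) tens) module"
  where "tensor_alg R A B = (tensor_mod R A B)
    \<lparr>monoid.mult := tensor_act R A B A B (monoid.mult A) (monoid.mult B),
     one := pure_tensor R A B \<one>\<^bsub>A\<^esub> \<one>\<^bsub>B\<^esub>\<rparr>"

section \<open>Quasi-Hopf algebras and cochain twists\<close>

text \<open>The library's locale \<open>algebra\<close> requires commutativity.\<close>

definition unital_algebra :: "('k, 'r) ring_scheme \<Rightarrow> ('k, 'a, 'm) module_scheme \<Rightarrow> bool"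
  where "unital_algebra R A \<longleftrightarrow> cring R \<and> ring A \<and> module R A \<and>
    (\<forall>r\<in>carrier R. \<forall>a\<in>carrier A. \<forall>b\<in>carrier A.
       (r \<odot>\<^bsub>A\<^esub> a) \<otimes>\<^bsub>A\<^esub> b = r \<odot>\<^bsub>A\<^esub> (a \<otimes>\<^bsub>A\<^esub> b) \<and>
       a \<otimes>\<^bsub>A\<^esub> (r \<odot>\<^bsub>A\<^esub> b) = r \<odot>\<^bsub>A\<^esub> (a \<otimes>\<^bsub>A\<^esub> b))"

definition algebra_hom ::
    "('k, 'r) ring_scheme \<Rightarrow> ('k, 'a, 'm) module_scheme \<Rightarrow> ('k, 'b, 'n) module_scheme \<Rightarrow> ('a \<Rightarrow> 'b) \<Rightarrow> bool"
  where "algebra_hom R A B f \<longleftrightarrow> linear_map R A B f \<and>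
    (\<forall>x\<in>carrier A. \<forall>y\<in>carrier A. f (x \<otimes>\<^bsub>A\<^esub> y) = f x \<otimes>\<^bsub>B\<^esub> f y) \<and> f \<one>\<^bsub>A\<^esub> = \<one>\<^bsub>B\<^esub>"

definition algebra_anti_automorphism ::
    "('k, 'r) ring_scheme \<Rightarrow> ('k, 'a, 'm) module_scheme \<Rightarrow> ('a \<Rightarrow> 'a) \<Rightarrow> bool"
  where "algebra_anti_automorphism R A f \<longleftrightarrow> linear_map R A A f \<and>
    bij_betw f (carrier A) (carrier A) \<and>
    (\<forall>x\<in>carrier A. \<forall>y\<in>carrier A. f (x \<otimes>\<^bsub>A\<^esub> y) = f y \<otimes>\<^bsub>A\<^esub> f x) \<and> f \<one>\<^bsub>A\<^esub> = \<one>\<^bsub>A\<^esub>"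

definition base_algebra :: "('k, 'r) ring_scheme \<Rightarrow> ('k, 'k) module"
  where "base_algebra R =
    \<lparr>carrier = carrier R, monoid.mult = monoid.mult R, one = one R, ring.zero = ring.zero R,
     add = add R, smult = monoid.mult R\<rparr>"

record ('k, 'h) quasi_hopf_algebra = "('k, 'h) module" +
  comult :: "'h \<Rightarrow> ('h, 'h) tens"
  counit :: "'h \<Rightarrow> 'k"
  coassociator :: "('h, ('h, 'h) tens) tens"
  antipode :: "'h \<Rightarrow> 'h"
  qalpha :: 'h
  qbeta :: 'h

abbreviation tensor2 ::
    "('k, 'r) ring_scheme \<Rightarrow> ('k, 'a, 'm) module_scheme \<Rightarrow> ('k, ('a, 'a) tens) module"
  where "tensor2 R A \<equiv> tensor_alg R A A"

abbreviation tensor3 ::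
    "('k, 'r) ring_scheme \<Rightarrow> ('k, 'a, 'm) module_scheme \<Rightarrow> ('k, ('a, ('a, 'a) tens) tens) module"
  where "tensor3 R A \<equiv> tensor_alg R A (tensor2 R A)"

abbreviation tensor4 ::
    "('k, 'r) ring_scheme \<Rightarrow> ('k, 'a, 'm) module_scheme
      \<Rightarrow> ('k, ('a, ('a, ('a, 'a) tens) tens) tens) module"
  where "tensor4 R A \<equiv> tensor_alg R A (tensor3 R A)"

text \<open>\<open>\<epsilon> \<otimes> id\<close> and \<open>id \<otimes> \<epsilon>\<close> as maps \<open>H \<otimes> H \<rightarrow> H\<close>, identifying \<open>k \<otimes> H\<close> and \<open>H \<otimes> k\<close> with \<open>H\<close>.\<close>

definition counit_left ::
    "('k, 'r) ring_scheme \<Rightarrow> ('k, 'h) quasi_hopf_algebra \<Rightarrow> ('h, 'h) tens \<Rightarrow> 'h"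
  where "counit_left R H = tensor_lift R H H H (\<lambda>a b. counit H a \<odot>\<^bsub>H\<^esub> b)"

definition counit_right ::
    "('k, 'r) ring_scheme \<Rightarrow> ('k, 'h) quasi_hopf_algebra \<Rightarrow> ('h, 'h) tens \<Rightarrow> 'h"
  where "counit_right R H = tensor_lift R H H H (\<lambda>a b. counit H b \<odot>\<^bsub>H\<^esub> a)"

text \<open>\<open>id \<otimes> \<Delta>\<close> and \<open>\<Delta> \<otimes> id\<close> as maps \<open>H \<otimes> H \<rightarrow> H \<otimes> (H \<otimes> H)\<close>, and
  \<open>1 \<otimes> x\<close>, \<open>x \<otimes> 1\<close> as elements of \<open>H \<otimes> (H \<otimes> H)\<close>.\<close>

definition id_comult ::
    "('k, 'r) ring_scheme \<Rightarrow> ('k, 'h) quasi_hopf_algebra \<Rightarrow> ('h, 'h) tens \<Rightarrow> ('h, ('h, 'h) tens) tens"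
  where "id_comult R H = tensor_map R H H H (tensor2 R H) (\<lambda>x. x) (comult H)"

definition comult_id ::
    "('k, 'r) ring_scheme \<Rightarrow> ('k, 'h) quasi_hopf_algebra \<Rightarrow> ('h, 'h) tens \<Rightarrow> ('h, ('h, 'h) tens) tens"
  where "comult_id R H t =
    tensor_reassoc R H H H (tensor_map R H H (tensor2 R H) H (comult H) (\<lambda>x. x) t)"

definition one_tensor ::
    "('k, 'r) ring_scheme \<Rightarrow> ('k, 'h) quasi_hopf_algebra \<Rightarrow> ('h, 'h) tens \<Rightarrow> ('h, ('h, 'h) tens) tens"
  where "one_tensor R H t = pure_tensor R H (tensor2 R H) \<one>\<^bsub>H\<^esub> t"

definition tensor_one ::
    "('k, 'r) ring_scheme \<Rightarrow> ('k, 'h) quasi_hopf_algebra \<Rightarrow> ('h, 'h) tens \<Rightarrow> ('h, ('h, 'h) tens) tens"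
  where "tensor_one R H t = tensor_reassoc R H H H (pure_tensor R (tensor2 R H) H t \<one>\<^bsub>H\<^esub>)"

text \<open>The two sides of the 3-cocycle condition, in \<open>H \<otimes> (H \<otimes> (H \<otimes> H))\<close>:
  \<open>(id \<otimes> id \<otimes> \<Delta>)(\<phi>) (\<Delta> \<otimes> id \<otimes> id)(\<phi>)\<close> and
  \<open>(1 \<otimes> \<phi>) (id \<otimes> \<Delta> \<otimes> id)(\<phi>) (\<phi> \<otimes> 1)\<close>.\<close>

definition cocycle_lhs ::
    "('k, 'r) ring_scheme \<Rightarrow> ('k, 'h) quasi_hopf_algebra \<Rightarrow> ('h, ('h, ('h, 'h) tens) tens) tens"
  where "cocycle_lhs R H =
    tensor_map R H (tensor2 R H) H (tensor3 R H) (\<lambda>x. x) (id_comult R H) (coassociator H)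
    \<otimes>\<^bsub>tensor4 R H\<^esub>
    tensor_reassoc R H H (tensor2 R H)
      (tensor_map R H (tensor2 R H) (tensor2 R H) (tensor2 R H) (comult H) (\<lambda>x. x) (coassociator H))"

definition cocycle_rhs ::
    "('k, 'r) ring_scheme \<Rightarrow> ('k, 'h) quasi_hopf_algebra \<Rightarrow> ('h, ('h, ('h, 'h) tens) tens) tens"
  where "cocycle_rhs R H =
    pure_tensor R H (tensor3 R H) \<one>\<^bsub>H\<^esub> (coassociator H)
    \<otimes>\<^bsub>tensor4 R H\<^esub>
    tensor_map R H (tensor2 R H) H (tensor3 R H) (\<lambda>x. x) (comult_id R H) (coassociator H)
    \<otimes>\<^bsub>tensor4 R H\<^esub>
    tensor_map R H (tensor_alg R (tensor2 R H) H) H (tensor3 R H) (\<lambda>x. x) (tensor_reassoc R H H H)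
      (tensor_reassoc R H (tensor2 R H) H
         (pure_tensor R (tensor3 R H) H (coassociator H) \<one>\<^bsub>H\<^esub>))"

definition quasi_bialgebra :: "('k, 'r) ring_scheme \<Rightarrow> ('k, 'h) quasi_hopf_algebra \<Rightarrow> bool"
  where "quasi_bialgebra R H \<longleftrightarrow>
    unital_algebra R H \<and>
    algebra_hom R H (tensor2 R H) (comult H) \<and>
    algebra_hom R H (base_algebra R) (counit H) \<and>
    coassociator H \<in> Units (tensor3 R H) \<and>
    (\<forall>h\<in>carrier H. counit_left R H (comult H h) = h \<and> counit_right R H (comult H h) = h) \<and>
    (\<forall>h\<in>carrier H. id_comult R H (comult H h) \<otimes>\<^bsub>tensor3 R H\<^esub> coassociator H =
       coassociator H \<otimes>\<^bsub>tensor3 R H\<^esub> comult_id R H (comult H h)) \<and>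
    cocycle_lhs R H = cocycle_rhs R H \<and>
    tensor_map R H (tensor2 R H) H H (\<lambda>x. x) (counit_left R H) (coassociator H) =
      \<one>\<^bsub>tensor2 R H\<^esub>"

definition quasi_hopf :: "('k, 'r) ring_scheme \<Rightarrow> ('k, 'h) quasi_hopf_algebra \<Rightarrow> bool"
  where "quasi_hopf R H \<longleftrightarrow>
    quasi_bialgebra R H \<and>
    algebra_anti_automorphism R H (antipode H) \<and>
    qalpha H \<in> carrier H \<and> qbeta H \<in> carrier H \<and>
    (\<forall>h\<in>carrier H.
       tensor_lift R H H H (\<lambda>a b. antipode H a \<otimes>\<^bsub>H\<^esub> qalpha H \<otimes>\<^bsub>H\<^esub> b) (comult H h) =
         counit H h \<odot>\<^bsub>H\<^esub> qalpha H \<and>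
       tensor_lift R H H H (\<lambda>a b. a \<otimes>\<^bsub>H\<^esub> qbeta H \<otimes>\<^bsub>H\<^esub> antipode H b) (comult H h) =
         counit H h \<odot>\<^bsub>H\<^esub> qbeta H) \<and>
    tensor_lift R H (tensor2 R H) H
      (\<lambda>a. tensor_lift R H H H
        (\<lambda>b c. a \<otimes>\<^bsub>H\<^esub> qbeta H \<otimes>\<^bsub>H\<^esub> antipode H b \<otimes>\<^bsub>H\<^esub> qalpha H \<otimes>\<^bsub>H\<^esub> c))
      (coassociator H) = \<one>\<^bsub>H\<^esub> \<and>
    tensor_lift R H (tensor2 R H) H
      (\<lambda>a. tensor_lift R H H H
        (\<lambda>b c. antipode H a \<otimes>\<^bsub>H\<^esub> qalpha H \<otimes>\<^bsub>H\<^esub> b \<otimes>\<^bsub>H\<^esub> qbeta H \<otimes>\<^bsub>H\<^esub> antipode H c))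
      (inv\<^bsub>tensor3 R H\<^esub> coassociator H) = \<one>\<^bsub>H\<^esub>"

definition cochain_twist ::
    "('k, 'r) ring_scheme \<Rightarrow> ('k, 'h) quasi_hopf_algebra \<Rightarrow> ('h, 'h) tens \<Rightarrow> bool"
  where "cochain_twist R H F \<longleftrightarrow>
    F \<in> Units (tensor2 R H) \<and> counit_left R H F = \<one>\<^bsub>H\<^esub> \<and> counit_right R H F = \<one>\<^bsub>H\<^esub>"

definition twisted_algebra ::
    "('k, 'r) ring_scheme \<Rightarrow> ('k, 'h) quasi_hopf_algebra \<Rightarrow> ('h, 'h) tens \<Rightarrow> ('k, 'h) quasi_hopf_algebra"
  where "twisted_algebra R H F =
    (let G = inv\<^bsub>tensor2 R H\<^esub> F
     in H\<lparr>comult := (\<lambda>h. F \<otimes>\<^bsub>tensor2 R H\<^esub> comult H h \<otimes>\<^bsub>tensor2 R H\<^esub> G),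
          coassociator :=
            one_tensor R H F \<otimes>\<^bsub>tensor3 R H\<^esub> id_comult R H F \<otimes>\<^bsub>tensor3 R H\<^esub> coassociator H
            \<otimes>\<^bsub>tensor3 R H\<^esub> comult_id R H G \<otimes>\<^bsub>tensor3 R H\<^esub> tensor_one R H G,
          qalpha := tensor_lift R H H H (\<lambda>a b. antipode H a \<otimes>\<^bsub>H\<^esub> qalpha H \<otimes>\<^bsub>H\<^esub> b) G,
          qbeta := tensor_lift R H H H (\<lambda>a b. a \<otimes>\<^bsub>H\<^esub> qbeta H \<otimes>\<^bsub>H\<^esub> antipode H b) F\<rparr>)"

section \<open>Categories, functors, natural isomorphisms\<close>

record ('o, 'a) cat =
  cat_obj :: "'o set"
  cat_arr :: "'a set"
  cat_dom :: "'a \<Rightarrow> 'o"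
  cat_cod :: "'a \<Rightarrow> 'o"
  cat_id :: "'o \<Rightarrow> 'a"
  cat_comp :: "'a \<Rightarrow> 'a \<Rightarrow> 'a"

definition is_category :: "('o, 'a) cat \<Rightarrow> bool"
  where "is_category C \<longleftrightarrow>
    (\<forall>f\<in>cat_arr C. cat_dom C f \<in> cat_obj C \<and> cat_cod C f \<in> cat_obj C) \<and>
    (\<forall>X\<in>cat_obj C. cat_id C X \<in> cat_arr C \<and> cat_dom C (cat_id C X) = X \<and> cat_cod C (cat_id C X) = X) \<and>
    (\<forall>f\<in>cat_arr C. \<forall>g\<in>cat_arr C. cat_cod C f = cat_dom C g \<longrightarrow>
       cat_comp C g f \<in> cat_arr C \<and> cat_dom C (cat_comp C g f) = cat_dom C f \<and>
       cat_cod C (cat_comp C g f) = cat_cod C g) \<and>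
    (\<forall>f\<in>cat_arr C. cat_comp C f (cat_id C (cat_dom C f)) = f \<and>
       cat_comp C (cat_id C (cat_cod C f)) f = f) \<and>
    (\<forall>f\<in>cat_arr C. \<forall>g\<in>cat_arr C. \<forall>h\<in>cat_arr C.
       cat_cod C f = cat_dom C g \<and> cat_cod C g = cat_dom C h \<longrightarrow>
       cat_comp C h (cat_comp C g f) = cat_comp C (cat_comp C h g) f)"

definition is_isomorphism :: "('o, 'a) cat \<Rightarrow> 'a \<Rightarrow> bool"
  where "is_isomorphism C f \<longleftrightarrow> f \<in> cat_arr C \<and>
    (\<exists>g\<in>cat_arr C. cat_dom C g = cat_cod C f \<and> cat_cod C g = cat_dom C f \<and>
       cat_comp C g f = cat_id C (cat_dom C f) \<and> cat_comp C f g = cat_id C (cat_cod C f))"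

definition op_cat :: "('o, 'a) cat \<Rightarrow> ('o, 'a) cat"
  where "op_cat C = \<lparr>cat_obj = cat_obj C, cat_arr = cat_arr C, cat_dom = cat_cod C, cat_cod = cat_dom C,
    cat_id = cat_id C, cat_comp = (\<lambda>g f. cat_comp C f g)\<rparr>"

definition prod_cat :: "('o, 'a) cat \<Rightarrow> ('p, 'b) cat \<Rightarrow> ('o \<times> 'p, 'a \<times> 'b) cat"
  where "prod_cat C D = \<lparr>cat_obj = cat_obj C \<times> cat_obj D, cat_arr = cat_arr C \<times> cat_arr D,
    cat_dom = map_prod (cat_dom C) (cat_dom D), cat_cod = map_prod (cat_cod C) (cat_cod D),
    cat_id = map_prod (cat_id C) (cat_id D),
    cat_comp = (\<lambda>(g, g') (f, f'). (cat_comp C g f, cat_comp D g' f'))\<rparr>"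

record ('o, 'a, 'p, 'b) cfunctor =
  fobj :: "'o \<Rightarrow> 'p"
  farr :: "'a \<Rightarrow> 'b"

definition is_functor :: "('o, 'a) cat \<Rightarrow> ('p, 'b) cat \<Rightarrow> ('o, 'a, 'p, 'b) cfunctor \<Rightarrow> bool"
  where "is_functor C D T \<longleftrightarrow> is_category C \<and> is_category D \<and>
    (\<forall>X\<in>cat_obj C. fobj T X \<in> cat_obj D) \<and>
    (\<forall>f\<in>cat_arr C. farr T f \<in> cat_arr D \<and> cat_dom D (farr T f) = fobj T (cat_dom C f) \<and>
       cat_cod D (farr T f) = fobj T (cat_cod C f)) \<and>
    (\<forall>X\<in>cat_obj C. farr T (cat_id C X) = cat_id D (fobj T X)) \<and>
    (\<forall>f\<in>cat_arr C. \<forall>g\<in>cat_arr C. cat_cod C f = cat_dom C g \<longrightarrow>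
       farr T (cat_comp C g f) = cat_comp D (farr T g) (farr T f))"

definition cfunctor_id :: "('o, 'a, 'o, 'a) cfunctor"
  where "cfunctor_id = \<lparr>fobj = (\<lambda>X. X), farr = (\<lambda>f. f)\<rparr>"

definition cfunctor_comp ::
    "('p, 'b, 'q, 'c) cfunctor \<Rightarrow> ('o, 'a, 'p, 'b) cfunctor \<Rightarrow> ('o, 'a, 'q, 'c) cfunctor"
  where "cfunctor_comp U T = \<lparr>fobj = fobj U \<circ> fobj T, farr = farr U \<circ> farr T\<rparr>"

definition cfunctor_prod ::
    "('o, 'a, 'p, 'b) cfunctor \<Rightarrow> ('o2, 'a2, 'p2, 'b2) cfunctor
      \<Rightarrow> ('o \<times> 'o2, 'a \<times> 'a2, 'p \<times> 'p2, 'b \<times> 'b2) cfunctor"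
  where "cfunctor_prod T U = \<lparr>fobj = map_prod (fobj T) (fobj U), farr = map_prod (farr T) (farr U)\<rparr>"

text \<open>The opposite \<open>C\<^sup>o\<^sup>p \<rightarrow> D\<^sup>o\<^sup>p\<close> of a functor \<open>C \<rightarrow> D\<close> has the same object and arrow maps.\<close>

definition cfunctor_op :: "('o, 'a, 'p, 'b) cfunctor \<Rightarrow> ('o, 'a, 'p, 'b) cfunctor"
  where "cfunctor_op T = T"

definition natural_iso ::
    "('o, 'a) cat \<Rightarrow> ('p, 'b) cat \<Rightarrow> ('o, 'a, 'p, 'b) cfunctor \<Rightarrow> ('o, 'a, 'p, 'b) cfunctor
      \<Rightarrow> ('o \<Rightarrow> 'b) \<Rightarrow> bool"
  where "natural_iso C D T U \<eta> \<longleftrightarrow> is_functor C D T \<and> is_functor C D U \<and>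
    (\<forall>X\<in>cat_obj C. is_isomorphism D (\<eta> X) \<and> cat_dom D (\<eta> X) = fobj T X \<and> cat_cod D (\<eta> X) = fobj U X) \<and>
    (\<forall>f\<in>cat_arr C. cat_comp D (farr U f) (\<eta> (cat_dom C f)) = cat_comp D (\<eta> (cat_cod C f)) (farr T f))"

definition equivalence_of_categories ::
    "('o, 'a) cat \<Rightarrow> ('p, 'b) cat \<Rightarrow> ('o, 'a, 'p, 'b) cfunctor \<Rightarrow> bool"
  where "equivalence_of_categories C D T \<longleftrightarrow> is_functor C D T \<and>
    (\<exists>U \<eta> \<theta>. is_functor D C U \<and> natural_iso C C cfunctor_id (cfunctor_comp U T) \<eta> \<and>
       natural_iso D D (cfunctor_comp T U) cfunctor_id \<theta>)"

section \<open>The category of left modules and its closed monoidal structure\<close>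

record ('k, 'h, 'v) hmodule = "('k, 'v) module" +
  act :: "'h \<Rightarrow> 'v \<Rightarrow> 'v"

definition left_module ::
    "('k, 'r) ring_scheme \<Rightarrow> ('k, 'h) quasi_hopf_algebra \<Rightarrow> ('k, 'h, 'v) hmodule \<Rightarrow> bool"
  where "left_module R H V \<longleftrightarrow> module R V \<and>
    (\<forall>h\<in>carrier H. linear_map R V V (act V h)) \<and>
    (\<forall>v\<in>carrier V. linear_map R H V (\<lambda>h. act V h v)) \<and>
    (\<forall>g\<in>carrier H. \<forall>h\<in>carrier H. \<forall>v\<in>carrier V. act V (g \<otimes>\<^bsub>H\<^esub> h) v = act V g (act V h v)) \<and>
    (\<forall>v\<in>carrier V. act V \<one>\<^bsub>H\<^esub> v = v)"

text \<open>An arrow is a triple of domain, underlying map and codomain. Domain and codomain may have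
  elements of different types, as needed for the associators and for coherence diagrams.\<close>

type_synonym ('k, 'h, 'v, 'w) harrow =
  "('k, 'h, 'v) hmodule \<times> ('v \<Rightarrow> 'w) \<times> ('k, 'h, 'w) hmodule"

definition is_arrow ::
    "('k, 'r) ring_scheme \<Rightarrow> ('k, 'h) quasi_hopf_algebra \<Rightarrow> ('k, 'h, 'v, 'w) harrow \<Rightarrow> bool"
  where "is_arrow R H a \<longleftrightarrow> (case a of (V, f, W) \<Rightarrow>
    left_module R H V \<and> left_module R H W \<and> f \<in> lin_hom R V W \<and>
    (\<forall>h\<in>carrier H. \<forall>v\<in>carrier V. f (act V h v) = act W h (f v)))"

definition id_arrow :: "('k, 'h, 'v) hmodule \<Rightarrow> ('k, 'h, 'v, 'v) harrow"
  where "id_arrow V = (V, \<lambda>v\<in>carrier V. v, V)"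

definition comp_arrow ::
    "('k, 'h, 'w, 'x) harrow \<Rightarrow> ('k, 'h, 'v, 'w) harrow \<Rightarrow> ('k, 'h, 'v, 'x) harrow"
    (infixr "\<circ>\<^sub>a" 55)
  where "b \<circ>\<^sub>a a = (case a of (V, f, _) \<Rightarrow> case b of (_, g, X) \<Rightarrow> (V, compose (carrier V) g f, X))"

text \<open>The category of left \<open>H\<close>-modules whose underlying sets are subsets of the type \<open>'v\<close>.
  Since \<open>'v\<close> is arbitrary, no module is excluded; but tensor products and internal homs of such
  modules live over other types, so that \<open>\<otimes>\<close> and \<open>hom\<close> are functors between
  instances of \<open>module_cat\<close> at different types.\<close>

type_synonym ('k, 'h, 'v) hmod_cat = "(('k, 'h, 'v) hmodule, ('k, 'h, 'v, 'v) harrow) cat"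

definition module_cat ::
    "('k, 'r) ring_scheme \<Rightarrow> ('k, 'h) quasi_hopf_algebra \<Rightarrow> ('k, 'h, 'v) hmod_cat"
  where "module_cat R H = \<lparr>cat_obj = {V. left_module R H V}, cat_arr = {a. is_arrow R H a},
    cat_dom = fst, cat_cod = snd \<circ> snd, cat_id = id_arrow, cat_comp = comp_arrow\<rparr>"

definition unit_module ::
    "('k, 'r) ring_scheme \<Rightarrow> ('k, 'h) quasi_hopf_algebra \<Rightarrow> ('k, 'h, 'k) hmodule"
  where "unit_module R H = module.extend (base_algebra R) \<lparr>act = (\<lambda>h c. counit H h \<otimes>\<^bsub>R\<^esub> c)\<rparr>"

text \<open>\<open>act2 R H V W t\<close> is the action of \<open>t \<in> H \<otimes> H\<close> on \<open>V \<otimes> W\<close>.\<close>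

definition act2 ::
    "('k, 'r) ring_scheme \<Rightarrow> ('k, 'h) quasi_hopf_algebra \<Rightarrow> ('k, 'h, 'v) hmodule \<Rightarrow> ('k, 'h, 'w) hmodule
      \<Rightarrow> ('h, 'h) tens \<Rightarrow> ('v, 'w) tens \<Rightarrow> ('v, 'w) tens"
  where "act2 R H V W = tensor_act R H H V W (act V) (act W)"

definition tensor_module ::
    "('k, 'r) ring_scheme \<Rightarrow> ('k, 'h) quasi_hopf_algebra \<Rightarrow> ('k, 'h, 'v) hmodule \<Rightarrow> ('k, 'h, 'w) hmodule
      \<Rightarrow> ('k, 'h, ('v, 'w) tens) hmodule"
  where "tensor_module R H V W =
    module.extend (tensor_mod R V W) \<lparr>act = (\<lambda>h. act2 R H V W (comult H h))\<rparr>"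

definition tensor_arrow ::
    "('k, 'r) ring_scheme \<Rightarrow> ('k, 'h) quasi_hopf_algebra
      \<Rightarrow> ('k, 'h, 'v, 'v2) harrow \<Rightarrow> ('k, 'h, 'w, 'w2) harrow
      \<Rightarrow> ('k, 'h, ('v, 'w) tens, ('v2, 'w2) tens) harrow"
  where "tensor_arrow R H a b = (case a of (V, f, V') \<Rightarrow> case b of (W, g, W') \<Rightarrow>
    (tensor_module R H V W, tensor_map R V W V' W' f g, tensor_module R H V' W'))"

definition tensor_functor ::
    "('k, 'r) ring_scheme \<Rightarrow> ('k, 'h) quasi_hopf_algebra
      \<Rightarrow> (('k, 'h, 'v) hmodule \<times> ('k, 'h, 'w) hmodule, ('k, 'h, 'v, 'v) harrow \<times> ('k, 'h, 'w, 'w) harrow,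
          ('k, 'h, ('v, 'w) tens) hmodule, ('k, 'h, ('v, 'w) tens, ('v, 'w) tens) harrow) cfunctor"
  where "tensor_functor R H =
    \<lparr>fobj = case_prod (tensor_module R H), farr = case_prod (tensor_arrow R H)\<rparr>"

definition associator ::
    "('k, 'r) ring_scheme \<Rightarrow> ('k, 'h) quasi_hopf_algebra
      \<Rightarrow> ('k, 'h, 'v) hmodule \<Rightarrow> ('k, 'h, 'w) hmodule \<Rightarrow> ('k, 'h, 'x) hmodule
      \<Rightarrow> ('k, 'h, (('v, 'w) tens, 'x) tens, ('v, ('w, 'x) tens) tens) harrow"
  where "associator R H V W X =
    (let S = tensor_module R H (tensor_module R H V W) X;
         T = tensor_module R H V (tensor_module R H W X)
     in (S, \<lambda>t\<in>carrier S. tensor_act R H (tensor2 R H) V (tensor_mod R W X) (act V) (act2 R H W X)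
              (coassociator H) (tensor_reassoc R V W X t), T))"

definition left_unitor ::
    "('k, 'r) ring_scheme \<Rightarrow> ('k, 'h) quasi_hopf_algebra \<Rightarrow> ('k, 'h, 'v) hmodule
      \<Rightarrow> ('k, 'h, ('k, 'v) tens, 'v) harrow"
  where "left_unitor R H V = (tensor_module R H (unit_module R H) V,
    tensor_lift R (unit_module R H) V V (\<lambda>c v. c \<odot>\<^bsub>V\<^esub> v), V)"

definition right_unitor ::
    "('k, 'r) ring_scheme \<Rightarrow> ('k, 'h) quasi_hopf_algebra \<Rightarrow> ('k, 'h, 'v) hmodule
      \<Rightarrow> ('k, 'h, ('v, 'k) tens, 'v) harrow"
  where "right_unitor R H V = (tensor_module R H V (unit_module R H),
    tensor_lift R V (unit_module R H) V (\<lambda>v c. c \<odot>\<^bsub>V\<^esub> v), V)"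

definition hom_mod ::
    "('k, 'r) ring_scheme \<Rightarrow> ('k, 'v, 'm) module_scheme \<Rightarrow> ('k, 'w, 'n) module_scheme \<Rightarrow> ('k, 'v \<Rightarrow> 'w) module"
  where "hom_mod R V W =
    \<lparr>carrier = lin_hom R V W, monoid.mult = undefined, one = undefined,
     ring.zero = (\<lambda>v\<in>carrier V. \<zero>\<^bsub>W\<^esub>),
     add = (\<lambda>K L. \<lambda>v\<in>carrier V. K v \<oplus>\<^bsub>W\<^esub> L v),
     smult = (\<lambda>r L. \<lambda>v\<in>carrier V. r \<odot>\<^bsub>W\<^esub> L v)\<rparr>"

text \<open>For \<open>t \<in> H \<otimes> H\<close>, the endomorphism of \<open>Hom\<^sub>k(V, W)\<close> given for \<open>t = a \<otimes> b\<close> by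
  \<open>L \<mapsto> (a \<triangleright> \<cdot>) \<circ> L \<circ> (S(b) \<triangleright> \<cdot>)\<close>.\<close>

definition hom_act ::
    "('k, 'r) ring_scheme \<Rightarrow> ('k, 'h) quasi_hopf_algebra \<Rightarrow> ('k, 'h, 'v) hmodule \<Rightarrow> ('k, 'h, 'w) hmodule
      \<Rightarrow> ('h, 'h) tens \<Rightarrow> ('v \<Rightarrow> 'w) \<Rightarrow> ('v \<Rightarrow> 'w)"
  where "hom_act R H V W t L =
    tensor_lift R H H (hom_mod R V W)
      (\<lambda>a b. \<lambda>v\<in>carrier V. act W a (L (act V (antipode H b) v))) t"

definition hom_module ::
    "('k, 'r) ring_scheme \<Rightarrow> ('k, 'h) quasi_hopf_algebra \<Rightarrow> ('k, 'h, 'v) hmodule \<Rightarrow> ('k, 'h, 'w) hmodule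
      \<Rightarrow> ('k, 'h, 'v \<Rightarrow> 'w) hmodule"
  where "hom_module R H V W =
    module.extend (hom_mod R V W) \<lparr>act = (\<lambda>h. hom_act R H V W (comult H h))\<rparr>"

text \<open>The arrow part takes \<open>f : V' \<rightarrow> V\<close>, regarded as an arrow \<open>V \<rightarrow> V'\<close> of the opposite
  category, and \<open>g : W \<rightarrow> W'\<close>.\<close>

definition hom_functor ::
    "('k, 'r) ring_scheme \<Rightarrow> ('k, 'h) quasi_hopf_algebra
      \<Rightarrow> (('k, 'h, 'v) hmodule \<times> ('k, 'h, 'w) hmodule, ('k, 'h, 'v, 'v) harrow \<times> ('k, 'h, 'w, 'w) harrow,
          ('k, 'h, 'v \<Rightarrow> 'w) hmodule, ('k, 'h, 'v \<Rightarrow> 'w, 'v \<Rightarrow> 'w) harrow) cfunctor"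
  where "hom_functor R H =
    \<lparr>fobj = (\<lambda>(V, W). hom_module R H V W),
     farr = (\<lambda>((V', f, V), (W, g, W')).
       (hom_module R H V W, \<lambda>L\<in>lin_hom R V W. \<lambda>v\<in>carrier V'. g (L (f v)), hom_module R H V' W'))\<rparr>"

section \<open>The functor induced by a twist and its coherence maps\<close>

text \<open>Modules over \<open>H\<close> and over the twisted algebra are the same records, and the functor
  is the identity on them and on arrows.\<close>

definition twist_functor ::
    "(('k, 'h, 'v) hmodule, ('k, 'h, 'v, 'v) harrow, ('k, 'h, 'v) hmodule, ('k, 'h, 'v, 'v) harrow) cfunctor"
  where "twist_functor = \<lparr>fobj = (\<lambda>V. V), farr = (\<lambda>a. a)\<rparr>"

definition twist_phi ::
    "('k, 'r) ring_scheme \<Rightarrow> ('k, 'h) quasi_hopf_algebra \<Rightarrow> ('h, 'h) tens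
      \<Rightarrow> ('k, 'h, 'v) hmodule \<Rightarrow> ('k, 'h, 'w) hmodule
      \<Rightarrow> ('k, 'h, ('v, 'w) tens, ('v, 'w) tens) harrow"
  where "twist_phi R H F V W =
    (let S = tensor_module R (twisted_algebra R H F) V W
     in (S, \<lambda>t\<in>carrier S. act2 R H V W (inv\<^bsub>tensor2 R H\<^esub> F) t, tensor_module R H V W))"

definition twist_psi ::
    "('k, 'r) ring_scheme \<Rightarrow> ('k, 'h) quasi_hopf_algebra \<Rightarrow> ('h, 'h) tens \<Rightarrow> ('k, 'h, 'k, 'k) harrow"
  where "twist_psi R H F =
    (unit_module R (twisted_algebra R H F), \<lambda>c\<in>carrier R. c, unit_module R H)"

definition twist_gamma ::
    "('k, 'r) ring_scheme \<Rightarrow> ('k, 'h) quasi_hopf_algebra \<Rightarrow> ('h, 'h) tens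
      \<Rightarrow> ('k, 'h, 'v) hmodule \<Rightarrow> ('k, 'h, 'w) hmodule
      \<Rightarrow> ('k, 'h, 'v \<Rightarrow> 'w, 'v \<Rightarrow> 'w) harrow"
  where "twist_gamma R H F V W =
    (let S = hom_module R (twisted_algebra R H F) V W
     in (S, \<lambda>L\<in>carrier S. hom_act R H V W (inv\<^bsub>tensor2 R H\<^esub> F) L, hom_module R H V W))"

end

theory Submission
  imports Defs
begin

text \<open>
  Write \<open>G = F\<^sup>-\<^sup>1\<close> and \<open>H\<^sub>F\<close> for the twisted algebra. The category of modules sees only the
  algebra structure of \<open>H\<close>, which the twist does not touch, so the functor of the theorem is an
  identity functor and the content lies in the quasi-Hopf axioms of \<open>H\<^sub>F\<close> and in the coherence maps.

  \<^bold>\<open>The coherence maps.\<close> Both \<open>V \<otimes> W\<close> and \<open>Hom(V, W)\<close> carry an action \<open>\<tau>\<close> of the algebra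
  \<open>H \<otimes> H\<close>; the \<open>H\<close>-structure is \<open>\<tau>\<close> composed with \<open>\<Delta>\<close>, the \<open>H\<^sub>F\<close>-structure is \<open>\<tau>\<close> composed
  with \<open>F \<Delta>(-) G\<close>. Since \<open>G (F \<Delta>(h) G) = \<Delta>(h) G\<close>, acting by \<open>G\<close> is an isomorphism from the
  latter to the former, with inverse the action of \<open>F\<close> (\<open>twist_isomorphism\<close>). This gives
  \<open>twist_phi\<close> and \<open>twist_gamma\<close> at once, and they are natural because maps induced by module homomorphisms commute with
  \<open>\<tau>\<close>. For the associativity diagram, every arrow is the action of an element of
  \<open>H \<otimes> H \<otimes> H\<close> after the rebracketing map, which is equivariant (\<open>tensor_reassoc_act\<close>), and the
  diagram reduces to the definition of the twisted associator,
  \<open>\<phi> (\<Delta> \<otimes> id)(G) (G \<otimes> 1) = (id \<otimes> \<Delta>)(G) (1 \<otimes> G) \<phi>\<^sub>F\<close> (\<open>associator_coherence\<close>). The unit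
  diagrams come from \<open>(\<epsilon> \<otimes> id)(G) = 1 = (id \<otimes> \<epsilon>)(G)\<close>.

  \<^bold>\<open>The axioms of \<open>H\<^sub>F\<close>.\<close> All maps between tensor powers of \<open>H\<close> that occur in them are algebra
  homomorphisms, and replacing \<open>\<Delta>\<close> by \<open>\<Delta>\<^sub>F\<close> conjugates each of them by an image of \<open>F\<close>. The
  axioms of \<open>H\<^sub>F\<close> then follow from those of \<open>H\<close> by cancelling images of \<open>F\<close> against images of
  \<open>G\<close>. For the cocycle condition one also moves \<open>\<phi>\<close> past the images of \<open>F\<close> and \<open>G\<close> in
  \<open>H\<^sup>\<otimes>\<^sup>4\<close> by quasi-coassociativity (\<open>one_tensor3_phi_id_comult\<close>, \<open>comult_id_phi_one\<close>). For the
  antipode, consider \<open>\<Psi>(a \<otimes> b \<otimes> c) = a \<beta> S(b) \<alpha> c\<close>. Since \<open>S\<close> is an anti-homomorphism, its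
  twisted form is \<open>\<Psi>\<^sub>F(x) = \<Psi>((1 \<otimes> G) x (F \<otimes> 1))\<close>, and the antipode axioms say
  \<open>\<Psi>((id \<otimes> \<Delta>)(u) x) = (id \<otimes> \<epsilon>)(u) \<Psi>(x)\<close> and \<open>\<Psi>(x (\<Delta> \<otimes> id)(u)) = \<Psi>(x) (\<epsilon> \<otimes> id)(u)\<close>
  (\<open>zigzag_comult\<close>). Hence \<open>\<Psi>\<^sub>F(\<phi>\<^sub>F) = \<Psi>((id \<otimes> \<Delta>)(F) \<phi> (\<Delta> \<otimes> id)(G)) = \<Psi>(\<phi>) = 1\<close>, and
  similarly for \<open>\<phi>\<^sub>F\<^sup>-\<^sup>1\<close>.

  All of this rests on the universal property of the tensor product, which is proved first; it gives
  the induction principle on pure tensors that turns each identity above into a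
  computation with elements.
\<close>

section \<open>Linear and bilinear maps\<close>

lemma linear_mapI:
  assumes "\<And>x. x \<in> carrier V \<Longrightarrow> f x \<in> carrier W"
    and "\<And>x y. \<lbrakk>x \<in> carrier V; y \<in> carrier V\<rbrakk> \<Longrightarrow> f (x \<oplus>\<^bsub>V\<^esub> y) = f x \<oplus>\<^bsub>W\<^esub> f y"
    and "\<And>r x. \<lbrakk>r \<in> carrier R; x \<in> carrier V\<rbrakk> \<Longrightarrow> f (r \<odot>\<^bsub>V\<^esub> x) = r \<odot>\<^bsub>W\<^esub> f x"
  shows "linear_map R V W f"
  using assms by (simp add: linear_map_def)

lemma linear_mapD:
  assumes "linear_map R V W f"
  shows "x \<in> carrier V \<Longrightarrow> f x \<in> carrier W"
    and "\<lbrakk>x \<in> carrier V; y \<in> carrier V\<rbrakk> \<Longrightarrow> f (x \<oplus>\<^bsub>V\<^esub> y) = f x \<oplus>\<^bsub>W\<^esub> f y"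
    and "\<lbrakk>r \<in> carrier R; x \<in> carrier V\<rbrakk> \<Longrightarrow> f (r \<odot>\<^bsub>V\<^esub> x) = r \<odot>\<^bsub>W\<^esub> f x"
  using assms by (auto simp: linear_map_def)

lemma linear_map_compose:
  "\<lbrakk>linear_map R V W f; linear_map R W X g\<rbrakk> \<Longrightarrow> linear_map R V X (\<lambda>v. g (f v))"
  by (auto simp: linear_map_def Pi_iff)

lemma linear_map_cong:
  assumes "module R V" and "\<And>v. v \<in> carrier V \<Longrightarrow> f v = g v"
  shows "linear_map R V W f \<longleftrightarrow> linear_map R V W g"
proof -
  interpret module R V by fact
  show ?thesis using assms(2) by (auto simp: linear_map_def Pi_iff)
qed

definition bilinear_map ::
    "('k, 'r) ring_scheme \<Rightarrow> ('k, 'v, 'm) module_scheme \<Rightarrow> ('k, 'w, 'n) module_scheme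
      \<Rightarrow> ('k, 'x, 'l) module_scheme \<Rightarrow> ('v \<Rightarrow> 'w \<Rightarrow> 'x) \<Rightarrow> bool"
  where "bilinear_map R V W M b \<longleftrightarrow>
    (\<forall>v\<in>carrier V. linear_map R W M (b v)) \<and> (\<forall>w\<in>carrier W. linear_map R V M (\<lambda>v. b v w))"

section \<open>The universal property of the tensor product\<close>

locale tensor_product =
  fixes R :: "('k, 'r) ring_scheme"
    and V :: "('k, 'v, 'm) module_scheme"
    and W :: "('k, 'w, 'n) module_scheme"
  assumes mod_V: "module R V" and mod_W: "module R W"
begin

sublocale V: module R V by (rule mod_V)
sublocale W: module R W by (rule mod_W)

abbreviation "fag \<equiv> free_Abelian_group (carrier V \<times> carrier W)"
abbreviation "N \<equiv> tensor_kernel R V W"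
abbreviation "cls \<equiv> tensor_class R V W"
abbreviation "T \<equiv> tensor_mod R V W"

lemma fag_comm: "comm_group fag" by (rule abelian_free_Abelian_group)

sublocale fag: comm_group fag by (rule fag_comm)

lemma in_fag_iff: "p \<in> carrier fag \<longleftrightarrow> Poly_Mapping.keys p \<subseteq> carrier V \<times> carrier W"
  by simp

declare carrier_free_Abelian_group_iff [simp del]

lemma frag_of_closed: "\<lbrakk>v \<in> carrier V; w \<in> carrier W\<rbrakk> \<Longrightarrow> frag_of (v, w) \<in> carrier fag"
  by (simp add: in_fag_iff)

lemma fag_add_closed: "\<lbrakk>p \<in> carrier fag; q \<in> carrier fag\<rbrakk> \<Longrightarrow> p + q \<in> carrier fag"
  using fag.m_closed by simp

lemma fag_minus_closed: "p \<in> carrier fag \<Longrightarrow> - p \<in> carrier fag"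
  by (simp add: in_fag_iff)

lemma inv_fag: "p \<in> carrier fag \<Longrightarrow> inv\<^bsub>fag\<^esub> p = - p"
  by (simp add: in_fag_iff)

lemma zero_closed_fag: "0 \<in> carrier fag"
  by (simp add: in_fag_iff)

lemma fag_diff_closed: "\<lbrakk>p \<in> carrier fag; q \<in> carrier fag\<rbrakk> \<Longrightarrow> p - q \<in> carrier fag"
  using fag_add_closed[of p "- q"] fag_minus_closed[of q] by simp

lemmas fag_closed = frag_of_closed fag_add_closed fag_minus_closed fag_diff_closed

lemma relations_subset: "tensor_relations R V W \<subseteq> carrier fag"
  unfolding tensor_relations_def
  by (auto intro!: fag_closed)

lemma kernel_subgroup: "subgroup N fag"
  unfolding tensor_kernel_def by (rule fag.generate_is_subgroup[OF relations_subset])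

lemma kernel_normal: "N \<lhd> fag"
  by (rule fag.subgroup_imp_normal[OF kernel_subgroup])

lemma cls_eq_iff:
  assumes "p \<in> carrier fag" "q \<in> carrier fag"
  shows "cls p = cls q \<longleftrightarrow> p - q \<in> N"
proof -
  have "cls p = cls q \<longleftrightarrow> p \<otimes>\<^bsub>fag\<^esub> inv\<^bsub>fag\<^esub> q \<in> N"
    unfolding tensor_class_def
    using assms kernel_subgroup fag.is_group
    by (metis fag.rcos_self fag.repr_independence subgroup.rcos_module)
  then show ?thesis using assms by (simp add: inv_fag)
qed

lemma cls_relation:
  assumes "p - q \<in> tensor_relations R V W" "p \<in> carrier fag" "q \<in> carrier fag"
  shows "cls p = cls q"
  using assms cls_eq_iff by (simp add: tensor_kernel_def generate.incl)

lemma carrier_T: "carrier T = cls ` carrier fag"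
  by (auto simp: tensor_mod_def Let_def FactGroup_def RCOSETS_def tensor_class_def
     )

lemma cls_closed: "p \<in> carrier fag \<Longrightarrow> cls p \<in> carrier T"
  by (auto simp: carrier_T)

lemma add_T: "\<lbrakk>p \<in> carrier fag; q \<in> carrier fag\<rbrakk> \<Longrightarrow> cls p \<oplus>\<^bsub>T\<^esub> cls q = cls (p + q)"
  using normal.rcos_sum[OF kernel_normal, of p q]
  by (simp add: tensor_mod_def Let_def tensor_class_def FactGroup_def)

lemma zero_T: "\<zero>\<^bsub>T\<^esub> = cls 0"
  using fag.coset_mult_one[OF subgroup.subset[OF kernel_subgroup]]
  by (simp add: tensor_mod_def Let_def tensor_class_def FactGroup_def)

text \<open>The scalar action of \<open>r\<close> on formal sums, before passing to the quotient: it scales first factors.\<close>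

abbreviation scale where "scale r \<equiv> frag_extend (\<lambda>(v, w). frag_of (r \<odot>\<^bsub>V\<^esub> v, w))"

lemma scale_closed:
  assumes r: "r \<in> carrier R" and p: "p \<in> carrier fag" shows "scale r p \<in> carrier fag"
proof (rule free_Abelian_group_induct[where P = "\<lambda>p. scale r p \<in> carrier fag"])
  show "Poly_Mapping.keys p \<subseteq> carrier V \<times> carrier W" using p by (simp add: in_fag_iff)
  show "scale r 0 \<in> carrier fag" by (simp add: zero_closed_fag)
  show "scale r (frag_of a) \<in> carrier fag" if "a \<in> carrier V \<times> carrier W" for a
    using that r by (auto intro: frag_of_closed)
qed (simp add: frag_extend_diff fag_diff_closed)

lemma relation_add_left:
  "\<lbrakk>v \<in> carrier V; v' \<in> carrier V; w \<in> carrier W\<rbrakk> \<Longrightarrow>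
    frag_of (v \<oplus>\<^bsub>V\<^esub> v', w) - frag_of (v, w) - frag_of (v', w) \<in> tensor_relations R V W"
  unfolding tensor_relations_def by blast

lemma relation_add_right:
  "\<lbrakk>v \<in> carrier V; w \<in> carrier W; w' \<in> carrier W\<rbrakk> \<Longrightarrow>
    frag_of (v, w \<oplus>\<^bsub>W\<^esub> w') - frag_of (v, w) - frag_of (v, w') \<in> tensor_relations R V W"
  unfolding tensor_relations_def by blast

lemma relation_smult:
  "\<lbrakk>r \<in> carrier R; v \<in> carrier V; w \<in> carrier W\<rbrakk> \<Longrightarrow>
    frag_of (r \<odot>\<^bsub>V\<^esub> v, w) - frag_of (v, r \<odot>\<^bsub>W\<^esub> w) \<in> tensor_relations R V W"
  unfolding tensor_relations_def by blast

lemma relation_cases: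
  assumes "p \<in> tensor_relations R V W"
  obtains (add_left) v v' w where "v \<in> carrier V" "v' \<in> carrier V" "w \<in> carrier W"
      "p = frag_of (v \<oplus>\<^bsub>V\<^esub> v', w) - frag_of (v, w) - frag_of (v', w)"
    | (add_right) v w w' where "v \<in> carrier V" "w \<in> carrier W" "w' \<in> carrier W"
      "p = frag_of (v, w \<oplus>\<^bsub>W\<^esub> w') - frag_of (v, w) - frag_of (v, w')"
    | (smult) r v w where "r \<in> carrier R" "v \<in> carrier V" "w \<in> carrier W"
      "p = frag_of (r \<odot>\<^bsub>V\<^esub> v, w) - frag_of (v, r \<odot>\<^bsub>W\<^esub> w)"
  using assms unfolding tensor_relations_def Un_iff mem_Collect_eq
  by (elim disjE exE conjE)
    ((rule add_left; assumption) | (rule add_right; assumption) | (rule smult; assumption))+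

lemma scale_relation:
  assumes r: "r \<in> carrier R" and p: "p \<in> tensor_relations R V W"
  shows "scale r p \<in> tensor_relations R V W"
  using p
proof (cases p rule: relation_cases)
  case (add_left v v' w)
  then show ?thesis
    using relation_add_left[of "r \<odot>\<^bsub>V\<^esub> v" "r \<odot>\<^bsub>V\<^esub> v'" w] r
    by (simp add: frag_extend_diff V.smult_r_distr)
next
  case (add_right v w w')
  then show ?thesis
    using relation_add_right[of "r \<odot>\<^bsub>V\<^esub> v" w w'] r by (simp add: frag_extend_diff)
next
  case (smult s v w)
  have "r \<odot>\<^bsub>V\<^esub> (s \<odot>\<^bsub>V\<^esub> v) = s \<odot>\<^bsub>V\<^esub> (r \<odot>\<^bsub>V\<^esub> v)"
    using smult r by (simp add: V.smult_assoc1[symmetric] V.R.m_comm)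
  then show ?thesis
    using smult relation_smult[of s "r \<odot>\<^bsub>V\<^esub> v" w] r by (simp add: frag_extend_diff)
qed

lemma scale_kernel:
  assumes r: "r \<in> carrier R" and p: "p \<in> N" shows "scale r p \<in> N"
  using p unfolding tensor_kernel_def
proof (induction rule: generate.induct)
  case one show ?case using generate.one[of fag] by simp
next
  case (incl h) then show ?case using scale_relation[OF r] by (simp add: generate.incl)
next
  case (inv h)
  have "h \<in> carrier fag" "scale r h \<in> carrier fag" using inv relations_subset scale_closed[OF r] by auto
  then show ?case using generate.inv[OF scale_relation[OF r inv], of fag]
    by (simp add: frag_extend_minus inv_fag)
next
  case (eng h1 h2)
  then show ?case using generate.eng[of _ fag] by (auto simp: frag_extend_add)
qed

text \<open>Scaling preserves the relations, so the scalar multiples of all representatives lie in one coset and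
  the union that defines the scalar multiplication on the quotient is that coset.\<close>

lemma smult_T:
  assumes r: "r \<in> carrier R" and p: "p \<in> carrier fag"
  shows "r \<odot>\<^bsub>T\<^esub> cls p = cls (scale r p)"
proof -
  have "cls (scale r q) = cls (scale r p)" if "q \<in> cls p" for q
  proof -
    have qp: "q \<in> carrier fag" "q - p \<in> N"
      using that p subgroup.rcos_module[OF kernel_subgroup fag.is_group p, of q]
        fag.r_coset_subset_G[OF subgroup.subset[OF kernel_subgroup] p]
      by (auto simp: tensor_class_def inv_fag)
    then show ?thesis
      using scale_kernel[OF r qp(2)] scale_closed[OF r] p
      by (subst cls_eq_iff) (auto simp: frag_extend_diff)
  qed
  moreover have "p \<in> cls p"
    unfolding tensor_class_def by (rule fag.rcos_self[OF p kernel_subgroup])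
  ultimately have "(\<Union>q\<in>cls p. cls (scale r q)) = cls (scale r p)" by blast
  then show ?thesis by (simp add: tensor_mod_def Let_def)
qed

lemma abelian_T: "abelian_group T"
proof (rule abelian_groupI)
  note [simp] = add_T zero_T cls_closed fag_closed zero_closed_fag
  show "x \<oplus>\<^bsub>T\<^esub> y \<in> carrier T" if "x \<in> carrier T" "y \<in> carrier T" for x y
    using that by (auto simp: carrier_T)
  show "x \<oplus>\<^bsub>T\<^esub> y \<oplus>\<^bsub>T\<^esub> z = x \<oplus>\<^bsub>T\<^esub> (y \<oplus>\<^bsub>T\<^esub> z)"
    if "x \<in> carrier T" "y \<in> carrier T" "z \<in> carrier T" for x y z
    using that by (auto simp: carrier_T add.assoc)
  show "x \<oplus>\<^bsub>T\<^esub> y = y \<oplus>\<^bsub>T\<^esub> x" if "x \<in> carrier T" "y \<in> carrier T" for x y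
    using that by (auto simp: carrier_T add.commute)
  show "\<exists>y\<in>carrier T. y \<oplus>\<^bsub>T\<^esub> x = \<zero>\<^bsub>T\<^esub>" if "x \<in> carrier T" for x
  proof -
    obtain p where "p \<in> carrier fag" "x = cls p" using \<open>x \<in> carrier T\<close> by (auto simp: carrier_T)
    then show ?thesis by (intro bexI[of _ "cls (- p)"]) auto
  qed
qed (auto simp: zero_T cls_closed zero_closed_fag carrier_T add_T)

abbreviation "pt \<equiv> pure_tensor R V W"

lemma pure_tensor_closed: "\<lbrakk>v \<in> carrier V; w \<in> carrier W\<rbrakk> \<Longrightarrow> pt v w \<in> carrier T"
  unfolding pure_tensor_def by (rule cls_closed) (rule frag_of_closed)

lemma pure_tensor_add_left:
  assumes "v \<in> carrier V" "v' \<in> carrier V" "w \<in> carrier W"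
  shows "pt (v \<oplus>\<^bsub>V\<^esub> v') w = pt v w \<oplus>\<^bsub>T\<^esub> pt v' w"
proof -
  have "cls (frag_of (v \<oplus>\<^bsub>V\<^esub> v', w)) = cls (frag_of (v, w) + frag_of (v', w))"
    by (rule cls_relation) (use assms relation_add_left[OF assms] in
      \<open>simp_all add: fag_closed diff_diff_add\<close>)
  then show ?thesis using assms by (simp add: pure_tensor_def add_T fag_closed)
qed

lemma pure_tensor_add_right:
  assumes "v \<in> carrier V" "w \<in> carrier W" "w' \<in> carrier W"
  shows "pt v (w \<oplus>\<^bsub>W\<^esub> w') = pt v w \<oplus>\<^bsub>T\<^esub> pt v w'"
proof -
  have "cls (frag_of (v, w \<oplus>\<^bsub>W\<^esub> w')) = cls (frag_of (v, w) + frag_of (v, w'))"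
    by (rule cls_relation) (use assms relation_add_right[OF assms] in
      \<open>simp_all add: fag_closed diff_diff_add\<close>)
  then show ?thesis using assms by (simp add: pure_tensor_def add_T fag_closed)
qed

lemma smult_pure_tensor:
  assumes "r \<in> carrier R" "v \<in> carrier V" "w \<in> carrier W"
  shows "r \<odot>\<^bsub>T\<^esub> pt v w = pt (r \<odot>\<^bsub>V\<^esub> v) w"
  using assms unfolding pure_tensor_def by (simp add: smult_T)

lemma pure_tensor_smult_right:
  assumes "r \<in> carrier R" "v \<in> carrier V" "w \<in> carrier W"
  shows "pt v (r \<odot>\<^bsub>W\<^esub> w) = pt (r \<odot>\<^bsub>V\<^esub> v) w"
  unfolding pure_tensor_def
  by (rule cls_relation[symmetric])
    (use assms relation_smult[OF assms] in \<open>simp_all add: fag_closed\<close>)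

text \<open>An idempotent of an abelian group is zero; this avoids a separate proof that \<open>0 \<otimes> w\<close> vanishes.\<close>

lemma zero_pure_tensor: "\<zero>\<^bsub>T\<^esub> = pt \<zero>\<^bsub>V\<^esub> \<zero>\<^bsub>W\<^esub>"
proof -
  interpret T: abelian_group T by (rule abelian_T)
  have "pt \<zero>\<^bsub>V\<^esub> \<zero>\<^bsub>W\<^esub> \<oplus>\<^bsub>T\<^esub> pt \<zero>\<^bsub>V\<^esub> \<zero>\<^bsub>W\<^esub> = pt \<zero>\<^bsub>V\<^esub> \<zero>\<^bsub>W\<^esub>"
    using pure_tensor_add_left[of "\<zero>\<^bsub>V\<^esub>" "\<zero>\<^bsub>V\<^esub>" "\<zero>\<^bsub>W\<^esub>"] by simp
  then show ?thesis
    using pure_tensor_closed[of "\<zero>\<^bsub>V\<^esub>" "\<zero>\<^bsub>W\<^esub>"] T.add.r_cancel_one by auto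
qed

lemma cls_minus: 
  assumes "p \<in> carrier fag" shows "cls (- p) = \<ominus>\<^bsub>T\<^esub> cls p"
proof -
  interpret T: abelian_group T by (rule abelian_T)
  have "cls (- p) \<oplus>\<^bsub>T\<^esub> cls p = \<zero>\<^bsub>T\<^esub>"
    using assms add_T[of "- p" p] zero_T by (simp add: fag_minus_closed)
  then show ?thesis using T.minus_equality cls_closed assms by (simp add: fag_minus_closed)
qed

text \<open>Because \<open>0 = 0 \<otimes> 0\<close> and \<open>- (v \<otimes> w) = (- v) \<otimes> w\<close>, sums of pure tensors already exhaust the
  quotient of the free group, and an induction needs no step for differences. Nearly every
  identity below is proved with this rule: both sides are additive, and on pure tensors one computes.\<close>

lemma pure_tensor_induct [consumes 1, case_names pure add]:
  assumes t: "t \<in> carrier T"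
    and pure: "\<And>v w. \<lbrakk>v \<in> carrier V; w \<in> carrier W\<rbrakk> \<Longrightarrow> P (pt v w)"
    and add: "\<And>x y. \<lbrakk>x \<in> carrier T; y \<in> carrier T; P x; P y\<rbrakk> \<Longrightarrow> P (x \<oplus>\<^bsub>T\<^esub> y)"
  shows "P t"
proof -
  interpret T: abelian_group T by (rule abelian_T)
  have *: "P (cls p) \<and> P (cls (- p))" if "Poly_Mapping.keys p \<subseteq> carrier V \<times> carrier W" for p
    using that
  proof (rule free_Abelian_group_induct)
    show "P (cls 0) \<and> P (cls (- 0))"
      using pure[of "\<zero>\<^bsub>V\<^esub>" "\<zero>\<^bsub>W\<^esub>"] by (simp add: zero_T[symmetric] zero_pure_tensor)
  next
    fix x y assume *: "Poly_Mapping.keys x \<subseteq> carrier V \<times> carrier W"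
      "Poly_Mapping.keys y \<subseteq> carrier V \<times> carrier W"
      "P (cls x) \<and> P (cls (- x))" "P (cls y) \<and> P (cls (- y))"
    then have c: "x \<in> carrier fag" "y \<in> carrier fag" "- x \<in> carrier fag" "- y \<in> carrier fag"
      by (auto simp: in_fag_iff)
    have "P (cls x \<oplus>\<^bsub>T\<^esub> cls (- y))" "P (cls (- x) \<oplus>\<^bsub>T\<^esub> cls y)"
      using * c by (auto intro!: add cls_closed)
    then show "P (cls (x - y)) \<and> P (cls (- (x - y)))"
      by (simp add: add_T[OF c(1,4)] add_T[OF c(3,2)])
  next
    fix a assume "a \<in> carrier V \<times> carrier W"
    then obtain v w where a: "a = (v, w)" "v \<in> carrier V" "w \<in> carrier W" by auto
    have "pt (\<ominus>\<^bsub>V\<^esub> v) w \<oplus>\<^bsub>T\<^esub> pt v w = \<zero>\<^bsub>T\<^esub>"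
    proof -
      have "pt (\<ominus>\<^bsub>V\<^esub> v) w \<oplus>\<^bsub>T\<^esub> pt v w = pt \<zero>\<^bsub>V\<^esub> w"
        using a pure_tensor_add_left[of "\<ominus>\<^bsub>V\<^esub> v" v w] by (simp add: V.M.l_neg)
      moreover have "pt \<zero>\<^bsub>V\<^esub> w \<oplus>\<^bsub>T\<^esub> pt \<zero>\<^bsub>V\<^esub> w = pt \<zero>\<^bsub>V\<^esub> w"
        using a pure_tensor_add_left[of "\<zero>\<^bsub>V\<^esub>" "\<zero>\<^bsub>V\<^esub>" w] by simp
      ultimately show ?thesis
        using a pure_tensor_closed[of "\<zero>\<^bsub>V\<^esub>" w] T.add.r_cancel_one by auto
    qed
    then have "cls (- frag_of a) = pt (\<ominus>\<^bsub>V\<^esub> v) w"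
      using a pure_tensor_closed T.minus_equality by (simp add: cls_minus pure_tensor_def)
    then show "P (cls (frag_of a)) \<and> P (cls (- frag_of a))"
      using pure[of v w] pure[of "\<ominus>\<^bsub>V\<^esub> v" w] a by (simp add: pure_tensor_def)
  qed
  from t obtain p where "p \<in> carrier fag" "t = cls p" by (auto simp: carrier_T)
  then show ?thesis using * by (simp add: in_fag_iff)
qed

lemma smult_closed_T: "\<lbrakk>r \<in> carrier R; t \<in> carrier T\<rbrakk> \<Longrightarrow> r \<odot>\<^bsub>T\<^esub> t \<in> carrier T"
  unfolding carrier_T using scale_closed smult_T by (auto)

lemma smult_add_T: "\<lbrakk>r \<in> carrier R; s \<in> carrier T; t \<in> carrier T\<rbrakk> \<Longrightarrow>
  r \<odot>\<^bsub>T\<^esub> (s \<oplus>\<^bsub>T\<^esub> t) = r \<odot>\<^bsub>T\<^esub> s \<oplus>\<^bsub>T\<^esub> r \<odot>\<^bsub>T\<^esub> t"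
  unfolding carrier_T using scale_closed
  by (auto simp: smult_T add_T fag_add_closed frag_extend_add)

lemma module_T: "module R T"
proof (rule moduleI)
  interpret T: abelian_group T by (rule abelian_T)
  note [simp] = smult_closed_T smult_add_T pure_tensor_closed smult_pure_tensor
  show "cring R" by (rule V.R.is_cring)
  show "abelian_group T" by (rule abelian_T)
  show "(a \<oplus>\<^bsub>R\<^esub> b) \<odot>\<^bsub>T\<^esub> x = a \<odot>\<^bsub>T\<^esub> x \<oplus>\<^bsub>T\<^esub> b \<odot>\<^bsub>T\<^esub> x"
    if "a \<in> carrier R" "b \<in> carrier R" "x \<in> carrier T" for a b x
    using that(3) by (induction rule: pure_tensor_induct)
      (use that in \<open>simp_all add: V.smult_l_distr pure_tensor_add_left T.a_ac\<close>)
  show "(a \<otimes>\<^bsub>R\<^esub> b) \<odot>\<^bsub>T\<^esub> x = a \<odot>\<^bsub>T\<^esub> (b \<odot>\<^bsub>T\<^esub> x)"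
    if "a \<in> carrier R" "b \<in> carrier R" "x \<in> carrier T" for a b x
    using that(3) by (induction rule: pure_tensor_induct)
      (use that in \<open>simp_all add: V.smult_assoc1\<close>)
  show "\<one>\<^bsub>R\<^esub> \<odot>\<^bsub>T\<^esub> x = x" if "x \<in> carrier T" for x
    using that by (induction rule: pure_tensor_induct) simp_all
qed (simp_all add: smult_closed_T smult_add_T)

lemma hom_unique:
  assumes f: "linear_map R T M f" and g: "linear_map R T M g"
    and eq: "\<And>v w. \<lbrakk>v \<in> carrier V; w \<in> carrier W\<rbrakk> \<Longrightarrow> f (pt v w) = g (pt v w)"
    and t: "t \<in> carrier T"
  shows "f t = g t"
  using t by (induction rule: pure_tensor_induct) (auto simp: eq linear_mapD(2)[OF f] linear_mapD(2)[OF g])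

text \<open>The extension of \<open>b\<close> to the free abelian group sends the three kinds of relations to zero exactly by
  the three conditions of bilinearity, so it factors through the quotient. Linearity over \<open>R\<close>
  can be checked afterwards on pure tensors.\<close>

lemma lift_exists:
  assumes M: "module R M" and b: "bilinear_map R V W M b"
  shows "\<exists>g\<in>lin_hom R T M. \<forall>v\<in>carrier V. \<forall>w\<in>carrier W. g (pt v w) = b v w"
proof -
  interpret M: module R M by (rule M)
  have bV: "\<And>w. w \<in> carrier W \<Longrightarrow> linear_map R V M (\<lambda>v. b v w)"
    and bW: "\<And>v. v \<in> carrier V \<Longrightarrow> linear_map R W M (b v)"
    using b by (auto simp: bilinear_map_def)
  have "case_prod b ` (carrier V \<times> carrier W) \<subseteq> carrier (add_monoid M)"
    using linear_mapD(1)[OF bW] by auto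
  then obtain h where h: "h \<in> hom fag (add_monoid M)"
    and hf: "\<And>x. x \<in> carrier V \<times> carrier W \<Longrightarrow> h (frag_of x) = case_prod b x"
    by (rule comm_group.free_Abelian_group_universal[OF M.a_comm_group]) (rule that)
  interpret h: group_hom fag "add_monoid M" h
    using h fag.is_group comm_group.axioms(2)[OF M.a_comm_group] by (simp add: group_hom_def group_hom_axioms_def)
  have hadd: "h (p + q) = h p \<oplus>\<^bsub>M\<^esub> h q" if "p \<in> carrier fag" "q \<in> carrier fag" for p q
    using h.hom_mult[OF that] by simp
  have hdiff: "h (p - q) = h p \<ominus>\<^bsub>M\<^esub> h q" if "p \<in> carrier fag" "q \<in> carrier fag" for p q
    using hadd[of p "- q"] h.hom_inv[of q] that
    by (simp add: a_minus_def a_inv_def inv_fag fag_minus_closed)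
  have hcl: "h p \<in> carrier M" if "p \<in> carrier fag" for p
    using h.hom_closed[OF that] by simp
  have cancel: "x \<oplus>\<^bsub>M\<^esub> y \<ominus>\<^bsub>M\<^esub> x \<ominus>\<^bsub>M\<^esub> y = \<zero>\<^bsub>M\<^esub>"
    if "x \<in> carrier M" "y \<in> carrier M" for x y
  proof -
    have "x \<oplus>\<^bsub>M\<^esub> y \<ominus>\<^bsub>M\<^esub> x = y"
      using that M.a_comm M.minus_eq M.r_neg2 by (metis M.a_assoc M.add.inv_closed M.r_neg M.r_zero)
    then show ?thesis using that by (simp add: a_minus_def M.r_neg)
  qed
  have rel: "h p = \<zero>\<^bsub>M\<^esub>" if "p \<in> tensor_relations R V W" for p
    using that
  proof (cases p rule: relation_cases)
    case (add_left v v' w)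
    have "h p = b (v \<oplus>\<^bsub>V\<^esub> v') w \<ominus>\<^bsub>M\<^esub> b v w \<ominus>\<^bsub>M\<^esub> b v' w"
      using add_left by (simp add: hdiff fag_diff_closed hf)
    then show ?thesis using add_left linear_mapD[OF bV[of w]] 
      by (simp add: cancel)
  next
    case (add_right v w w')
    have "h p = b v (w \<oplus>\<^bsub>W\<^esub> w') \<ominus>\<^bsub>M\<^esub> b v w \<ominus>\<^bsub>M\<^esub> b v w'"
      using add_right by (simp add: hdiff fag_diff_closed hf)
    then show ?thesis using add_right linear_mapD[OF bW[of v]]
      by (simp add: cancel)
  next
    case (smult r v w)
    have "h p = b (r \<odot>\<^bsub>V\<^esub> v) w \<ominus>\<^bsub>M\<^esub> b v (r \<odot>\<^bsub>W\<^esub> w)"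
      using smult by (simp add: hdiff fag_diff_closed hf)
    then show ?thesis using smult linear_mapD[OF bV[of w]] linear_mapD[OF bW[of v]]
      by (simp add: a_minus_def M.r_neg)
  qed
  have "tensor_relations R V W \<subseteq> kernel fag (add_monoid M) h"
    using rel relations_subset by (auto simp: kernel_def)
  then have "N \<subseteq> kernel fag (add_monoid M) h"
    unfolding tensor_kernel_def
    by (rule fag.generate_subgroup_incl) (rule h.subgroup_kernel)
  then obtain g where g: "g \<in> hom (fag Mod N) (add_monoid M)" "\<And>p. p \<in> carrier fag \<Longrightarrow> g (cls p) = h p"
    using h.FactGroup_universal_kernel[OF kernel_normal] unfolding tensor_class_def by metis
  define g' where "g' = restrict g (carrier T)"
  have g'cls: "g' (cls p) = h p" if "p \<in> carrier fag" for p
    using g(2)[OF that] cls_closed[OF that] by (simp add: g'_def)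
  have g'pt: "g' (pt v w) = b v w" if "v \<in> carrier V" "w \<in> carrier W" for v w
    using that g'cls[of "frag_of (v, w)"] hf[of "(v, w)"] by (simp add: pure_tensor_def)
  have g'cl: "g' x \<in> carrier M" if "x \<in> carrier T" for x
    using that g'cls hcl by (auto simp: carrier_T)
  have g'add: "g' (x \<oplus>\<^bsub>T\<^esub> y) = g' x \<oplus>\<^bsub>M\<^esub> g' y" if "x \<in> carrier T" "y \<in> carrier T" for x y
    using that g'cls hadd fag_add_closed
    by (auto simp: carrier_T add_T)
  have "g' (r \<odot>\<^bsub>T\<^esub> x) = r \<odot>\<^bsub>M\<^esub> g' x" if "r \<in> carrier R" "x \<in> carrier T" for r x
    using that(2)
  proof (induction rule: pure_tensor_induct)
    case (pure v w)
    then show ?case using that(1) linear_mapD(3)[OF bV[of w]] by (simp add: smult_pure_tensor g'pt)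
  next
    case (add x y)
    then show ?case using that(1) by (simp add: smult_add_T g'add g'cl smult_closed_T M.smult_r_distr)
  qed
  then have "g' \<in> lin_hom R T M"
    using g'cl g'add by (auto simp: lin_hom_def g'_def intro!: linear_mapI)
  then show ?thesis using g'pt by blast
qed

text \<open>Existence together with uniqueness on pure tensors makes the definite description in
  \<open>tensor_lift\<close> meaningful.\<close>

lemma lift:
  assumes "module R M" and "bilinear_map R V W M b"
  shows lift_in_lin_hom: "tensor_lift R V W M b \<in> lin_hom R T M"
    and lift_pure: "\<lbrakk>v \<in> carrier V; w \<in> carrier W\<rbrakk> \<Longrightarrow> tensor_lift R V W M b (pt v w) = b v w"
proof -
  let ?P = "\<lambda>g. g \<in> lin_hom R T M \<and> (\<forall>v\<in>carrier V. \<forall>w\<in>carrier W. g (pt v w) = b v w)"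
  obtain g where g: "?P g" using lift_exists[OF assms] by blast
  have "\<exists>!g. ?P g"
  proof (rule ex1I[of _ g])
    show "?P g" by (rule g)
    fix g' assume g': "?P g'"
    show "g' = g"
    proof (rule extensionalityI[of _ "carrier T"])
      fix x assume "x \<in> carrier T"
      then show "g' x = g x"
        by (rule hom_unique[rotated 3]) (use g g' in \<open>auto simp: lin_hom_def\<close>)
    qed (use g g' in \<open>auto simp: lin_hom_def\<close>)
  qed
  then have "?P (tensor_lift R V W M b)" unfolding tensor_lift_def by (rule theI')
  then show "tensor_lift R V W M b \<in> lin_hom R T M"
    and "\<lbrakk>v \<in> carrier V; w \<in> carrier W\<rbrakk> \<Longrightarrow> tensor_lift R V W M b (pt v w) = b v w" by blast+
qed

lemma lift_eqI:
  assumes "module R M" and "g \<in> lin_hom R T M"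
    and "\<And>v w. \<lbrakk>v \<in> carrier V; w \<in> carrier W\<rbrakk> \<Longrightarrow> g (pt v w) = b v w"
    and "bilinear_map R V W M b"
  shows "tensor_lift R V W M b = g"
proof (rule extensionalityI[of _ "carrier T"])
  note l = lift[OF assms(1,4)]
  fix x assume "x \<in> carrier T"
  then show "tensor_lift R V W M b x = g x"
    by (rule hom_unique[rotated 3]) (use assms l in \<open>auto simp: lin_hom_def\<close>)
qed (use assms lift[OF assms(1,4)] in \<open>auto simp: lin_hom_def\<close>)

end

text \<open>The same facts with the module hypotheses as premises, so that one proof can use them for several
  tensor products at a time.\<close>

lemmas tensor_module_module [simp] = tensor_product.module_T[OF tensor_product.intro]
lemmas pure_tensor_closed [simp] = tensor_product.pure_tensor_closed[OF tensor_product.intro]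
lemmas pure_tensor_add_left = tensor_product.pure_tensor_add_left[OF tensor_product.intro]
lemmas pure_tensor_add_right = tensor_product.pure_tensor_add_right[OF tensor_product.intro]
lemmas smult_pure_tensor = tensor_product.smult_pure_tensor[OF tensor_product.intro]
lemmas pure_tensor_smult_right = tensor_product.pure_tensor_smult_right[OF tensor_product.intro]
lemmas pure_tensor_induct = tensor_product.pure_tensor_induct[OF tensor_product.intro, consumes 3, case_names pure add]
lemmas lift_in_lin_hom = tensor_product.lift_in_lin_hom[OF tensor_product.intro]
lemmas lift_pure = tensor_product.lift_pure[OF tensor_product.intro]

lemma lin_homD: "f \<in> lin_hom R V W \<Longrightarrow> linear_map R V W f" "f \<in> lin_hom R V W \<Longrightarrow> f \<in> extensional (carrier V)"
  by (auto simp: lin_hom_def)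

lemma lin_hom_eqI:
  assumes "f \<in> lin_hom R V W" "g \<in> lin_hom R V W" "\<And>v. v \<in> carrier V \<Longrightarrow> f v = g v"
  shows "f = g"
  using assms by (auto simp: lin_hom_def intro: extensionalityI)

lemma module_closed:
  assumes "module R M"
  shows "\<lbrakk>x \<in> carrier M; y \<in> carrier M\<rbrakk> \<Longrightarrow> x \<oplus>\<^bsub>M\<^esub> y \<in> carrier M"
    and "\<lbrakk>r \<in> carrier R; x \<in> carrier M\<rbrakk> \<Longrightarrow> r \<odot>\<^bsub>M\<^esub> x \<in> carrier M"
    and "\<lbrakk>r \<in> carrier R; x \<in> carrier M; y \<in> carrier M\<rbrakk> \<Longrightarrow> r \<odot>\<^bsub>M\<^esub> (x \<oplus>\<^bsub>M\<^esub> y) = r \<odot>\<^bsub>M\<^esub> x \<oplus>\<^bsub>M\<^esub> r \<odot>\<^bsub>M\<^esub> y"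
    and "\<lbrakk>r \<in> carrier R; s \<in> carrier R; x \<in> carrier M\<rbrakk> \<Longrightarrow> r \<odot>\<^bsub>M\<^esub> (s \<odot>\<^bsub>M\<^esub> x) = s \<odot>\<^bsub>M\<^esub> (r \<odot>\<^bsub>M\<^esub> x)"
    and "\<lbrakk>w \<in> carrier M; x \<in> carrier M; y \<in> carrier M; z \<in> carrier M\<rbrakk> \<Longrightarrow>
      (w \<oplus>\<^bsub>M\<^esub> x) \<oplus>\<^bsub>M\<^esub> (y \<oplus>\<^bsub>M\<^esub> z) = (w \<oplus>\<^bsub>M\<^esub> y) \<oplus>\<^bsub>M\<^esub> (x \<oplus>\<^bsub>M\<^esub> z)"
proof -
  interpret module R M by fact
  show "\<lbrakk>x \<in> carrier M; y \<in> carrier M\<rbrakk> \<Longrightarrow> x \<oplus>\<^bsub>M\<^esub> y \<in> carrier M"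
    "\<lbrakk>r \<in> carrier R; x \<in> carrier M\<rbrakk> \<Longrightarrow> r \<odot>\<^bsub>M\<^esub> x \<in> carrier M"
    "\<lbrakk>r \<in> carrier R; x \<in> carrier M; y \<in> carrier M\<rbrakk> \<Longrightarrow> r \<odot>\<^bsub>M\<^esub> (x \<oplus>\<^bsub>M\<^esub> y) = r \<odot>\<^bsub>M\<^esub> x \<oplus>\<^bsub>M\<^esub> r \<odot>\<^bsub>M\<^esub> y"
    by (auto simp: smult_r_distr)
  show "\<lbrakk>r \<in> carrier R; s \<in> carrier R; x \<in> carrier M\<rbrakk> \<Longrightarrow> r \<odot>\<^bsub>M\<^esub> (s \<odot>\<^bsub>M\<^esub> x) = s \<odot>\<^bsub>M\<^esub> (r \<odot>\<^bsub>M\<^esub> x)"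
    by (simp add: smult_assoc1[symmetric] R.m_comm)
  show "\<lbrakk>w \<in> carrier M; x \<in> carrier M; y \<in> carrier M; z \<in> carrier M\<rbrakk> \<Longrightarrow>
      (w \<oplus>\<^bsub>M\<^esub> x) \<oplus>\<^bsub>M\<^esub> (y \<oplus>\<^bsub>M\<^esub> z) = (w \<oplus>\<^bsub>M\<^esub> y) \<oplus>\<^bsub>M\<^esub> (x \<oplus>\<^bsub>M\<^esub> z)"
    by (simp add: M.a_ac)
qed

lemma bilinear_mapI:
  assumes "\<And>v. v \<in> carrier V \<Longrightarrow> linear_map R W M (b v)"
    and "\<And>w. w \<in> carrier W \<Longrightarrow> linear_map R V M (\<lambda>v. b v w)"
  shows "bilinear_map R V W M b"
  using assms by (simp add: bilinear_map_def)

lemma bilinear_mapD: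
  assumes "bilinear_map R V W M b"
  shows "v \<in> carrier V \<Longrightarrow> linear_map R W M (b v)"
    and "w \<in> carrier W \<Longrightarrow> linear_map R V M (\<lambda>v. b v w)"
    and "\<lbrakk>v \<in> carrier V; w \<in> carrier W\<rbrakk> \<Longrightarrow> b v w \<in> carrier M"
    and "\<lbrakk>v \<in> carrier V; v' \<in> carrier V; w \<in> carrier W\<rbrakk> \<Longrightarrow> b (v \<oplus>\<^bsub>V\<^esub> v') w = b v w \<oplus>\<^bsub>M\<^esub> b v' w"
    and "\<lbrakk>v \<in> carrier V; w \<in> carrier W; w' \<in> carrier W\<rbrakk> \<Longrightarrow> b v (w \<oplus>\<^bsub>W\<^esub> w') = b v w \<oplus>\<^bsub>M\<^esub> b v w'"
    and "\<lbrakk>r \<in> carrier R; v \<in> carrier V; w \<in> carrier W\<rbrakk> \<Longrightarrow> b (r \<odot>\<^bsub>V\<^esub> v) w = r \<odot>\<^bsub>M\<^esub> b v w"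
    and "\<lbrakk>r \<in> carrier R; v \<in> carrier V; w \<in> carrier W\<rbrakk> \<Longrightarrow> b v (r \<odot>\<^bsub>W\<^esub> w) = r \<odot>\<^bsub>M\<^esub> b v w"
  using assms by (auto simp: bilinear_map_def linear_map_def Pi_iff)

lemma bilinear_map_compose:
  assumes "bilinear_map R X Y M b" "linear_map R V X f" "linear_map R W Y g"
  shows "bilinear_map R V W M (\<lambda>v w. b (f v) (g w))"
  using assms by (auto simp: bilinear_map_def linear_map_def Pi_iff)

lemma bilinear_pure_tensor:
  assumes "module R V" "module R W"
  shows "bilinear_map R V W (tensor_mod R V W) (pure_tensor R V W)"
  using assms
  by (auto intro!: bilinear_mapI linear_mapI
      simp: pure_tensor_add_left pure_tensor_add_right smult_pure_tensor pure_tensor_smult_right)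

lemma linear_map_id: "linear_map R V V (\<lambda>x. x)"
  by (simp add: linear_map_def)

text \<open>Iterated tensor products and actions are lifts of maps that are themselves lifts depending on a
  parameter; bilinearity of the outer map amounts to linear dependence on the parameter.\<close>

lemma linear_lift_param:
  assumes m: "module R V" "module R W" "module R M" "module R A"
    and b: "\<And>a. a \<in> carrier A \<Longrightarrow> bilinear_map R V W M (b a)"
    and l: "\<And>v w. \<lbrakk>v \<in> carrier V; w \<in> carrier W\<rbrakk> \<Longrightarrow> linear_map R A M (\<lambda>a. b a v w)"
    and t: "t \<in> carrier (tensor_mod R V W)"
  shows "linear_map R A M (\<lambda>a. tensor_lift R V W M (b a) t)"
  using m(1,2) t
proof (induction rule: pure_tensor_induct)
  case (pure v w)
  then show ?case
    using l[OF pure] by (subst linear_map_cong[OF m(4)]) (auto simp: lift_pure m b)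
next
  case (add x y)
  note lin = lift_in_lin_hom[OF m(1-3) b, THEN lin_homD(1)]
  have "linear_map R A M (\<lambda>a. tensor_lift R V W M (b a) x \<oplus>\<^bsub>M\<^esub> tensor_lift R V W M (b a) y)"
    using add.IH add.hyps linear_mapD(1)[OF lin]
    by (auto simp: linear_map_def Pi_iff module_closed[OF m(3)])
  then show ?case
    using add.hyps by (subst linear_map_cong[OF m(4)]) (auto simp: linear_mapD(2)[OF lin])
qed

lemma bilinear_lift_param:
  assumes "module R V" "module R W" "module R M" "module R A"
    and "\<And>a. a \<in> carrier A \<Longrightarrow> bilinear_map R V W M (b a)"
    and "\<And>v w. \<lbrakk>v \<in> carrier V; w \<in> carrier W\<rbrakk> \<Longrightarrow> linear_map R A M (\<lambda>a. b a v w)"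
  shows "bilinear_map R A (tensor_mod R V W) M (\<lambda>a. tensor_lift R V W M (b a))"
    and "bilinear_map R (tensor_mod R V W) A M (\<lambda>t a. tensor_lift R V W M (b a) t)"
  by (rule bilinear_mapI; rule linear_lift_param[OF assms] lift_in_lin_hom[THEN lin_homD(1)]; simp add: assms)+

section \<open>Tensor products of maps and of actions\<close>

lemma tensor_map_aux:
  assumes m: "module R V" "module R W" "module R X" "module R Y"
    and f: "linear_map R V X f" and g: "linear_map R W Y g"
  shows tensor_map_in_lin_hom: "tensor_map R V W X Y f g \<in> lin_hom R (tensor_mod R V W) (tensor_mod R X Y)"
    and tensor_map_pure: "\<lbrakk>v \<in> carrier V; w \<in> carrier W\<rbrakk> \<Longrightarrow>
      tensor_map R V W X Y f g (pure_tensor R V W v w) = pure_tensor R X Y (f v) (g w)"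
  unfolding tensor_map_def
  using m bilinear_map_compose[OF bilinear_pure_tensor[OF m(3,4)] f g]
  by (auto intro: lift_in_lin_hom simp: lift_pure)

lemmas tensor_map_linear = tensor_map_in_lin_hom[THEN lin_homD(1)]
lemmas tensor_map_closed = linear_mapD(1)[OF tensor_map_linear]
lemmas tensor_map_add = linear_mapD(2)[OF tensor_map_linear]

lemma tensor_map_cong:
  assumes "\<And>v. v \<in> carrier V \<Longrightarrow> f v = f' v" and "\<And>w. w \<in> carrier W \<Longrightarrow> g w = g' w"
  shows "tensor_map R V W X Y f g = tensor_map R V W X Y f' g'"
  unfolding tensor_map_def tensor_lift_def using assms by (simp cong: ball_cong)

lemma tensor_map_compose:
  assumes m: "module R V" "module R W" "module R X" "module R Y" "module R X'" "module R Y'"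
    and f: "linear_map R V X f" and g: "linear_map R W Y g"
    and f': "linear_map R X X' f'" and g': "linear_map R Y Y' g'"
    and t: "t \<in> carrier (tensor_mod R V W)"
  shows "tensor_map R X Y X' Y' f' g' (tensor_map R V W X Y f g t)
    = tensor_map R V W X' Y' (\<lambda>v. f' (f v)) (\<lambda>w. g' (g w)) t"
  using m(1,2) t
proof (induction rule: pure_tensor_induct)
  case (pure v w)
  then show ?case
    by (simp add: m f g f' g' tensor_map_pure linear_mapD(1)[OF f] linear_mapD(1)[OF g]
        linear_map_compose[OF f f'] linear_map_compose[OF g g'])
next
  case (add x y)
  then show ?case
    by (simp add: m f g f' g' tensor_map_add tensor_map_closed
        linear_map_compose[OF f f'] linear_map_compose[OF g g'])
qed

lemma tensor_map_id:
  assumes m: "module R V" "module R W"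
  shows "tensor_map R V W V W (\<lambda>v. v) (\<lambda>w. w) = (\<lambda>t\<in>carrier (tensor_mod R V W). t)"
  unfolding tensor_map_def
proof (rule tensor_product.lift_eqI[OF tensor_product.intro])
  interpret T: module R "tensor_mod R V W" using m by simp
  show "(\<lambda>t\<in>carrier (tensor_mod R V W). t) \<in> lin_hom R (tensor_mod R V W) (tensor_mod R V W)"
    by (auto simp: lin_hom_def linear_map_def)
qed (use m in \<open>auto intro: bilinear_pure_tensor\<close>)

lemma tensor_act_aux:
  assumes m: "module R A" "module R B" "module R V" "module R W"
    and r: "bilinear_map R A V V \<rho>" and s: "bilinear_map R B W W \<sigma>"
  shows bilinear_tensor_act:
      "bilinear_map R (tensor_mod R A B) (tensor_mod R V W) (tensor_mod R V W) (tensor_act R A B V W \<rho> \<sigma>)"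
    and tensor_act_pure_left: "\<lbrakk>a \<in> carrier A; b \<in> carrier B; x \<in> carrier (tensor_mod R V W)\<rbrakk> \<Longrightarrow>
      tensor_act R A B V W \<rho> \<sigma> (pure_tensor R A B a b) x = tensor_map R V W V W (\<rho> a) (\<sigma> b) x"
    and tensor_act_pure: "\<lbrakk>a \<in> carrier A; b \<in> carrier B; v \<in> carrier V; w \<in> carrier W\<rbrakk> \<Longrightarrow>
      tensor_act R A B V W \<rho> \<sigma> (pure_tensor R A B a b) (pure_tensor R V W v w)
        = pure_tensor R V W (\<rho> a v) (\<sigma> b w)"
proof -
  let ?T = "tensor_mod R V W"
  note rl = bilinear_mapD(1)[OF r] and sl = bilinear_mapD(1)[OF s]
  have pb: "bilinear_map R V W ?T (\<lambda>v w. pure_tensor R V W (\<rho> a v) (\<sigma> b w))"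
    if "a \<in> carrier A" "b \<in> carrier B" for a b
    using bilinear_map_compose[OF bilinear_pure_tensor[OF m(3,4)] rl sl] that by blast
  have bil: "bilinear_map R A B ?T (\<lambda>a b. tensor_map R V W V W (\<rho> a) (\<sigma> b) x)"
    if x: "x \<in> carrier ?T" for x
  proof (rule bilinear_mapI)
    fix a assume a: "a \<in> carrier A"
    show "linear_map R B ?T (\<lambda>b. tensor_map R V W V W (\<rho> a) (\<sigma> b) x)"
      unfolding tensor_map_def
      using a x m pb by (intro linear_lift_param)
        (auto intro!: linear_map_compose[OF bilinear_mapD(2)[OF s]
           bilinear_mapD(1)[OF bilinear_pure_tensor[OF m(3,4)]]] bilinear_mapD(3)[OF r])
  next
    fix b assume b: "b \<in> carrier B"
    show "linear_map R A ?T (\<lambda>a. tensor_map R V W V W (\<rho> a) (\<sigma> b) x)"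
      unfolding tensor_map_def
      using b x m pb by (intro linear_lift_param)
        (auto intro!: linear_map_compose[OF bilinear_mapD(2)[OF r]
           bilinear_mapD(2)[OF bilinear_pure_tensor[OF m(3,4)]]] bilinear_mapD(3)[OF s])
  qed
  have lin: "linear_map R ?T ?T (\<lambda>x. tensor_map R V W V W (\<rho> a) (\<sigma> b) x)"
    if "a \<in> carrier A" "b \<in> carrier B" for a b
    using tensor_map_linear[OF m(3,4) m(3,4) rl sl] that by blast
  show "bilinear_map R (tensor_mod R A B) ?T ?T (tensor_act R A B V W \<rho> \<sigma>)"
    unfolding tensor_act_def
    using m bil lin by (intro bilinear_lift_param(2)) auto
  show pl: "tensor_act R A B V W \<rho> \<sigma> (pure_tensor R A B a b) x = tensor_map R V W V W (\<rho> a) (\<sigma> b) x"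
    if "a \<in> carrier A" "b \<in> carrier B" "x \<in> carrier (tensor_mod R V W)" for a b x
    using m that bil unfolding tensor_act_def by (simp add: lift_pure)
  show "tensor_act R A B V W \<rho> \<sigma> (pure_tensor R A B a b) (pure_tensor R V W v w)
        = pure_tensor R V W (\<rho> a v) (\<sigma> b w)"
    if "a \<in> carrier A" "b \<in> carrier B" "v \<in> carrier V" "w \<in> carrier W" 
    using that m by (simp add: pl tensor_map_pure rl sl)
qed

lemmas tensor_act_closed = bilinear_mapD(3)[OF bilinear_tensor_act]
lemmas tensor_act_add = bilinear_mapD(4,5)[OF bilinear_tensor_act]

text \<open>Left \<open>H\<close>-modules, the action of \<open>H \<otimes> H\<close> on \<open>V \<otimes> W\<close> and on \<open>Hom(V, W)\<close>, and an algebra acting on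
  itself by left multiplication are all instances. The action is a separate argument, not a field
  of a record, because one module carries several of them.\<close>

definition algebra_action ::
    "('k, 'r) ring_scheme \<Rightarrow> ('k, 'a, 'm) module_scheme \<Rightarrow> ('k, 'v, 'n) module_scheme
      \<Rightarrow> ('a \<Rightarrow> 'v \<Rightarrow> 'v) \<Rightarrow> bool"
  where "algebra_action R A V \<rho> \<longleftrightarrow> module R V \<and> bilinear_map R A V V \<rho> \<and>
    (\<forall>a\<in>carrier A. \<forall>b\<in>carrier A. \<forall>v\<in>carrier V. \<rho> (a \<otimes>\<^bsub>A\<^esub> b) v = \<rho> a (\<rho> b v)) \<and>
    (\<forall>v\<in>carrier V. \<rho> \<one>\<^bsub>A\<^esub> v = v)"

lemma algebra_actionD:
  assumes "algebra_action R A V \<rho>"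
  shows "module R V" and "bilinear_map R A V V \<rho>"
    and "\<lbrakk>a \<in> carrier A; b \<in> carrier A; v \<in> carrier V\<rbrakk> \<Longrightarrow> \<rho> (a \<otimes>\<^bsub>A\<^esub> b) v = \<rho> a (\<rho> b v)"
    and "v \<in> carrier V \<Longrightarrow> \<rho> \<one>\<^bsub>A\<^esub> v = v"
    and "\<lbrakk>a \<in> carrier A; v \<in> carrier V\<rbrakk> \<Longrightarrow> \<rho> a v \<in> carrier V"
  using assms by (auto simp: algebra_action_def bilinear_mapD(3))

lemma unital_algebraD:
  assumes "unital_algebra R A"
  shows "cring R" "ring A" "module R A"
    and "\<lbrakk>r \<in> carrier R; a \<in> carrier A; b \<in> carrier A\<rbrakk> \<Longrightarrow> (r \<odot>\<^bsub>A\<^esub> a) \<otimes>\<^bsub>A\<^esub> b = r \<odot>\<^bsub>A\<^esub> (a \<otimes>\<^bsub>A\<^esub> b)"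
    and "\<lbrakk>r \<in> carrier R; a \<in> carrier A; b \<in> carrier A\<rbrakk> \<Longrightarrow> a \<otimes>\<^bsub>A\<^esub> (r \<odot>\<^bsub>A\<^esub> b) = r \<odot>\<^bsub>A\<^esub> (a \<otimes>\<^bsub>A\<^esub> b)"
  using assms by (auto simp: unital_algebra_def)

lemma algebra_action_mult:
  assumes A: "unital_algebra R A"
  shows "algebra_action R A A (monoid.mult A)"
proof -
  interpret ring A using unital_algebraD(2)[OF A] .
  show ?thesis
    using unital_algebraD[OF A] unfolding algebra_action_def
    by (auto simp: bilinear_map_def linear_map_def l_distr r_distr m_assoc)
qed

lemma bilinear_mult: "unital_algebra R A \<Longrightarrow> bilinear_map R A A A (monoid.mult A)"
  using algebra_action_mult algebra_actionD(2) by blast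

section \<open>The tensor product of algebras\<close>

lemma tensor_alg_sel [simp]:
  "carrier (tensor_alg R A B) = carrier (tensor_mod R A B)"
  "add (tensor_alg R A B) = add (tensor_mod R A B)"
  "ring.zero (tensor_alg R A B) = ring.zero (tensor_mod R A B)"
  "smult (tensor_alg R A B) = smult (tensor_mod R A B)"
  by (simp_all add: tensor_alg_def)

lemma module_cong:
  assumes M: "module R M" and eq: "carrier M' = carrier M" "add M' = add M" "ring.zero M' = ring.zero M" "smult M' = smult M"
  shows "module R M'"
proof -
  interpret module R M by (rule M)
  show ?thesis
    by (intro moduleI abelian_groupI)
      (auto simp: eq is_cring M.a_ac smult_l_distr smult_r_distr smult_assoc1 intro: M.l_neg)
qed

lemma module_tensor_alg [simp]:
  "\<lbrakk>module R A; module R B\<rbrakk> \<Longrightarrow> module R (tensor_alg R A B)"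
  by (rule module_cong[of R "tensor_mod R A B"]) auto

lemma one_tensor_alg: "\<one>\<^bsub>tensor_alg R A B\<^esub> = pure_tensor R A B \<one>\<^bsub>A\<^esub> \<one>\<^bsub>B\<^esub>"
  and mult_tensor_alg: "monoid.mult (tensor_alg R A B) = tensor_act R A B A B (monoid.mult A) (monoid.mult B)"
  by (simp_all add: tensor_alg_def)

lemma mult_pure_tensor:
  assumes "unital_algebra R A" "unital_algebra R B"
    "a \<in> carrier A" "a' \<in> carrier A" "b \<in> carrier B" "b' \<in> carrier B"
  shows "pure_tensor R A B a b \<otimes>\<^bsub>tensor_alg R A B\<^esub> pure_tensor R A B a' b'
    = pure_tensor R A B (a \<otimes>\<^bsub>A\<^esub> a') (b \<otimes>\<^bsub>B\<^esub> b')"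
  using assms by (simp add: mult_tensor_alg tensor_act_pure bilinear_mult unital_algebraD)

text \<open>Applied to the left multiplications of \<open>A\<close> and \<open>B\<close>, the action law in the conclusion is
  the associativity of \<open>A \<otimes> B\<close>; that is why it is proved for arbitrary actions before
  \<open>A \<otimes> B\<close> is known to be a ring.\<close>

lemma algebra_action_tensor:
  assumes A: "unital_algebra R A" and B: "unital_algebra R B"
    and r: "algebra_action R A V \<rho>" and s: "algebra_action R B W \<sigma>"
  shows "algebra_action R (tensor_alg R A B) (tensor_mod R V W) (tensor_act R A B V W \<rho> \<sigma>)"
proof -
  interpret A: ring A using unital_algebraD(2)[OF A] .
  interpret B: ring B using unital_algebraD(2)[OF B] .
  note m = unital_algebraD(3)[OF A] unital_algebraD(3)[OF B] algebra_actionD(1)[OF r] algebra_actionD(1)[OF s]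
  note rb = algebra_actionD(2)[OF r] and sb = algebra_actionD(2)[OF s]
  let ?V = "tensor_mod R V W" and ?A = "tensor_mod R A B" and ?t = "tensor_act R A B V W \<rho> \<sigma>"
  interpret mV: module R ?V using m by simp
  have [simp]: "bilinear_map R A A A (monoid.mult A)" "bilinear_map R B B B (monoid.mult B)"
    using A B by (simp_all add: bilinear_mult)
  note ta = tensor_act_closed[OF m rb sb] tensor_act_add[OF m rb sb]
  note tm = tensor_act_closed[OF m(1,2) m(1,2)] tensor_act_add[OF m(1,2) m(1,2)]
  note cl = algebra_actionD(5)[OF r] algebra_actionD(5)[OF s]
  have assoc: "?t (a \<otimes>\<^bsub>tensor_alg R A B\<^esub> b) v = ?t a (?t b v)"
    if a: "a \<in> carrier ?A" and b: "b \<in> carrier ?A" and v: "v \<in> carrier ?V" for a b v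
    using m(1,2) a
  proof (induction rule: pure_tensor_induct)
    case (pure a1 a2)
    show ?case using m(1,2) b
    proof (induction rule: pure_tensor_induct)
      case (pure b1 b2)
      show ?case using m(3,4) v
      proof (induction rule: pure_tensor_induct)
        case (pure v w)
        with \<open>a1 \<in> _\<close> \<open>a2 \<in> _\<close> \<open>b1 \<in> _\<close> \<open>b2 \<in> _\<close> show ?case
          by (simp add: mult_pure_tensor A B tensor_act_pure m rb sb cl
             algebra_actionD(3)[OF r] algebra_actionD(3)[OF s])
      next
        case (add x y)
        with \<open>a1 \<in> _\<close> \<open>a2 \<in> _\<close> \<open>b1 \<in> _\<close> \<open>b2 \<in> _\<close> show ?case
          by (simp add: mult_tensor_alg ta tm m)
      qed
    next
      case (add x y)
      with v \<open>a1 \<in> _\<close> \<open>a2 \<in> _\<close> show ?case by (simp add: mult_tensor_alg ta tm m)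
    qed
  next
    case (add x y)
    with v b show ?case by (simp add: mult_tensor_alg ta tm m)
  qed
  have unit: "?t \<one>\<^bsub>tensor_alg R A B\<^esub> v = v" if v: "v \<in> carrier ?V" for v
    using m(3,4) v
    by (induction rule: pure_tensor_induct)
      (auto simp: one_tensor_alg tensor_act_pure m rb sb ta algebra_actionD(4)[OF r] algebra_actionD(4)[OF s])
  show ?thesis
    using assoc unit bilinear_tensor_act[OF m rb sb] m
    by (auto simp: algebra_action_def bilinear_map_def linear_map_def)
qed

lemma unital_algebra_tensor [simp]:
  assumes A: "unital_algebra R A" and B: "unital_algebra R B"
  shows "unital_algebra R (tensor_alg R A B)"
proof -
  interpret A: ring A using unital_algebraD(2)[OF A] .
  interpret B: ring B using unital_algebraD(2)[OF B] .
  let ?T = "tensor_alg R A B"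
  note m = unital_algebraD(3)[OF A] unital_algebraD(3)[OF B]
  note act = algebra_action_tensor[OF A B algebra_action_mult[OF A] algebra_action_mult[OF B],
      folded mult_tensor_alg]
  note bD = bilinear_mapD[OF algebra_actionD(2)[OF act], simplified]
  interpret T: module R ?T using m by simp
  have ro: "x \<otimes>\<^bsub>?T\<^esub> \<one>\<^bsub>?T\<^esub> = x" if "x \<in> carrier ?T" for x
    using m that[simplified]
  proof (induction rule: pure_tensor_induct)
    case (pure v w) then show ?case by (simp add: one_tensor_alg mult_pure_tensor A B)
  next
    case (add x y) then show ?case using m by (simp add: bD one_tensor_alg)
  qed
  have "ring ?T"
    using bD algebra_actionD[OF act] ro m
    by (intro ringI T.abelian_group_axioms monoidI) (auto simp: one_tensor_alg)
  then show ?thesis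
    using bD T.module_axioms unital_algebraD(1)[OF A] by (auto simp: unital_algebra_def)
qed

section \<open>Independence of the surrounding record\<close>

text \<open>The tensor constructions depend only on these three fields. The same underlying module occurs as a
  plain module, as an algebra, as an \<open>H\<close>-module and inside the twisted algebra, and the congruence
  rules that follow identify the tensor products formed from these variants.\<close>

definition same_module ::
    "('k, 'v, 'm) module_scheme \<Rightarrow> ('k, 'v, 'n) module_scheme \<Rightarrow> bool"
  where "same_module V V' \<longleftrightarrow> carrier V = carrier V' \<and> add V = add V' \<and> smult V = smult V'"

lemma same_module_refl [simp]: "same_module V V"
  by (simp add: same_module_def)

lemma same_module_tensor_alg [simp]: "same_module (tensor_alg R A B) (tensor_mod R A B)"
  by (simp add: same_module_def)

lemma tensor_cong:
  assumes "same_module V V'" "same_module W W'"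
  shows tensor_mod_cong: "tensor_mod R V W = tensor_mod R V' W'"
    and pure_tensor_cong: "pure_tensor R V W = pure_tensor R V' W'"
proof -
  have "tensor_relations R V W = tensor_relations R V' W'"
    using assms by (simp add: same_module_def tensor_relations_def)
  then have k: "tensor_kernel R V W = tensor_kernel R V' W'"
    using assms by (simp add: same_module_def tensor_kernel_def)
  then have c: "tensor_class R V W = tensor_class R V' W'"
    using assms by (simp add: same_module_def tensor_class_def fun_eq_iff)
  show "tensor_mod R V W = tensor_mod R V' W'"
    using assms k c by (simp add: same_module_def tensor_mod_def)
  show "pure_tensor R V W = pure_tensor R V' W'"
    using c by (simp add: pure_tensor_def fun_eq_iff)
qed

lemma lin_hom_cong:
  assumes "same_module V V'" "same_module W W'"
  shows "lin_hom R V W = lin_hom R V' W'"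
  using assms by (simp_all add: same_module_def lin_hom_def linear_map_def fun_eq_iff)

lemma tensor_lift_cong:
  assumes "same_module V V'" "same_module W W'" "same_module M M'"
  shows "tensor_lift R V W M = tensor_lift R V' W' M'"
  unfolding tensor_lift_def tensor_cong[OF assms(1,2)] lin_hom_cong[OF same_module_refl assms(3)]
  using assms by (simp add: same_module_def)

lemma tensor_map_module_cong:
  assumes "same_module V V'" "same_module W W'" "same_module X X'" "same_module Y Y'"
  shows "tensor_map R V W X Y = tensor_map R V' W' X' Y'"
  by (intro ext) (simp add: tensor_map_def tensor_lift_cong[OF assms(1,2) same_module_refl]
      tensor_cong[OF assms(3,4)])

lemma tensor_reassoc_cong:
  assumes "same_module U U'" "same_module V V'" "same_module W W'"
  shows "tensor_reassoc R U V W = tensor_reassoc R U' V' W'"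
  by (simp add: tensor_reassoc_def tensor_cong[OF assms(2,3)]
      tensor_cong[OF assms(1) same_module_refl] tensor_cong[OF same_module_refl assms(2)]
      tensor_lift_cong[OF same_module_refl assms(3) same_module_refl]
      tensor_lift_cong[OF assms(1,2) same_module_refl])

lemma tensor_act_cong:
  assumes "same_module A A'" "same_module B B'" "same_module V V'" "same_module W W'"
  shows "tensor_act R A B V W = tensor_act R A' B' V' W'"
  by (intro ext) (simp add: tensor_act_def tensor_lift_cong[OF assms(1,2) same_module_refl]
      tensor_map_module_cong[OF assms(3,4,3,4)] tensor_cong[OF assms(3,4)])

lemma tensor_alg_cong:
  assumes "same_module A A'" "same_module B B'"
    "monoid.mult A = monoid.mult A'" "monoid.mult B = monoid.mult B'" "one A = one A'" "one B = one B'"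
  shows "tensor_alg R A B = tensor_alg R A' B'"
  by (simp add: tensor_alg_def assms(3-) tensor_cong[OF assms(1,2)]
      tensor_act_cong[OF assms(1,2) assms(1,2)])

lemmas tensor_flatten =
  tensor_mod_cong[OF same_module_tensor_alg same_module_refl]
  tensor_mod_cong[OF same_module_refl same_module_tensor_alg]
  pure_tensor_cong[OF same_module_tensor_alg same_module_refl]
  pure_tensor_cong[OF same_module_refl same_module_tensor_alg]

section \<open>Rebracketing and algebra homomorphisms\<close>

lemma tensor_reassoc_aux:
  assumes m: "module R U" "module R V" "module R W"
  shows tensor_reassoc_in_lin_hom: "tensor_reassoc R U V W \<in>
      lin_hom R (tensor_mod R (tensor_mod R U V) W) (tensor_mod R U (tensor_mod R V W))"
    and tensor_reassoc_pure: "\<lbrakk>u \<in> carrier U; v \<in> carrier V; w \<in> carrier W\<rbrakk> \<Longrightarrow>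
      tensor_reassoc R U V W (pure_tensor R (tensor_mod R U V) W (pure_tensor R U V u v) w) =
        pure_tensor R U (tensor_mod R V W) u (pure_tensor R V W v w)"
proof -
  let ?VW = "tensor_mod R V W"
  let ?T = "tensor_mod R U ?VW"
  let ?b = "\<lambda>w u v. pure_tensor R U ?VW u (pure_tensor R V W v w)"
  have p: "bilinear_map R V W ?VW (pure_tensor R V W)" "bilinear_map R U ?VW ?T (pure_tensor R U ?VW)"
    using m by (simp_all add: bilinear_pure_tensor)
  have b: "bilinear_map R U V ?T (?b w)" if "w \<in> carrier W" for w
    using bilinear_map_compose[OF p(2) linear_map_id bilinear_mapD(2)[OF p(1)]] that by blast
  have l: "linear_map R W ?T (\<lambda>w. ?b w u v)" if "u \<in> carrier U" "v \<in> carrier V" for u v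
    using linear_map_compose[OF bilinear_mapD(1)[OF p(1)] bilinear_mapD(1)[OF p(2)]] that by blast
  have bil: "bilinear_map R (tensor_mod R U V) W ?T (\<lambda>t w. tensor_lift R U V ?T (?b w) t)"
    using m b l by (intro bilinear_lift_param(2)) auto
  show "tensor_reassoc R U V W \<in> lin_hom R (tensor_mod R (tensor_mod R U V) W) (tensor_mod R U (tensor_mod R V W))"
    unfolding tensor_reassoc_def Let_def using m bil by (intro lift_in_lin_hom) auto
  show "tensor_reassoc R U V W (pure_tensor R (tensor_mod R U V) W (pure_tensor R U V u v) w) =
        pure_tensor R U (tensor_mod R V W) u (pure_tensor R V W v w)"
    if "u \<in> carrier U" "v \<in> carrier V" "w \<in> carrier W"
    unfolding tensor_reassoc_def Let_def using m bil b that by (simp add: lift_pure)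
qed

lemmas tensor_reassoc_linear = tensor_reassoc_in_lin_hom[THEN lin_homD(1)]
lemmas tensor_reassoc_closed = linear_mapD(1)[OF tensor_reassoc_linear]
lemmas tensor_reassoc_add = linear_mapD(2)[OF tensor_reassoc_linear]

lemma tensor_reassoc_pure_alg:
  "\<lbrakk>module R U; module R V; module R W; u \<in> carrier U; v \<in> carrier V; w \<in> carrier W\<rbrakk> \<Longrightarrow>
      tensor_reassoc R U V W (pure_tensor R (tensor_alg R U V) W (pure_tensor R U V u v) w) =
        pure_tensor R U (tensor_alg R V W) u (pure_tensor R V W v w)"
  by (simp add: tensor_flatten tensor_reassoc_pure)

lemma algebra_homD:
  assumes "algebra_hom R A B f"
  shows "linear_map R A B f"
    and "x \<in> carrier A \<Longrightarrow> f x \<in> carrier B"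
    and "\<lbrakk>x \<in> carrier A; y \<in> carrier A\<rbrakk> \<Longrightarrow> f (x \<oplus>\<^bsub>A\<^esub> y) = f x \<oplus>\<^bsub>B\<^esub> f y"
    and "\<lbrakk>x \<in> carrier A; y \<in> carrier A\<rbrakk> \<Longrightarrow> f (x \<otimes>\<^bsub>A\<^esub> y) = f x \<otimes>\<^bsub>B\<^esub> f y"
    and "f \<one>\<^bsub>A\<^esub> = \<one>\<^bsub>B\<^esub>"
  using assms by (auto simp: algebra_hom_def linear_map_def Pi_iff)

lemma algebra_hom_id: "algebra_hom R A A (\<lambda>x. x)"
  by (simp add: algebra_hom_def linear_map_id)

lemma algebra_hom_compose:
  "\<lbrakk>algebra_hom R A B f; algebra_hom R B C g\<rbrakk> \<Longrightarrow> algebra_hom R A C (\<lambda>x. g (f x))"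
  by (auto simp: algebra_hom_def linear_map_def Pi_iff)

text \<open>A linear map on \<open>A \<otimes> B\<close> is multiplicative if it is so on pure tensors, both sides of the law being
  biadditive.\<close>

lemma algebra_hom_tensorI:
  assumes A: "unital_algebra R A" and B: "unital_algebra R B" and C: "unital_algebra R C"
    and f: "linear_map R (tensor_mod R A B) C f"
    and one: "f (pure_tensor R A B \<one>\<^bsub>A\<^esub> \<one>\<^bsub>B\<^esub>) = \<one>\<^bsub>C\<^esub>"
    and mult: "\<And>a a' b b'. \<lbrakk>a \<in> carrier A; a' \<in> carrier A; b \<in> carrier B; b' \<in> carrier B\<rbrakk> \<Longrightarrow>
      f (pure_tensor R A B (a \<otimes>\<^bsub>A\<^esub> a') (b \<otimes>\<^bsub>B\<^esub> b')) =
        f (pure_tensor R A B a b) \<otimes>\<^bsub>C\<^esub> f (pure_tensor R A B a' b')"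
  shows "algebra_hom R (tensor_alg R A B) C f"
proof -
  interpret C: ring C using unital_algebraD(2)[OF C] .
  interpret T: ring "tensor_alg R A B" using unital_algebraD(2)[OF unital_algebra_tensor[OF A B]] .
  note m = unital_algebraD(3)[OF A] unital_algebraD(3)[OF B]
  note Tcl = T.m_closed[simplified] T.l_distr[simplified] T.r_distr[simplified]
  have "f (x \<otimes>\<^bsub>tensor_alg R A B\<^esub> y) = f x \<otimes>\<^bsub>C\<^esub> f y"
    if x: "x \<in> carrier (tensor_mod R A B)" and y: "y \<in> carrier (tensor_mod R A B)" for x y
    using m x
  proof (induction rule: pure_tensor_induct)
    case (pure a b)
    show ?case using m y
    proof (induction rule: pure_tensor_induct)
      case (pure a' b')
      with \<open>a \<in> _\<close> \<open>b \<in> _\<close> show ?case by (simp add: mult_pure_tensor A B mult)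
    next
      case (add u v)
      with \<open>a \<in> _\<close> \<open>b \<in> _\<close> show ?case
        by (simp add: linear_mapD[OF f] Tcl m C.r_distr)
    qed
  next
    case (add u v)
    with y show ?case by (simp add: linear_mapD[OF f] Tcl m C.l_distr)
  qed
  moreover have "linear_map R (tensor_alg R A B) C f"
    using f by (simp add: linear_map_def)
  ultimately show ?thesis using one by (simp add: algebra_hom_def one_tensor_alg)
qed

lemma algebra_hom_tensor_map:
  assumes A: "unital_algebra R A" and B: "unital_algebra R B" and C: "unital_algebra R C" and D: "unital_algebra R D"
    and f: "algebra_hom R A C f" and g: "algebra_hom R B D g"
  shows "algebra_hom R (tensor_alg R A B) (tensor_alg R C D) (tensor_map R A B C D f g)"
proof (rule algebra_hom_tensorI[OF A B unital_algebra_tensor[OF C D]])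
  interpret A: ring A using unital_algebraD(2)[OF A] .
  interpret B: ring B using unital_algebraD(2)[OF B] .
  note m = unital_algebraD(3)[OF A] unital_algebraD(3)[OF B] unital_algebraD(3)[OF C] unital_algebraD(3)[OF D]
  note tm = tensor_map_linear[OF m algebra_homD(1)[OF f] algebra_homD(1)[OF g]]
    tensor_map_pure[OF m algebra_homD(1)[OF f] algebra_homD(1)[OF g]]
  show "linear_map R (tensor_mod R A B) (tensor_alg R C D) (tensor_map R A B C D f g)"
    using tm(1) by (simp add: linear_map_def)
  show "tensor_map R A B C D f g (pure_tensor R A B \<one>\<^bsub>A\<^esub> \<one>\<^bsub>B\<^esub>) = \<one>\<^bsub>tensor_alg R C D\<^esub>"
    by (simp add: tm(2) one_tensor_alg algebra_homD(5)[OF f] algebra_homD(5)[OF g])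
  show "tensor_map R A B C D f g (pure_tensor R A B (a \<otimes>\<^bsub>A\<^esub> a') (b \<otimes>\<^bsub>B\<^esub> b')) =
      tensor_map R A B C D f g (pure_tensor R A B a b) \<otimes>\<^bsub>tensor_alg R C D\<^esub>
      tensor_map R A B C D f g (pure_tensor R A B a' b')"
    if "a \<in> carrier A" "a' \<in> carrier A" "b \<in> carrier B" "b' \<in> carrier B" for a a' b b'
    using that by (simp add: tm(2) mult_pure_tensor C D algebra_homD[OF f] algebra_homD[OF g])
qed

lemma algebra_hom_pure_left:
  assumes A: "unital_algebra R A" and B: "unital_algebra R B"
  shows "algebra_hom R A (tensor_alg R A B) (\<lambda>a. pure_tensor R A B a \<one>\<^bsub>B\<^esub>)"
proof -
  interpret B: ring B using unital_algebraD(2)[OF B] .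
  show ?thesis
    using bilinear_mapD(2)[OF bilinear_pure_tensor[OF unital_algebraD(3)[OF A] unital_algebraD(3)[OF B]], of "\<one>\<^bsub>B\<^esub>"]
    by (simp add: algebra_hom_def linear_map_def mult_pure_tensor A B one_tensor_alg)
qed

lemma algebra_hom_pure_right:
  assumes A: "unital_algebra R A" and B: "unital_algebra R B"
  shows "algebra_hom R B (tensor_alg R A B) (pure_tensor R A B \<one>\<^bsub>A\<^esub>)"
proof -
  interpret A: ring A using unital_algebraD(2)[OF A] .
  show ?thesis
    using bilinear_mapD(1)[OF bilinear_pure_tensor[OF unital_algebraD(3)[OF A] unital_algebraD(3)[OF B]], of "\<one>\<^bsub>A\<^esub>"]
    by (simp add: algebra_hom_def linear_map_def mult_pure_tensor A B one_tensor_alg)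
qed

text \<open>Rebracketing \<open>V \<otimes> W \<otimes> X\<close> is equivariant along rebracketing \<open>A \<otimes> B \<otimes> C\<close>. For regular actions
  this is the multiplicativity of rebracketing; for modules it carries the coherence
  diagram of the associators over to an identity between elements of \<open>H \<otimes> H \<otimes> H\<close>.\<close>

lemma tensor_reassoc_act:
  assumes A: "unital_algebra R A" and B: "unital_algebra R B" and C: "unital_algebra R C"
    and r: "algebra_action R A V \<rho>" and s: "algebra_action R B W \<sigma>" and k: "algebra_action R C X \<kappa>"
    and t: "t \<in> carrier (tensor_alg R (tensor_alg R A B) C)"
    and x: "x \<in> carrier (tensor_mod R (tensor_mod R V W) X)"
  shows "tensor_reassoc R V W X
      (tensor_act R (tensor_alg R A B) C (tensor_mod R V W) X (tensor_act R A B V W \<rho> \<sigma>) \<kappa> t x) =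
    tensor_act R A (tensor_alg R B C) V (tensor_mod R W X) \<rho> (tensor_act R B C W X \<sigma> \<kappa>)
      (tensor_reassoc R A B C t) (tensor_reassoc R V W X x)"
proof -
  note mA = unital_algebraD(3)[OF A] unital_algebraD(3)[OF B] unital_algebraD(3)[OF C]
  note mV = algebra_actionD(1)[OF r] algebra_actionD(1)[OF s] algebra_actionD(1)[OF k]
  note rb = algebra_actionD(2)[OF r] and sb = algebra_actionD(2)[OF s] and kb = algebra_actionD(2)[OF k]
  note bi = bilinear_mapD(3)[OF rb] bilinear_mapD(3)[OF sb] bilinear_mapD(3)[OF kb]
  note rs = algebra_actionD(2)[OF algebra_action_tensor[OF A B r s]]
  note sk = algebra_actionD(2)[OF algebra_action_tensor[OF B C s k]]
  let ?l = "tensor_act R (tensor_alg R A B) C (tensor_mod R V W) X (tensor_act R A B V W \<rho> \<sigma>) \<kappa>"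
  let ?r = "tensor_act R A (tensor_alg R B C) V (tensor_mod R W X) \<rho> (tensor_act R B C W X \<sigma> \<kappa>)"
  have mod: "module R (tensor_alg R A B)" "module R (tensor_alg R B C)" 
    "module R (tensor_mod R V W)" "module R (tensor_mod R W X)"
    using mA mV by simp_all
  note lD = bilinear_mapD[OF bilinear_tensor_act[OF mod(1) mA(3) mod(3) mV(3) rs kb]]
    and rD = bilinear_mapD[OF bilinear_tensor_act[OF mA(1) mod(2) mV(1) mod(4) rb sk]]
  note lp = tensor_act_pure[OF mod(1) mA(3) mod(3) mV(3) rs kb]
    and rp = tensor_act_pure[OF mA(1) mod(2) mV(1) mod(4) rb sk]
  note rsp = tensor_act_pure[OF mA(1,2) mV(1,2) rb sb] and skp = tensor_act_pure[OF mA(2,3) mV(2,3) sb kb]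
  note reA = tensor_reassoc_add[OF mA] tensor_reassoc_closed[OF mA] 
  note reV = tensor_reassoc_add[OF mV] tensor_reassoc_closed[OF mV] tensor_reassoc_pure[OF mV]
  have reA': "tensor_reassoc R A B C (u \<oplus>\<^bsub>tensor_mod R (tensor_alg R A B) C\<^esub> v) = tensor_reassoc R A B C u
      \<oplus>\<^bsub>tensor_mod R A (tensor_alg R B C)\<^esub> tensor_reassoc R A B C v"
    if "u \<in> carrier (tensor_mod R (tensor_alg R A B) C)" "v \<in> carrier (tensor_mod R (tensor_alg R A B) C)" for u v
    using that reA by (simp add: tensor_flatten)
  have reA'': "tensor_reassoc R A B C u \<in> carrier (tensor_mod R A (tensor_alg R B C))"
    if "u \<in> carrier (tensor_mod R (tensor_alg R A B) C)" for u
    using that reA by (simp add: tensor_flatten)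
  have t': "t \<in> carrier (tensor_mod R (tensor_alg R A B) C)" using t by simp
  show ?thesis using mod(1) mA(3) t'
  proof (induction rule: pure_tensor_induct)
    case (pure ab c)
    have c: "c \<in> carrier C" by fact
    show ?case
      using mA(1,2) pure(1)[simplified]
    proof (induction rule: pure_tensor_induct)
      case (pure a b)
      note ab = pure
      show ?case using mod(3) mV(3) x
      proof (induction rule: pure_tensor_induct)
        case (pure vw x)
        have x: "x \<in> carrier X" by fact
        show ?case using mV(1,2) pure(1)
        proof (induction rule: pure_tensor_induct)
          case (pure v w)
          then show ?case using ab c x
            by (simp add: lp rp rsp skp reV tensor_reassoc_pure_alg mA mV mod bi)
        next
          case (add p q)
          have "pure_tensor R (tensor_mod R V W) X (p \<oplus>\<^bsub>tensor_mod R V W\<^esub> q) x =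
            pure_tensor R (tensor_mod R V W) X p x \<oplus>\<^bsub>tensor_mod R (tensor_mod R V W) X\<^esub> pure_tensor R (tensor_mod R V W) X q x"
            using add x mV mod by (simp add: pure_tensor_add_left)
          then show ?case using add ab c x
            by (simp add: lD(3,5) rD(3,5) reV reA' reA'' mA mV mod)
        qed
      next
        case (add p q)
        then show ?case using ab c by (simp add: lD(3,5) rD(3,5) reV reA' reA'' mA mV mod)
      qed
    next
      case (add p q)
      have "pure_tensor R (tensor_alg R A B) C (p \<oplus>\<^bsub>tensor_mod R A B\<^esub> q) c =
            pure_tensor R (tensor_alg R A B) C p c \<oplus>\<^bsub>tensor_mod R (tensor_alg R A B) C\<^esub> pure_tensor R (tensor_alg R A B) C q c"
        using add c mA mod pure_tensor_add_left[OF mod(1) mA(3), of p q c] by simp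
      then show ?case using add c x
        by (simp add: lD(3,4) rD(3,4) reV reA' reA'' mA mV mod)
    qed
  next
    case (add p q)
    then show ?case using x by (simp add: lD(3,4) rD(3,4) reV reA' reA'' mA mV mod)
  qed
qed

lemma algebra_hom_reassoc:
  assumes A: "unital_algebra R A" and B: "unital_algebra R B" and C: "unital_algebra R C"
  shows "algebra_hom R (tensor_alg R (tensor_alg R A B) C) (tensor_alg R A (tensor_alg R B C)) (tensor_reassoc R A B C)"
proof -
  interpret A: ring A using unital_algebraD(2)[OF A] .
  interpret B: ring B using unital_algebraD(2)[OF B] .
  interpret C: ring C using unital_algebraD(2)[OF C] .
  note m = unital_algebraD(3)[OF A] unital_algebraD(3)[OF B] unital_algebraD(3)[OF C]
  have 1: "linear_map R (tensor_alg R (tensor_alg R A B) C) (tensor_alg R A (tensor_alg R B C)) (tensor_reassoc R A B C)"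
    using tensor_reassoc_linear[OF m] by (simp add: linear_map_def tensor_flatten)
  have ma: "monoid.mult (tensor_alg R (tensor_alg R A B) C) =
      tensor_act R (tensor_alg R A B) C (tensor_mod R A B) C (tensor_act R A B A B (monoid.mult A) (monoid.mult B)) (monoid.mult C)"
    "monoid.mult (tensor_alg R A (tensor_alg R B C)) =
      tensor_act R A (tensor_alg R B C) A (tensor_mod R B C) (monoid.mult A) (tensor_act R B C B C (monoid.mult B) (monoid.mult C))"
    by (simp_all add: mult_tensor_alg[of R "tensor_alg R A B" C] mult_tensor_alg[of R A "tensor_alg R B C"] mult_tensor_alg[of R A B] mult_tensor_alg[of R B C]
      tensor_act_cong[OF same_module_refl same_module_refl same_module_tensor_alg same_module_refl]
      tensor_act_cong[OF same_module_refl same_module_refl same_module_refl same_module_tensor_alg])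
  have 2: "tensor_reassoc R A B C (x \<otimes>\<^bsub>tensor_alg R (tensor_alg R A B) C\<^esub> y) =
    tensor_reassoc R A B C x \<otimes>\<^bsub>tensor_alg R A (tensor_alg R B C)\<^esub> tensor_reassoc R A B C y"
    if "x \<in> carrier (tensor_alg R (tensor_alg R A B) C)" "y \<in> carrier (tensor_alg R (tensor_alg R A B) C)" for x y
    using that unfolding ma
    by (intro tensor_reassoc_act A B C algebra_action_mult) (simp_all add: tensor_flatten)
  show ?thesis using 1 2
    by (simp add: algebra_hom_def one_tensor_alg tensor_reassoc_pure_alg m)
qed

text \<open>The source of all naturality statements for \<open>V \<otimes> W\<close>: a tensor product of equivariant maps commutes
  with the whole of \<open>A \<otimes> B\<close>, not only with the image of a coproduct.\<close>

lemma tensor_map_act: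
  assumes m: "module R A" "module R B" "module R V" "module R W" "module R V'" "module R W'"
    and r: "bilinear_map R A V V \<rho>" and s: "bilinear_map R B W W \<sigma>"
    and r': "bilinear_map R A V' V' \<rho>'" and s': "bilinear_map R B W' W' \<sigma>'"
    and f: "linear_map R V V' f" and g: "linear_map R W W' g"
    and ef: "\<And>a v. \<lbrakk>a \<in> carrier A; v \<in> carrier V\<rbrakk> \<Longrightarrow> f (\<rho> a v) = \<rho>' a (f v)"
    and eg: "\<And>b w. \<lbrakk>b \<in> carrier B; w \<in> carrier W\<rbrakk> \<Longrightarrow> g (\<sigma> b w) = \<sigma>' b (g w)"
    and t: "t \<in> carrier (tensor_mod R A B)" and x: "x \<in> carrier (tensor_mod R V W)"
  shows "tensor_map R V W V' W' f g (tensor_act R A B V W \<rho> \<sigma> t x) =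
    tensor_act R A B V' W' \<rho>' \<sigma>' t (tensor_map R V W V' W' f g x)"
  using m(1,2) t
proof (induction rule: pure_tensor_induct)
  note tm = tensor_map_linear[OF m(3-6) f g, THEN linear_mapD(2)] tensor_map_linear[OF m(3-6) f g, THEN linear_mapD(1)] tensor_map_pure[OF m(3-6) f g]
  note l = bilinear_mapD[OF bilinear_tensor_act[OF m(1-4) r s]] and r = bilinear_mapD[OF bilinear_tensor_act[OF m(1,2,5,6) r' s']]
  {
    case (pure a b)
    note ab = pure
    show ?case using m(3,4) x
    proof (induction rule: pure_tensor_induct)
      case (pure v w)
      with ab show ?case
        by (simp add: tensor_act_pure m assms(7-10) tm bilinear_mapD(3)[OF assms(7)] bilinear_mapD(3)[OF s] ef eg linear_mapD(1)[OF f] linear_mapD(1)[OF g])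
    next
      case (add p q)
      with ab show ?case by (simp add: l(3,5) r(3,5) tm m)
    qed
  next
    case (add p q)
    with x show ?case by (simp add: l(3,4) r(3,4) tm m)
  }
qed

text \<open>Used with \<open>f\<close> or \<open>g\<close> the coproduct: acting by \<open>G\<close> on \<open>(V \<otimes> W) \<otimes> X\<close> is acting
  by \<open>(\<Delta> \<otimes> id)(G)\<close>.\<close>

lemma tensor_act_pullback:
  assumes m: "module R A" "module R B" "module R C" "module R D" "module R V" "module R W"
    and r: "bilinear_map R C V V \<rho>" and s: "bilinear_map R D W W \<sigma>"
    and f: "linear_map R A C f" and g: "linear_map R B D g"
    and t: "t \<in> carrier (tensor_mod R A B)" and x: "x \<in> carrier (tensor_mod R V W)"
  shows "tensor_act R C D V W \<rho> \<sigma> (tensor_map R A B C D f g t) x =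
    tensor_act R A B V W (\<lambda>a. \<rho> (f a)) (\<lambda>b. \<sigma> (g b)) t x"
  using m(1,2) t
proof (induction rule: pure_tensor_induct)
  note tm = tensor_map_linear[OF m(1-4) f g, THEN linear_mapD(2)] tensor_map_linear[OF m(1-4) f g, THEN linear_mapD(1)] tensor_map_pure[OF m(1-4) f g]
  have r': "bilinear_map R A V V (\<lambda>a. \<rho> (f a))" and s': "bilinear_map R B W W (\<lambda>b. \<sigma> (g b))"
    using bilinear_map_compose[OF r f linear_map_id] bilinear_map_compose[OF s g linear_map_id] .
  note l = bilinear_mapD[OF bilinear_tensor_act[OF m(3-6) r s]] and rr = bilinear_mapD[OF bilinear_tensor_act[OF m(1,2,5,6) r' s']]
  {
    case (pure a b)
    then show ?case using x
      by (simp add: tensor_act_pure_left[OF m(3-6) r s] tensor_act_pure_left[OF m(1,2,5,6) r' s'] tm linear_mapD(1)[OF f] linear_mapD(1)[OF g])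
  next
    case (add p q)
    with x show ?case by (simp add: l(3,4) rr(3,4) tm m)
  }
qed

section \<open>The structure maps of a quasi-Hopf algebra\<close>

lemma bilinear_map_cong:
  assumes "same_module V V'" "same_module W W'" "same_module M M'"
  shows "bilinear_map R V W M = bilinear_map R V' W' M'"
  using assms by (auto simp: bilinear_map_def linear_map_def same_module_def fun_eq_iff)

locale quasi_hopf_alg =
  fixes R :: "('k, 'r) ring_scheme" and H :: "('k, 'h) quasi_hopf_algebra"
  assumes quasi_hopf_H: "quasi_hopf R H"
begin

abbreviation "T2 \<equiv> tensor2 R H"
abbreviation "T3 \<equiv> tensor3 R H"
abbreviation "T4 \<equiv> tensor4 R H"
abbreviation "C2 \<equiv> carrier (tensor_mod R H H)"
abbreviation "C3 \<equiv> carrier (tensor_mod R H T2)"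
abbreviation "C4 \<equiv> carrier (tensor_mod R H T3)"
abbreviation "pure2 \<equiv> pure_tensor R H H"
abbreviation "pure3 \<equiv> pure_tensor R H T2"
abbreviation "pure4 \<equiv> pure_tensor R H T3"
abbreviation "S \<equiv> antipode H"
abbreviation "\<Delta> \<equiv> comult H"
abbreviation "\<epsilon> \<equiv> counit H"
abbreviation "\<phi> \<equiv> coassociator H"

lemma quasi_bialgebra_H: "quasi_bialgebra R H" using quasi_hopf_H by (simp add: quasi_hopf_def)
lemma algebra_H [simp]: "unital_algebra R H" using quasi_bialgebra_H by (simp add: quasi_bialgebra_def)
lemma module_H [simp]: "module R H" using unital_algebraD(3)[OF algebra_H] .

sublocale H: ring H using unital_algebraD(2)[OF algebra_H] .
sublocale mod: module R H by (rule module_H)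

lemma ring_T2: "ring T2" and ring_T3: "ring T3" and ring_T4: "ring T4"
  by (simp_all add: unital_algebraD(2)[where R = R])

lemma r_one [simp]:
  "x \<in> C2 \<Longrightarrow> x \<otimes>\<^bsub>T2\<^esub> \<one>\<^bsub>T2\<^esub> = x"
  "y \<in> C3 \<Longrightarrow> y \<otimes>\<^bsub>T3\<^esub> \<one>\<^bsub>T3\<^esub> = y"
  "z \<in> C4 \<Longrightarrow> z \<otimes>\<^bsub>T4\<^esub> \<one>\<^bsub>T4\<^esub> = z"
  using monoid.r_one[OF ring.is_monoid[OF ring_T2]] monoid.r_one[OF ring.is_monoid[OF ring_T3]]
    monoid.r_one[OF ring.is_monoid[OF ring_T4]] by simp_all

text \<open>The ring laws of the tensor powers, with carrier and addition in the form to which the simplifier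
  reduces them.\<close>

lemmas T2 = ring.ring_simprules[OF ring_T2, simplified]
lemmas T3 = ring.ring_simprules[OF ring_T3, simplified]
lemmas T4 = ring.ring_simprules[OF ring_T4, simplified]

lemma smult_mult [simp]:
  "\<lbrakk>r \<in> carrier R; a \<in> carrier H; b \<in> carrier H\<rbrakk> \<Longrightarrow> (r \<odot>\<^bsub>H\<^esub> a) \<otimes>\<^bsub>H\<^esub> b = r \<odot>\<^bsub>H\<^esub> (a \<otimes>\<^bsub>H\<^esub> b)"
  "\<lbrakk>r \<in> carrier R; a \<in> carrier H; b \<in> carrier H\<rbrakk> \<Longrightarrow> a \<otimes>\<^bsub>H\<^esub> (r \<odot>\<^bsub>H\<^esub> b) = r \<odot>\<^bsub>H\<^esub> (a \<otimes>\<^bsub>H\<^esub> b)"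
  using unital_algebraD(4,5)[OF algebra_H] by auto

lemma S_anti: "algebra_anti_automorphism R H S" using quasi_hopf_H by (simp add: quasi_hopf_def)

lemma S [simp]:
  "a \<in> carrier H \<Longrightarrow> S a \<in> carrier H"
  "\<lbrakk>a \<in> carrier H; b \<in> carrier H\<rbrakk> \<Longrightarrow> S (a \<oplus>\<^bsub>H\<^esub> b) = S a \<oplus>\<^bsub>H\<^esub> S b"
  "\<lbrakk>r \<in> carrier R; a \<in> carrier H\<rbrakk> \<Longrightarrow> S (r \<odot>\<^bsub>H\<^esub> a) = r \<odot>\<^bsub>H\<^esub> S a"
  "\<lbrakk>a \<in> carrier H; b \<in> carrier H\<rbrakk> \<Longrightarrow> S (a \<otimes>\<^bsub>H\<^esub> b) = S b \<otimes>\<^bsub>H\<^esub> S a"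
  "S \<one>\<^bsub>H\<^esub> = \<one>\<^bsub>H\<^esub>"
  using S_anti by (auto simp: algebra_anti_automorphism_def linear_map_def)

lemma comult_hom: "algebra_hom R H T2 \<Delta>" using quasi_bialgebra_H by (simp add: quasi_bialgebra_def)
lemma counit_hom: "algebra_hom R H (base_algebra R) \<epsilon>" using quasi_bialgebra_H by (simp add: quasi_bialgebra_def)

lemmas comult [simp] = algebra_homD[OF comult_hom, simplified]

lemma counit [simp]:
  "a \<in> carrier H \<Longrightarrow> \<epsilon> a \<in> carrier R"
  "\<lbrakk>a \<in> carrier H; b \<in> carrier H\<rbrakk> \<Longrightarrow> \<epsilon> (a \<oplus>\<^bsub>H\<^esub> b) = \<epsilon> a \<oplus>\<^bsub>R\<^esub> \<epsilon> b"
  "\<lbrakk>r \<in> carrier R; a \<in> carrier H\<rbrakk> \<Longrightarrow> \<epsilon> (r \<odot>\<^bsub>H\<^esub> a) = r \<otimes>\<^bsub>R\<^esub> \<epsilon> a"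
  "\<lbrakk>a \<in> carrier H; b \<in> carrier H\<rbrakk> \<Longrightarrow> \<epsilon> (a \<otimes>\<^bsub>H\<^esub> b) = \<epsilon> a \<otimes>\<^bsub>R\<^esub> \<epsilon> b"
  "\<epsilon> \<one>\<^bsub>H\<^esub> = \<one>\<^bsub>R\<^esub>"
  using counit_hom by (auto simp: algebra_hom_def linear_map_def base_algebra_def)

lemma \<phi>_unit: "\<phi> \<in> Units T3" using quasi_bialgebra_H by (simp add: quasi_bialgebra_def)
lemma \<phi>_closed [simp]: "\<phi> \<in> C3"
  using \<phi>_unit by (simp add: Units_def)

lemma alpha_beta_closed [simp]: "qalpha H \<in> carrier H" "qbeta H \<in> carrier H"
  using quasi_hopf_H by (simp_all add: quasi_hopf_def)

lemma quasi_coassoc: "h \<in> carrier H \<Longrightarrow>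
    id_comult R H (\<Delta> h) \<otimes>\<^bsub>T3\<^esub> \<phi> = \<phi> \<otimes>\<^bsub>T3\<^esub> comult_id R H (\<Delta> h)"
  and counit_comult [simp]: "h \<in> carrier H \<Longrightarrow> counit_left R H (\<Delta> h) = h"
    "h \<in> carrier H \<Longrightarrow> counit_right R H (\<Delta> h) = h"
  and cocycle: "cocycle_lhs R H = cocycle_rhs R H"
  and counit_phi: "tensor_map R H T2 H H (\<lambda>x. x) (counit_left R H) \<phi> = \<one>\<^bsub>T2\<^esub>"
  using quasi_bialgebra_H unfolding quasi_bialgebra_def by blast+

lemma smult_smult: "\<lbrakk>a \<in> carrier R; b \<in> carrier R; x \<in> carrier H\<rbrakk> \<Longrightarrow> a \<odot>\<^bsub>H\<^esub> (b \<odot>\<^bsub>H\<^esub> x) = (a \<otimes>\<^bsub>R\<^esub> b) \<odot>\<^bsub>H\<^esub> x"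
  by (simp add: mod.smult_assoc1)

lemma bilinear_counit_left: "bilinear_map R H H H (\<lambda>a b. \<epsilon> a \<odot>\<^bsub>H\<^esub> b)"
  by (auto simp: bilinear_map_def linear_map_def mod.smult_l_distr mod.smult_r_distr smult_smult mod.R.m_comm)

lemma bilinear_counit_right: "bilinear_map R H H H (\<lambda>a b. \<epsilon> b \<odot>\<^bsub>H\<^esub> a)"
  by (auto simp: bilinear_map_def linear_map_def mod.smult_l_distr mod.smult_r_distr smult_smult mod.R.m_comm)

lemma counit_left_pure [simp]:
  "\<lbrakk>a \<in> carrier H; b \<in> carrier H\<rbrakk> \<Longrightarrow> counit_left R H (pure2 a b) = \<epsilon> a \<odot>\<^bsub>H\<^esub> b"
  by (simp add: counit_left_def lift_pure bilinear_counit_left)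

lemma counit_right_pure [simp]:
  "\<lbrakk>a \<in> carrier H; b \<in> carrier H\<rbrakk> \<Longrightarrow> counit_right R H (pure2 a b) = \<epsilon> b \<odot>\<^bsub>H\<^esub> a"
  by (simp add: counit_right_def lift_pure bilinear_counit_right)

lemma counit_left_hom: "algebra_hom R T2 H (counit_left R H)"
proof (rule algebra_hom_tensorI)
  show "linear_map R (tensor_mod R H H) H (counit_left R H)"
    unfolding counit_left_def by (rule lift_in_lin_hom[THEN lin_homD(1)]) (simp_all add: bilinear_counit_left)
qed (simp_all add: smult_smult mod.R.m_comm)

lemma counit_right_hom: "algebra_hom R T2 H (counit_right R H)"
proof (rule algebra_hom_tensorI)
  show "linear_map R (tensor_mod R H H) H (counit_right R H)"
    unfolding counit_right_def by (rule lift_in_lin_hom[THEN lin_homD(1)]) (simp_all add: bilinear_counit_right)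
qed (simp_all add: smult_smult mod.R.m_comm)

lemma id_comult_hom: "algebra_hom R T2 T3 (id_comult R H)"
  unfolding id_comult_def by (rule algebra_hom_tensor_map) (simp_all add: algebra_hom_id comult_hom)

lemma comult_id_hom: "algebra_hom R T2 T3 (comult_id R H)"
  unfolding comult_id_def
  by (rule algebra_hom_compose[OF algebra_hom_tensor_map algebra_hom_reassoc])
    (simp_all add: algebra_hom_id comult_hom)

lemma one_tensor_hom: "algebra_hom R T2 T3 (one_tensor R H)"
  unfolding one_tensor_def by (rule algebra_hom_pure_right) simp_all

lemma tensor_one_hom: "algebra_hom R T2 T3 (tensor_one R H)"
  unfolding tensor_one_def
  by (rule algebra_hom_compose[OF algebra_hom_pure_left algebra_hom_reassoc]) simp_all

lemmas structure_homs [simp] =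
  algebra_homD(2-5)[OF counit_left_hom, simplified]
  algebra_homD(2-5)[OF counit_right_hom, simplified]
  algebra_homD(2-5)[OF id_comult_hom, simplified]
  algebra_homD(2-5)[OF comult_id_hom, simplified]
  algebra_homD(2-5)[OF one_tensor_hom, simplified]
  algebra_homD(2-5)[OF tensor_one_hom, simplified]

lemma id_comult_pure: "\<lbrakk>a \<in> carrier H; b \<in> carrier H\<rbrakk> \<Longrightarrow>
    id_comult R H (pure2 a b) = pure3 a (\<Delta> b)"
  unfolding id_comult_def by (simp add: tensor_map_pure algebra_homD(1)[OF comult_hom] linear_map_id)

lemma comult_id_pure: "\<lbrakk>a \<in> carrier H; b \<in> carrier H\<rbrakk> \<Longrightarrow>
    comult_id R H (pure2 a b) = tensor_reassoc R H H H (pure_tensor R T2 H (\<Delta> a) b)"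
  unfolding comult_id_def by (simp add: tensor_map_pure algebra_homD(1)[OF comult_hom] linear_map_id)

text \<open>The product \<open>s \<otimes> b\<close> of an element of \<open>H \<otimes> H\<close> with one of \<open>H\<close>, bracketed to the right. Since \<open>\<Delta>(a)\<close> is not a
  pure tensor, \<open>(\<Delta> \<otimes> id)(a \<otimes> b)\<close> is best treated as the value at \<open>s = \<Delta>(a)\<close> of this map, and identities about it
  are proved for all \<open>s\<close>.\<close>

abbreviation "join21 s b \<equiv> tensor_reassoc R H H H (pure_tensor R T2 H s b)"

lemma tensor_one_join21: "tensor_one R H s = join21 s \<one>\<^bsub>H\<^esub>"
  by (simp add: tensor_one_def)

lemmas reassoc_hom3 = algebra_hom_reassoc[OF algebra_H algebra_H algebra_H]

lemma join21 [simp]: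
  "\<lbrakk>a \<in> carrier H; b \<in> carrier H; c \<in> carrier H\<rbrakk> \<Longrightarrow> join21 (pure2 a b) c = pure3 a (pure2 b c)"
  "\<lbrakk>s \<in> C2; b \<in> carrier H\<rbrakk> \<Longrightarrow> join21 s b \<in> C3"
  "\<lbrakk>s \<in> C2; t \<in> C2; b \<in> carrier H\<rbrakk> \<Longrightarrow>
    join21 (s \<oplus>\<^bsub>tensor_mod R H H\<^esub> t) b = join21 s b \<oplus>\<^bsub>tensor_mod R H T2\<^esub> join21 t b"
  "\<lbrakk>s \<in> C2; t \<in> C2; b \<in> carrier H; c \<in> carrier H\<rbrakk> \<Longrightarrow>
    join21 s b \<otimes>\<^bsub>T3\<^esub> join21 t c = join21 (s \<otimes>\<^bsub>T2\<^esub> t) (b \<otimes>\<^bsub>H\<^esub> c)"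
  using pure_tensor_add_left[of R T2 H s t b]
  by (simp_all add: tensor_reassoc_pure_alg algebra_homD(2-4)[OF reassoc_hom3, simplified]
     algebra_homD(4)[OF reassoc_hom3, simplified, symmetric] mult_pure_tensor)

lemmas T2_induct = pure_tensor_induct[OF module_H module_H, consumes 1, case_names pure add]
lemmas T3_induct = pure_tensor_induct[OF module_H module_tensor_alg[OF module_H module_H], consumes 1, case_names pure add]

lemma pure_add3:
  "\<lbrakk>a \<in> carrier H; s \<in> C2; t \<in> C2\<rbrakk> \<Longrightarrow>
    pure3 a (s \<oplus>\<^bsub>tensor_mod R H H\<^esub> t) = pure3 a s \<oplus>\<^bsub>tensor_mod R H T2\<^esub> pure3 a t"
  using pure_tensor_add_right[of R H T2 a s t] by simp

lemma T3_induct3 [consumes 1, case_names pure add]: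
  assumes "t \<in> C3"
    and pure: "\<And>a b c. \<lbrakk>a \<in> carrier H; b \<in> carrier H; c \<in> carrier H\<rbrakk> \<Longrightarrow> P (pure3 a (pure2 b c))"
    and add: "\<And>x y. \<lbrakk>x \<in> C3; y \<in> C3; P x; P y\<rbrakk> \<Longrightarrow> P (x \<oplus>\<^bsub>tensor_mod R H T2\<^esub> y)"
  shows "P t"
  using assms(1)
proof (induction rule: T3_induct)
  case (pure a s)
  have "s \<in> C2" using pure by simp
  then show ?case
  proof (induction rule: T2_induct)
    case (pure b c) then show ?case using \<open>a \<in> _\<close> assms(2) by blast
  next
    case (add x y) then show ?case using \<open>a \<in> _\<close> by (simp add: pure_add3 assms(3))
  qed
qed (rule add)

section \<open>The antipode axioms as properties of functionals\<close>

text \<open>The Sweedler expressions of the antipode axioms, as functionals on \<open>H \<otimes> H\<close> and \<open>H \<otimes> H \<otimes> H\<close>. The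
  elements \<open>x\<close> and \<open>y\<close> in the places of \<open>\<alpha>\<close> and \<open>\<beta>\<close> are kept variable so that
  the expressions for the twisted algebra are instances.\<close>

definition "alpha_form x = tensor_lift R H H H (\<lambda>a b. S a \<otimes>\<^bsub>H\<^esub> x \<otimes>\<^bsub>H\<^esub> b)"
definition "beta_form y = tensor_lift R H H H (\<lambda>a b. a \<otimes>\<^bsub>H\<^esub> y \<otimes>\<^bsub>H\<^esub> S b)"
definition "zigzag x y = tensor_lift R H T2 H
      (\<lambda>a. tensor_lift R H H H (\<lambda>b c. a \<otimes>\<^bsub>H\<^esub> y \<otimes>\<^bsub>H\<^esub> S b \<otimes>\<^bsub>H\<^esub> x \<otimes>\<^bsub>H\<^esub> c))"
definition "zigzag_inv x y = tensor_lift R H T2 H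
      (\<lambda>a. tensor_lift R H H H (\<lambda>b c. S a \<otimes>\<^bsub>H\<^esub> x \<otimes>\<^bsub>H\<^esub> b \<otimes>\<^bsub>H\<^esub> y \<otimes>\<^bsub>H\<^esub> S c))"

context fixes x assumes x [simp]: "x \<in> carrier H"
begin

lemma bilinear_alpha_form: "bilinear_map R H H H (\<lambda>a b. S a \<otimes>\<^bsub>H\<^esub> x \<otimes>\<^bsub>H\<^esub> b)"
  by (auto simp: bilinear_map_def linear_map_def H.l_distr H.r_distr)

lemma alpha_form [simp]:
  "\<lbrakk>a \<in> carrier H; b \<in> carrier H\<rbrakk> \<Longrightarrow> alpha_form x (pure2 a b) = S a \<otimes>\<^bsub>H\<^esub> x \<otimes>\<^bsub>H\<^esub> b"
  "s \<in> C2 \<Longrightarrow> alpha_form x s \<in> carrier H"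
  "\<lbrakk>s \<in> C2; t \<in> C2\<rbrakk> \<Longrightarrow>
    alpha_form x (s \<oplus>\<^bsub>tensor_mod R H H\<^esub> t) = alpha_form x s \<oplus>\<^bsub>H\<^esub> alpha_form x t"
  unfolding alpha_form_def
  by (simp_all add: lift_pure bilinear_alpha_form linear_mapD[OF lift_in_lin_hom[THEN lin_homD(1)]])

lemma alpha_form_mult:
  assumes "s \<in> C2" "a \<in> carrier H" "b \<in> carrier H"
  shows "alpha_form x (s \<otimes>\<^bsub>T2\<^esub> pure2 a b) = S a \<otimes>\<^bsub>H\<^esub> alpha_form x s \<otimes>\<^bsub>H\<^esub> b"
  using assms(1)
  by (induction rule: T2_induct)
    (simp_all add: assms mult_pure_tensor H.m_assoc T2 H.l_distr H.r_distr)

end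

context fixes y assumes y [simp]: "y \<in> carrier H"
begin

lemma bilinear_beta_form: "bilinear_map R H H H (\<lambda>a b. a \<otimes>\<^bsub>H\<^esub> y \<otimes>\<^bsub>H\<^esub> S b)"
  by (auto simp: bilinear_map_def linear_map_def H.l_distr H.r_distr)

lemma beta_form [simp]:
  "\<lbrakk>a \<in> carrier H; b \<in> carrier H\<rbrakk> \<Longrightarrow> beta_form y (pure2 a b) = a \<otimes>\<^bsub>H\<^esub> y \<otimes>\<^bsub>H\<^esub> S b"
  "s \<in> C2 \<Longrightarrow> beta_form y s \<in> carrier H"
  "\<lbrakk>s \<in> C2; t \<in> C2\<rbrakk> \<Longrightarrow>
    beta_form y (s \<oplus>\<^bsub>tensor_mod R H H\<^esub> t) = beta_form y s \<oplus>\<^bsub>H\<^esub> beta_form y t"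
  unfolding beta_form_def
  by (simp_all add: lift_pure bilinear_beta_form linear_mapD[OF lift_in_lin_hom[THEN lin_homD(1)]])

lemma beta_form_mult:
  assumes "s \<in> C2" "a \<in> carrier H" "b \<in> carrier H"
  shows "beta_form y (pure2 a b \<otimes>\<^bsub>T2\<^esub> s) = a \<otimes>\<^bsub>H\<^esub> beta_form y s \<otimes>\<^bsub>H\<^esub> S b"
  using assms(1)
  by (induction rule: T2_induct)
    (simp_all add: assms mult_pure_tensor H.m_assoc T2 H.l_distr H.r_distr)

end

context fixes x y assumes x [simp]: "x \<in> carrier H" and y [simp]: "y \<in> carrier H"
begin

lemma bilinear_zigzag_inner:
  "a \<in> carrier H \<Longrightarrow> bilinear_map R H H H (\<lambda>b c. a \<otimes>\<^bsub>H\<^esub> y \<otimes>\<^bsub>H\<^esub> S b \<otimes>\<^bsub>H\<^esub> x \<otimes>\<^bsub>H\<^esub> c)"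
  "a \<in> carrier H \<Longrightarrow> bilinear_map R H H H (\<lambda>b c. S a \<otimes>\<^bsub>H\<^esub> x \<otimes>\<^bsub>H\<^esub> b \<otimes>\<^bsub>H\<^esub> y \<otimes>\<^bsub>H\<^esub> S c)"
  by (auto simp: bilinear_map_def linear_map_def H.l_distr H.r_distr)

lemma bilinear_zigzag:
  "bilinear_map R H T2 H (\<lambda>a. tensor_lift R H H H (\<lambda>b c. a \<otimes>\<^bsub>H\<^esub> y \<otimes>\<^bsub>H\<^esub> S b \<otimes>\<^bsub>H\<^esub> x \<otimes>\<^bsub>H\<^esub> c))"
  "bilinear_map R H T2 H (\<lambda>a. tensor_lift R H H H (\<lambda>b c. S a \<otimes>\<^bsub>H\<^esub> x \<otimes>\<^bsub>H\<^esub> b \<otimes>\<^bsub>H\<^esub> y \<otimes>\<^bsub>H\<^esub> S c))"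
proof -
  have "bilinear_map R H (tensor_mod R H H) H (\<lambda>a. tensor_lift R H H H (\<lambda>b c. a \<otimes>\<^bsub>H\<^esub> y \<otimes>\<^bsub>H\<^esub> S b \<otimes>\<^bsub>H\<^esub> x \<otimes>\<^bsub>H\<^esub> c))"
    and "bilinear_map R H (tensor_mod R H H) H (\<lambda>a. tensor_lift R H H H (\<lambda>b c. S a \<otimes>\<^bsub>H\<^esub> x \<otimes>\<^bsub>H\<^esub> b \<otimes>\<^bsub>H\<^esub> y \<otimes>\<^bsub>H\<^esub> S c))"
    using bilinear_zigzag_inner
    by (auto intro!: bilinear_lift_param(1) simp: linear_map_def H.l_distr H.r_distr)
  then show "bilinear_map R H T2 H (\<lambda>a. tensor_lift R H H H (\<lambda>b c. a \<otimes>\<^bsub>H\<^esub> y \<otimes>\<^bsub>H\<^esub> S b \<otimes>\<^bsub>H\<^esub> x \<otimes>\<^bsub>H\<^esub> c))"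
    and "bilinear_map R H T2 H (\<lambda>a. tensor_lift R H H H (\<lambda>b c. S a \<otimes>\<^bsub>H\<^esub> x \<otimes>\<^bsub>H\<^esub> b \<otimes>\<^bsub>H\<^esub> y \<otimes>\<^bsub>H\<^esub> S c))"
    by (simp_all add: bilinear_map_cong[OF same_module_refl same_module_tensor_alg same_module_refl])
qed

lemma zigzag [simp]:
  "\<lbrakk>a \<in> carrier H; b \<in> carrier H; c \<in> carrier H\<rbrakk> \<Longrightarrow>
    zigzag x y (pure3 a (pure2 b c)) = a \<otimes>\<^bsub>H\<^esub> y \<otimes>\<^bsub>H\<^esub> S b \<otimes>\<^bsub>H\<^esub> x \<otimes>\<^bsub>H\<^esub> c"
  "u \<in> C3 \<Longrightarrow> zigzag x y u \<in> carrier H"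
  "\<lbrakk>u \<in> C3; v \<in> C3\<rbrakk> \<Longrightarrow>
    zigzag x y (u \<oplus>\<^bsub>tensor_mod R H T2\<^esub> v) = zigzag x y u \<oplus>\<^bsub>H\<^esub> zigzag x y v"
  unfolding zigzag_def
  by (simp_all add: lift_pure bilinear_zigzag bilinear_zigzag_inner linear_mapD[OF lift_in_lin_hom[THEN lin_homD(1)]])

lemma zigzag_inv [simp]:
  "\<lbrakk>a \<in> carrier H; b \<in> carrier H; c \<in> carrier H\<rbrakk> \<Longrightarrow>
    zigzag_inv x y (pure3 a (pure2 b c)) = S a \<otimes>\<^bsub>H\<^esub> x \<otimes>\<^bsub>H\<^esub> b \<otimes>\<^bsub>H\<^esub> y \<otimes>\<^bsub>H\<^esub> S c"
  "u \<in> C3 \<Longrightarrow> zigzag_inv x y u \<in> carrier H"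
  "\<lbrakk>u \<in> C3; v \<in> C3\<rbrakk> \<Longrightarrow>
    zigzag_inv x y (u \<oplus>\<^bsub>tensor_mod R H T2\<^esub> v) = zigzag_inv x y u \<oplus>\<^bsub>H\<^esub> zigzag_inv x y v"
  unfolding zigzag_inv_def
  by (simp_all add: lift_pure bilinear_zigzag bilinear_zigzag_inner linear_mapD[OF lift_in_lin_hom[THEN lin_homD(1)]])

text \<open>Multiplying by \<open>d \<otimes> s\<close> or \<open>s \<otimes> d\<close> puts the two legs of \<open>s\<close> on both sides of \<open>x\<close>, or of
  \<open>y\<close>, as \<open>S\<close> reverses products. So \<open>x\<close> is replaced by \<open>alpha_form x s\<close>, or \<open>y\<close> by \<open>beta_form y s\<close>. Taking \<open>s\<close> to be
  a value of \<open>\<Delta>\<close> gives \<open>zigzag_comult\<close>, taking it to be \<open>F\<close> or \<open>G\<close> gives \<open>zigzag_twist\<close>.\<close>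

lemma zigzag_mult:
  assumes "s \<in> C2" "d \<in> carrier H" "a \<in> carrier H" "b \<in> carrier H" "c \<in> carrier H"
  shows "zigzag x y (pure3 d s \<otimes>\<^bsub>T3\<^esub> pure3 a (pure2 b c)) =
      d \<otimes>\<^bsub>H\<^esub> a \<otimes>\<^bsub>H\<^esub> y \<otimes>\<^bsub>H\<^esub> S b \<otimes>\<^bsub>H\<^esub> alpha_form x s \<otimes>\<^bsub>H\<^esub> c"
    and "zigzag x y (pure3 a (pure2 b c) \<otimes>\<^bsub>T3\<^esub> join21 s d) =
      a \<otimes>\<^bsub>H\<^esub> beta_form y s \<otimes>\<^bsub>H\<^esub> S b \<otimes>\<^bsub>H\<^esub> x \<otimes>\<^bsub>H\<^esub> c \<otimes>\<^bsub>H\<^esub> d"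
    and "zigzag_inv x y (join21 s d \<otimes>\<^bsub>T3\<^esub> pure3 a (pure2 b c)) =
      S a \<otimes>\<^bsub>H\<^esub> alpha_form x s \<otimes>\<^bsub>H\<^esub> b \<otimes>\<^bsub>H\<^esub> y \<otimes>\<^bsub>H\<^esub> S c \<otimes>\<^bsub>H\<^esub> S d"
    and "zigzag_inv x y (pure3 a (pure2 b c) \<otimes>\<^bsub>T3\<^esub> pure3 d s) =
      S d \<otimes>\<^bsub>H\<^esub> S a \<otimes>\<^bsub>H\<^esub> x \<otimes>\<^bsub>H\<^esub> b \<otimes>\<^bsub>H\<^esub> beta_form y s \<otimes>\<^bsub>H\<^esub> S c"
  using assms(1)
  by (induction rule: T2_induct)
    (simp_all add: assms mult_pure_tensor H.m_assoc T2 T3 H.l_distr H.r_distr pure_add3)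

end

text \<open>Twisting \<open>\<alpha>\<close> is the same as multiplying the argument of the functional: \<open>S(g\<^sub>1 a) \<alpha> g\<^sub>2 b = S(a) (S(g\<^sub>1) \<alpha> g\<^sub>2) b\<close>.\<close>

lemma alpha_form_twist:
  assumes "x \<in> carrier H" "g \<in> C2" "t \<in> C2"
  shows "alpha_form (alpha_form x g) t = alpha_form x (g \<otimes>\<^bsub>T2\<^esub> t)"
  using assms(3)
  by (induction rule: T2_induct) (simp_all add: assms alpha_form_mult T2)

lemma beta_form_twist:
  assumes "y \<in> carrier H" "f \<in> C2" "t \<in> C2"
  shows "beta_form (beta_form y f) t = beta_form y (t \<otimes>\<^bsub>T2\<^esub> f)"
  using assms(3)
  by (induction rule: T2_induct) (simp_all add: assms beta_form_mult T2)

lemma zigzag_twist_one_side: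
  assumes "x \<in> carrier H" "y \<in> carrier H" "g \<in> C2" "f \<in> C2"
    and t: "t \<in> C3"
  shows "zigzag (alpha_form x g) y t = zigzag x y (one_tensor R H g \<otimes>\<^bsub>T3\<^esub> t)"
    and "zigzag x (beta_form y f) t = zigzag x y (t \<otimes>\<^bsub>T3\<^esub> tensor_one R H f)"
    and "zigzag_inv (alpha_form x g) y t = zigzag_inv x y (tensor_one R H g \<otimes>\<^bsub>T3\<^esub> t)"
    and "zigzag_inv x (beta_form y f) t = zigzag_inv x y (t \<otimes>\<^bsub>T3\<^esub> one_tensor R H f)"
  using t
  by (induction rule: T3_induct3)
    (simp_all add: assms zigzag_mult one_tensor_def tensor_one_join21 T3 del: structure_homs)

lemma zigzag_twist:
  assumes "x \<in> carrier H" "y \<in> carrier H" "g \<in> C2" "f \<in> C2"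
    and t: "t \<in> C3"
  shows "zigzag (alpha_form x g) (beta_form y f) t = zigzag x y (one_tensor R H g \<otimes>\<^bsub>T3\<^esub> t \<otimes>\<^bsub>T3\<^esub> tensor_one R H f)"
    and "zigzag_inv (alpha_form x g) (beta_form y f) t = zigzag_inv x y (tensor_one R H g \<otimes>\<^bsub>T3\<^esub> t \<otimes>\<^bsub>T3\<^esub> one_tensor R H f)"
  using zigzag_twist_one_side[OF assms(1) beta_form(2)[OF assms(2,4)] assms(3,4) t]
    zigzag_twist_one_side(2,4)[OF assms(1-4)] assms
  by (simp_all add: T3)

lemma quasi_antipode [simp]:
  "h \<in> carrier H \<Longrightarrow> alpha_form (qalpha H) (\<Delta> h) = \<epsilon> h \<odot>\<^bsub>H\<^esub> qalpha H"
  "h \<in> carrier H \<Longrightarrow> beta_form (qbeta H) (\<Delta> h) = \<epsilon> h \<odot>\<^bsub>H\<^esub> qbeta H"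
  "zigzag (qalpha H) (qbeta H) \<phi> = \<one>\<^bsub>H\<^esub>"
  "zigzag_inv (qalpha H) (qbeta H) (inv\<^bsub>T3\<^esub> \<phi>) = \<one>\<^bsub>H\<^esub>"
  using quasi_hopf_H unfolding quasi_hopf_def alpha_form_def beta_form_def zigzag_def zigzag_inv_def by blast+

lemma alpha_beta_form_comult:
  assumes "h \<in> carrier H" "t \<in> C2"
  shows "alpha_form (qalpha H) (\<Delta> h \<otimes>\<^bsub>T2\<^esub> t) = \<epsilon> h \<odot>\<^bsub>H\<^esub> alpha_form (qalpha H) t"
    and "beta_form (qbeta H) (t \<otimes>\<^bsub>T2\<^esub> \<Delta> h) = \<epsilon> h \<odot>\<^bsub>H\<^esub> beta_form (qbeta H) t"
  using assms(2)
  by (induction rule: T2_induct)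
    (simp_all add: assms alpha_form_mult beta_form_mult T2 mod.smult_r_distr)

lemma zigzag_comult_pure:
  assumes "d \<in> carrier H" "e \<in> carrier H" and t: "t \<in> C3"
  shows "zigzag (qalpha H) (qbeta H) (pure3 d (\<Delta> e) \<otimes>\<^bsub>T3\<^esub> t) =
      (\<epsilon> e \<odot>\<^bsub>H\<^esub> d) \<otimes>\<^bsub>H\<^esub> zigzag (qalpha H) (qbeta H) t"
    and "zigzag (qalpha H) (qbeta H) (t \<otimes>\<^bsub>T3\<^esub> join21 (\<Delta> d) e) =
      zigzag (qalpha H) (qbeta H) t \<otimes>\<^bsub>H\<^esub> (\<epsilon> d \<odot>\<^bsub>H\<^esub> e)"
    and "zigzag_inv (qalpha H) (qbeta H) (join21 (\<Delta> d) e \<otimes>\<^bsub>T3\<^esub> t) =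
      zigzag_inv (qalpha H) (qbeta H) t \<otimes>\<^bsub>H\<^esub> S (\<epsilon> d \<odot>\<^bsub>H\<^esub> e)"
    and "zigzag_inv (qalpha H) (qbeta H) (t \<otimes>\<^bsub>T3\<^esub> pure3 d (\<Delta> e)) =
      S (\<epsilon> e \<odot>\<^bsub>H\<^esub> d) \<otimes>\<^bsub>H\<^esub> zigzag_inv (qalpha H) (qbeta H) t"
  using t
  by (induction rule: T3_induct3)
    (simp_all add: assms zigzag_mult T3 H.m_assoc H.l_distr H.r_distr mod.smult_r_distr)

text \<open>The antipode axioms remove an image of \<open>\<Delta>\<close> next to \<open>\<alpha>\<close> or \<open>\<beta>\<close> at the cost of a counit. This is
  what makes the functionals insensitive to the factors \<open>(id \<otimes> \<Delta>)(F)\<close> and \<open>(\<Delta> \<otimes> id)(G)\<close> of the twisted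
  associator.\<close>

lemma zigzag_comult:
  assumes u: "u \<in> C2" and t: "t \<in> C3"
  shows "zigzag (qalpha H) (qbeta H) (id_comult R H u \<otimes>\<^bsub>T3\<^esub> t) =
      counit_right R H u \<otimes>\<^bsub>H\<^esub> zigzag (qalpha H) (qbeta H) t"
    and "zigzag (qalpha H) (qbeta H) (t \<otimes>\<^bsub>T3\<^esub> comult_id R H u) =
      zigzag (qalpha H) (qbeta H) t \<otimes>\<^bsub>H\<^esub> counit_left R H u"
    and "zigzag_inv (qalpha H) (qbeta H) (comult_id R H u \<otimes>\<^bsub>T3\<^esub> t) =
      zigzag_inv (qalpha H) (qbeta H) t \<otimes>\<^bsub>H\<^esub> S (counit_left R H u)"
    and "zigzag_inv (qalpha H) (qbeta H) (t \<otimes>\<^bsub>T3\<^esub> id_comult R H u) =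
      S (counit_right R H u) \<otimes>\<^bsub>H\<^esub> zigzag_inv (qalpha H) (qbeta H) t"
  using u
  by (induction rule: T2_induct)
    (simp_all add: t id_comult_pure comult_id_pure zigzag_comult_pure[simplified] T3 H.l_distr H.r_distr
      del: S(4))

section \<open>The fourfold tensor power\<close>

text \<open>The maps \<open>id \<otimes> id \<otimes> \<Delta>\<close>, \<open>\<Delta> \<otimes> id \<otimes> id\<close>, \<open>id \<otimes> \<Delta> \<otimes> id\<close>, \<open>1 \<otimes> -\<close> and \<open>- \<otimes> 1\<close> of the cocycle condition,
  from \<open>H\<^sup>\<otimes>\<^sup>3\<close> to \<open>H\<^sup>\<otimes>\<^sup>4\<close>; \<open>reassoc4\<close> brackets \<open>H\<^sup>\<otimes>\<^sup>3 \<otimes> H\<close> to the right.\<close>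

definition "id_id_comult = tensor_map R H T2 H T3 (\<lambda>x. x) (id_comult R H)"
definition "comult_id_id x = tensor_reassoc R H H T2 (tensor_map R H T2 T2 T2 \<Delta> (\<lambda>x. x) x)"
definition "id_comult_id = tensor_map R H T2 H T3 (\<lambda>x. x) (comult_id R H)"
definition "one_tensor3 = pure4 \<one>\<^bsub>H\<^esub>"
definition "reassoc4 x = tensor_map R H (tensor_alg R T2 H) H T3 (\<lambda>x. x) (tensor_reassoc R H H H)
      (tensor_reassoc R H T2 H x)"
definition "tensor3_one x = reassoc4 (pure_tensor R T3 H x \<one>\<^bsub>H\<^esub>)"

lemma cocycle_fourfold: "id_id_comult \<phi> \<otimes>\<^bsub>T4\<^esub> comult_id_id \<phi> =
    one_tensor3 \<phi> \<otimes>\<^bsub>T4\<^esub> id_comult_id \<phi> \<otimes>\<^bsub>T4\<^esub> tensor3_one \<phi>"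
  using cocycle by (simp add: cocycle_lhs_def cocycle_rhs_def id_id_comult_def comult_id_id_def
      id_comult_id_def one_tensor3_def tensor3_one_def reassoc4_def)

lemma id_id_comult_hom: "algebra_hom R T3 T4 id_id_comult"
  unfolding id_id_comult_def by (rule algebra_hom_tensor_map) (simp_all add: algebra_hom_id id_comult_hom)

lemma comult_id_id_hom: "algebra_hom R T3 T4 comult_id_id"
  unfolding comult_id_id_def[abs_def]
  by (rule algebra_hom_compose[OF algebra_hom_tensor_map algebra_hom_reassoc])
    (simp_all add: algebra_hom_id comult_hom)

lemma id_comult_id_hom: "algebra_hom R T3 T4 id_comult_id"
  unfolding id_comult_id_def by (rule algebra_hom_tensor_map) (simp_all add: algebra_hom_id comult_id_hom)

lemma one_tensor3_hom: "algebra_hom R T3 T4 one_tensor3"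
  unfolding one_tensor3_def by (rule algebra_hom_pure_right) simp_all

lemma reassoc4_hom: "algebra_hom R (tensor_alg R T3 H) T4 reassoc4"
  unfolding reassoc4_def[abs_def]
  by (rule algebra_hom_compose[OF algebra_hom_reassoc algebra_hom_tensor_map])
    (simp_all add: algebra_hom_id algebra_hom_reassoc)

lemma tensor3_one_hom: "algebra_hom R T3 T4 tensor3_one"
  unfolding tensor3_one_def[abs_def]
  by (rule algebra_hom_compose[OF algebra_hom_pure_left reassoc4_hom]) simp_all

lemmas fourfold_homs [simp] =
  algebra_homD(2-5)[OF id_id_comult_hom, simplified]
  algebra_homD(2-5)[OF comult_id_id_hom, simplified]
  algebra_homD(2-5)[OF id_comult_id_hom, simplified]
  algebra_homD(2-5)[OF one_tensor3_hom, simplified]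
  algebra_homD(2-5)[OF tensor3_one_hom, simplified]
  

lemmas T2pure_lin = pure_tensor_add_left[of R T2 T2, simplified]
lemmas T3Hpure_lin = pure_tensor_add_left[of R T3 H, simplified]

text \<open>As before, products of elements that need not be pure tensors, bracketed to the right: \<open>s \<otimes> t\<close> with
  \<open>s\<close> and \<open>t\<close> in \<open>H \<otimes> H\<close>, and \<open>w \<otimes> b\<close> with \<open>w\<close> in \<open>H\<^sup>\<otimes>\<^sup>3\<close> and \<open>b\<close> in \<open>H\<close>.\<close>

abbreviation "join22 s t \<equiv> tensor_reassoc R H H T2 (pure_tensor R T2 T2 s t)"
abbreviation "join31 w b \<equiv> reassoc4 (pure_tensor R T3 H w b)"

lemmas join22_hom = algebra_hom_reassoc[OF algebra_H algebra_H unital_algebra_tensor[OF algebra_H algebra_H]]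

lemma join22 [simp]:
  "\<lbrakk>a \<in> carrier H; b \<in> carrier H; t \<in> C2\<rbrakk> \<Longrightarrow> join22 (pure2 a b) t = pure4 a (pure3 b t)"
  "\<lbrakk>s \<in> C2; t \<in> C2\<rbrakk> \<Longrightarrow> join22 s t \<in> C4"
  "\<lbrakk>s \<in> C2; t \<in> C2; u \<in> C2\<rbrakk> \<Longrightarrow>
    join22 (s \<oplus>\<^bsub>tensor_mod R H H\<^esub> u) t = join22 s t \<oplus>\<^bsub>tensor_mod R H T3\<^esub> join22 u t"
  "\<lbrakk>s \<in> C2; t \<in> C2; s' \<in> C2; t' \<in> C2\<rbrakk> \<Longrightarrow>
    join22 s t \<otimes>\<^bsub>T4\<^esub> join22 s' t' = join22 (s \<otimes>\<^bsub>T2\<^esub> s') (t \<otimes>\<^bsub>T2\<^esub> t')"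
  by (simp_all add: T2pure_lin tensor_reassoc_pure_alg algebra_homD(2-4)[OF join22_hom, simplified]
     algebra_homD(4)[OF join22_hom, simplified, symmetric] mult_pure_tensor)

lemma join31_pure [simp]:
  "\<lbrakk>a \<in> carrier H; s \<in> C2; b \<in> carrier H\<rbrakk> \<Longrightarrow>
    join31 (pure3 a s) b = pure4 a (join21 s b)"
  by (simp add: reassoc4_def tensor_reassoc_pure_alg tensor_map_pure linear_map_id algebra_homD(1)[OF reassoc_hom3])

lemma join31 [simp]:
  "\<lbrakk>w \<in> C3; b \<in> carrier H\<rbrakk> \<Longrightarrow> join31 w b \<in> C4"
  "\<lbrakk>w \<in> C3; w' \<in> C3; b \<in> carrier H\<rbrakk> \<Longrightarrow>
    join31 (w \<oplus>\<^bsub>tensor_mod R H T2\<^esub> w') b = join31 w b \<oplus>\<^bsub>tensor_mod R H T3\<^esub> join31 w' b"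
  "\<lbrakk>w \<in> C3; w' \<in> C3; b \<in> carrier H; b' \<in> carrier H\<rbrakk> \<Longrightarrow>
    join31 w b \<otimes>\<^bsub>T4\<^esub> join31 w' b' = join31 (w \<otimes>\<^bsub>T3\<^esub> w') (b \<otimes>\<^bsub>H\<^esub> b')"
  by (simp_all add: T3Hpure_lin algebra_homD(2-4)[OF reassoc4_hom, simplified]
     algebra_homD(4)[OF reassoc4_hom, simplified, symmetric] mult_pure_tensor)

lemma fourfold_pure [simp]:
  "\<lbrakk>a \<in> carrier H; s \<in> C2\<rbrakk> \<Longrightarrow>
    id_id_comult (pure3 a s) = pure4 a (id_comult R H s)"
  "\<lbrakk>a \<in> carrier H; s \<in> C2\<rbrakk> \<Longrightarrow>
    id_comult_id (pure3 a s) = pure4 a (comult_id R H s)"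
  "\<lbrakk>a \<in> carrier H; s \<in> C2\<rbrakk> \<Longrightarrow>
    comult_id_id (pure3 a s) = join22 (\<Delta> a) s"
  unfolding id_id_comult_def id_comult_id_def comult_id_id_def
  by (simp_all add: tensor_map_pure linear_map_id algebra_homD(1)[OF id_comult_hom]
      algebra_homD(1)[OF comult_id_hom] algebra_homD(1)[OF comult_hom])

context fixes s b assumes s: "s \<in> C2" and b [simp]: "b \<in> carrier H"
begin

lemma id_id_comult_join21: "id_id_comult (join21 s b) = join22 s (\<Delta> b)"
  using s by (induction rule: T2_induct) (simp_all add: id_comult_pure)

lemma join31_join21: "t \<in> C2 \<Longrightarrow> c \<in> carrier H \<Longrightarrow> join31 (join21 t c) b = join22 t (pure2 c b)"
  by (induction rule: T2_induct) simp_all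

lemma comult_id_id_join21: "comult_id_id (join21 s b) = join31 (comult_id R H s) b"
  using s by (induction rule: T2_induct) (simp_all add: comult_id_pure join31_join21)

lemma id_comult_id_join21: "id_comult_id (join21 s b) = join31 (id_comult R H s) b"
  using s by (induction rule: T2_induct) (simp_all add: id_comult_pure comult_id_pure)

end

text \<open>Quasi-coassociativity in the last three factors: on \<open>a \<otimes> b\<close> it is
  \<open>a \<otimes> \<phi> (\<Delta> \<otimes> id)(\<Delta>(b)) = a \<otimes> (id \<otimes> \<Delta>)(\<Delta>(b)) \<phi>\<close>. It moves \<open>1 \<otimes> \<phi>\<close> past \<open>F\<close> in the cocycle condition.\<close>

lemma one_tensor3_phi_id_comult:
  assumes "u \<in> C2"
  shows "one_tensor3 \<phi> \<otimes>\<^bsub>T4\<^esub> id_comult_id (id_comult R H u) = id_id_comult (id_comult R H u) \<otimes>\<^bsub>T4\<^esub> one_tensor3 \<phi>"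
  using assms
  by (induction rule: T2_induct)
    (simp_all add: id_comult_pure one_tensor3_def mult_pure_tensor quasi_coassoc T4 del: fourfold_homs(17-20))

text \<open>Quasi-coassociativity in the first three factors; it moves \<open>\<phi> \<otimes> 1\<close> past \<open>G\<close> in the cocycle condition.\<close>

lemma comult_id_phi_one:
  assumes "u \<in> C2"
  shows "id_comult_id (comult_id R H u) \<otimes>\<^bsub>T4\<^esub> tensor3_one \<phi> = tensor3_one \<phi> \<otimes>\<^bsub>T4\<^esub> comult_id_id (comult_id R H u)"
  using assms
proof (induction rule: T2_induct)
  case (pure a b)
  then show ?case
    by (simp add: comult_id_pure tensor3_one_def id_comult_id_join21 comult_id_id_join21 quasi_coassoc)
qed (simp_all add: T4)

lemma comult_id_id_tensor_one:
  "u \<in> C2 \<Longrightarrow> comult_id_id (tensor_one R H u) = tensor3_one (comult_id R H u)"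
  by (simp add: tensor_one_join21 comult_id_id_join21 tensor3_one_def)

lemma id_comult_id_tensor_one:
  "u \<in> C2 \<Longrightarrow> id_comult_id (tensor_one R H u) = tensor3_one (id_comult R H u)"
  by (simp add: tensor_one_join21 id_comult_id_join21 tensor3_one_def)

lemma id_id_comult_tensor_one:
  "u \<in> C2 \<Longrightarrow> id_id_comult (tensor_one R H u) = join22 u \<one>\<^bsub>T2\<^esub>"
  by (simp add: tensor_one_join21 id_id_comult_join21)

lemma tensor3_one_tensor_one:
  "u \<in> C2 \<Longrightarrow> tensor3_one (tensor_one R H u) = join22 u \<one>\<^bsub>T2\<^esub>"
  by (simp add: tensor_one_join21 tensor3_one_def join31_join21 one_tensor_alg)

text \<open>Both sides are \<open>(\<Delta> \<otimes> \<Delta>)(u)\<close>. In the twisted cocycle condition the values at \<open>G\<close> and \<open>F\<close> meet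
  and cancel.\<close>

lemma id_id_comult_comult_id:
  "u \<in> C2 \<Longrightarrow> id_id_comult (comult_id R H u) = comult_id_id (id_comult R H u)"
  by (induction rule: T2_induct) (simp_all add: comult_id_pure id_comult_pure id_id_comult_join21)

lemma one_tensor3_pure:
  assumes "u \<in> C2"
  shows "id_id_comult (one_tensor R H u) = one_tensor3 (id_comult R H u)"
    and "id_comult_id (one_tensor R H u) = one_tensor3 (comult_id R H u)"
    and "comult_id_id (one_tensor R H u) = one_tensor3 (one_tensor R H u)"
    and "tensor3_one (one_tensor R H u) = one_tensor3 (tensor_one R H u)"
    and "one_tensor3 (one_tensor R H u) = join22 \<one>\<^bsub>T2\<^esub> u"
  using assms by (simp_all add: one_tensor_def one_tensor3_def tensor3_one_def tensor_one_def[symmetric] 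
      one_tensor_alg[of R H H] del: structure_homs fourfold_homs)

end

section \<open>The twisted quasi-Hopf algebra\<close>

locale twisted_quasi_hopf = quasi_hopf_alg R H
  for R :: "('k, 'r) ring_scheme" and H :: "('k, 'h) quasi_hopf_algebra" +
  fixes F :: "('h, 'h) tens"
  assumes twist: "cochain_twist R H F"
begin

abbreviation "G \<equiv> inv\<^bsub>T2\<^esub> F"
abbreviation "HF \<equiv> twisted_algebra R H F"

lemma F_unit: "F \<in> Units T2" and counit_F [simp]: "counit_left R H F = \<one>\<^bsub>H\<^esub>" "counit_right R H F = \<one>\<^bsub>H\<^esub>"
  using twist by (auto simp: cochain_twist_def)

lemma monoid_T2: "monoid T2" and monoid_T3: "monoid T3"
  using ring_T2 ring_T3 by (auto dest: ring.is_monoid)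

lemma F_closed [simp]: "F \<in> C2"
  using F_unit by (simp add: Units_def)

lemma G_closed [simp]: "G \<in> C2"
  using monoid.Units_inv_closed[OF monoid_T2 F_unit] by simp

lemma FG [simp]: "F \<otimes>\<^bsub>T2\<^esub> G = \<one>\<^bsub>T2\<^esub>" "G \<otimes>\<^bsub>T2\<^esub> F = \<one>\<^bsub>T2\<^esub>"
  using monoid.Units_r_inv[OF monoid_T2 F_unit] monoid.Units_l_inv[OF monoid_T2 F_unit] by auto

lemma counit_G [simp]: "counit_left R H G = \<one>\<^bsub>H\<^esub>" "counit_right R H G = \<one>\<^bsub>H\<^esub>"
proof -
  show "counit_left R H G = \<one>\<^bsub>H\<^esub>" using structure_homs(3)[of F G] by simp
  show "counit_right R H G = \<one>\<^bsub>H\<^esub>" using structure_homs(7)[of F G] by simp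
qed

lemmas assoc = T2(11) T3(11) T4(11)

text \<open>Every algebra homomorphism out of \<open>H \<otimes> H\<close> keeps \<open>F\<close> and \<open>G\<close> mutually inverse. With products bracketed
  to the right, these rules carry out the cancellations of the twisted axioms.\<close>

lemma hom_cancel:
  assumes f: "algebra_hom R T2 B f" and B: "unital_algebra R B"
  shows "f F \<otimes>\<^bsub>B\<^esub> f G = \<one>\<^bsub>B\<^esub>" "f G \<otimes>\<^bsub>B\<^esub> f F = \<one>\<^bsub>B\<^esub>"
    "x \<in> carrier B \<Longrightarrow> f F \<otimes>\<^bsub>B\<^esub> (f G \<otimes>\<^bsub>B\<^esub> x) = x"
    "x \<in> carrier B \<Longrightarrow> f G \<otimes>\<^bsub>B\<^esub> (f F \<otimes>\<^bsub>B\<^esub> x) = x"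
proof -
  interpret B: ring B using unital_algebraD(2)[OF B] .
  show 1: "f F \<otimes>\<^bsub>B\<^esub> f G = \<one>\<^bsub>B\<^esub>" "f G \<otimes>\<^bsub>B\<^esub> f F = \<one>\<^bsub>B\<^esub>"
    using algebra_homD(4,5)[OF f, simplified] FG F_closed G_closed by metis+
  show "x \<in> carrier B \<Longrightarrow> f F \<otimes>\<^bsub>B\<^esub> (f G \<otimes>\<^bsub>B\<^esub> x) = x"
    "x \<in> carrier B \<Longrightarrow> f G \<otimes>\<^bsub>B\<^esub> (f F \<otimes>\<^bsub>B\<^esub> x) = x"
    using algebra_homD(2)[OF f, simplified] 1 by (simp_all add: B.m_assoc[symmetric])
qed

lemmas cancel [simp] =
  hom_cancel[OF algebra_hom_id, simplified]
  hom_cancel[OF id_comult_hom, simplified]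
  hom_cancel[OF comult_id_hom, simplified]
  hom_cancel[OF one_tensor_hom, simplified]
  hom_cancel[OF tensor_one_hom, simplified]

lemma HF_sel [simp]:
  "carrier HF = carrier H" "monoid.mult HF = monoid.mult H" "one HF = one H" "ring.zero HF = ring.zero H"
  "add HF = add H" "smult HF = smult H" "counit HF = \<epsilon>" "antipode HF = S"
  by (simp_all add: twisted_algebra_def Let_def)

lemma HF_data:
  "comult HF h = F \<otimes>\<^bsub>T2\<^esub> \<Delta> h \<otimes>\<^bsub>T2\<^esub> G"
  "coassociator HF = one_tensor R H F \<otimes>\<^bsub>T3\<^esub> id_comult R H F \<otimes>\<^bsub>T3\<^esub> \<phi> \<otimes>\<^bsub>T3\<^esub> comult_id R H G \<otimes>\<^bsub>T3\<^esub> tensor_one R H G"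
  "qalpha HF = alpha_form (qalpha H) G"
  "qbeta HF = beta_form (qbeta H) F"
  by (simp_all add: twisted_algebra_def Let_def alpha_form_def beta_form_def)

lemma same_module_HF [simp]: "same_module HF H"
  by (simp add: same_module_def)

lemma linear_conj:
  assumes B: "unital_algebra R B" and f: "linear_map R A B f" and u: "u \<in> carrier B" and v: "v \<in> carrier B"
  shows "linear_map R A B (\<lambda>x. u \<otimes>\<^bsub>B\<^esub> f x \<otimes>\<^bsub>B\<^esub> v)"
proof -
  interpret B: ring B using unital_algebraD(2)[OF B] .
  show ?thesis using linear_mapD[OF f] u v unital_algebraD(4,5)[OF B]
    by (auto simp: linear_map_def B.l_distr B.r_distr)
qed

lemma alg_HF [simp]: "tensor_alg R HF A = tensor_alg R H A" "tensor_alg R A HF = tensor_alg R A H"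
  by (rule tensor_alg_cong; simp)+

lemma mod_HF [simp]:
  "tensor_mod R HF A = tensor_mod R H A" "tensor_mod R A HF = tensor_mod R A H"
  "pure_tensor R HF A = pure_tensor R H A" "pure_tensor R A HF = pure_tensor R A H"
  "tensor_reassoc R HF A B = tensor_reassoc R H A B" "tensor_reassoc R A HF B = tensor_reassoc R A H B"
  "tensor_reassoc R A B HF = tensor_reassoc R A B H"
  "tensor_lift R HF A B = tensor_lift R H A B" "tensor_lift R A HF B = tensor_lift R A H B"
  "tensor_lift R A B HF = tensor_lift R A B H"
  "tensor_map R HF A B C = tensor_map R H A B C" "tensor_map R A HF B C = tensor_map R A H B C"
  "tensor_map R A B HF C = tensor_map R A B H C" "tensor_map R A B C HF = tensor_map R A B C H"
  by (rule tensor_mod_cong pure_tensor_cong tensor_reassoc_cong tensor_lift_cong tensor_map_module_cong; simp)+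

lemma HF_ops [simp]:
  "counit_left R HF = counit_left R H" "counit_right R HF = counit_right R H"
  "one_tensor R HF = one_tensor R H" "tensor_one R HF = tensor_one R H"
  by (simp_all add: counit_left_def counit_right_def one_tensor_def[abs_def] tensor_one_def[abs_def])

lemma comult_HF_hom: "algebra_hom R H T2 (comult HF)"
  unfolding algebra_hom_def HF_data(1)
  using linear_conj[OF _ algebra_homD(1)[OF comult_hom]]
  by (simp add: T2 assoc)

lemma comult_HF [simp]: "a \<in> carrier H \<Longrightarrow> comult HF a \<in> C2"
  using algebra_homD(2)[OF comult_HF_hom] by simp

text \<open>Passing from \<open>\<Delta>\<close> to \<open>\<Delta>\<^sub>F\<close> conjugates \<open>id \<otimes> \<Delta>\<close> by \<open>1 \<otimes> F\<close>, because \<open>a \<otimes> F \<Delta>(b) G\<close> is the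
  product of \<open>1 \<otimes> F\<close>, \<open>a \<otimes> \<Delta>(b)\<close> and \<open>1 \<otimes> G\<close>. The next lemmas do the same for the other maps.\<close>

lemma id_comult_HF:
  assumes "t \<in> C2"
  shows "id_comult R HF t = one_tensor R H F \<otimes>\<^bsub>T3\<^esub> id_comult R H t \<otimes>\<^bsub>T3\<^esub> one_tensor R H G"
  unfolding id_comult_def[of R HF] alg_HF mod_HF using assms
proof (induction rule: T2_induct)
  case (pure a b)
  then show ?case
    by (simp add: tensor_map_pure algebra_homD(1)[OF comult_HF_hom] linear_map_id id_comult_pure
        del: structure_homs, simp add: one_tensor_def mult_pure_tensor HF_data(1) T2 del: structure_homs)
next
  case (add x y)
  then show ?case
    by (simp add: tensor_map_add algebra_homD(1)[OF comult_HF_hom] linear_map_id T3)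
qed

lemma comult_id_HF:
  assumes "t \<in> C2"
  shows "comult_id R HF t = tensor_one R H F \<otimes>\<^bsub>T3\<^esub> comult_id R H t \<otimes>\<^bsub>T3\<^esub> tensor_one R H G"
  unfolding comult_id_def[of R HF] alg_HF mod_HF using assms
proof (induction rule: T2_induct)
  case (pure a b)
  then show ?case
    by (simp add: tensor_map_pure algebra_homD(1)[OF comult_HF_hom] linear_map_id comult_id_pure
       del: structure_homs, simp add: tensor_one_join21 HF_data(1) T2 del: structure_homs)
next
  case (add x y)
  then show ?case
    by (simp add: tensor_map_add tensor_map_closed algebra_homD(1)[OF comult_HF_hom] linear_map_id T3
      algebra_homD(3)[OF reassoc_hom3, simplified])
qed

lemma id_id_comult_HF:
  assumes "t \<in> C3"
  shows "tensor_map R H T2 H T3 (\<lambda>x. x) (id_comult R HF) t =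
    one_tensor3 (one_tensor R H F) \<otimes>\<^bsub>T4\<^esub> id_id_comult t \<otimes>\<^bsub>T4\<^esub> one_tensor3 (one_tensor R H G)"
proof -
  let ?f = "\<lambda>t. one_tensor R H F \<otimes>\<^bsub>T3\<^esub> id_comult R H t \<otimes>\<^bsub>T3\<^esub> one_tensor R H G"
  have l: "linear_map R T2 T3 ?f"
    by (rule linear_conj[OF _ algebra_homD(1)[OF id_comult_hom]]) simp_all
  have "tensor_map R H T2 H T3 (\<lambda>x. x) ?f t =
    one_tensor3 (one_tensor R H F) \<otimes>\<^bsub>T4\<^esub> id_id_comult t \<otimes>\<^bsub>T4\<^esub> one_tensor3 (one_tensor R H G)"
    using assms
  proof (induction rule: T3_induct)
    case (pure a s)
    then show ?case
      by (simp add: tensor_map_pure l linear_map_id one_tensor3_def mult_pure_tensor T3 T4)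
  next
    case (add x y)
    then show ?case by (simp add: tensor_map_add l linear_map_id T4)
  qed
  then show ?thesis
    by (subst tensor_map_cong[where f' = "\<lambda>x. x" and g' = ?f]) (simp_all add: id_comult_HF)
qed

lemma id_comult_id_HF:
  assumes "t \<in> C3"
  shows "tensor_map R H T2 H T3 (\<lambda>x. x) (comult_id R HF) t =
    one_tensor3 (tensor_one R H F) \<otimes>\<^bsub>T4\<^esub> id_comult_id t \<otimes>\<^bsub>T4\<^esub> one_tensor3 (tensor_one R H G)"
proof -
  let ?f = "\<lambda>t. tensor_one R H F \<otimes>\<^bsub>T3\<^esub> comult_id R H t \<otimes>\<^bsub>T3\<^esub> tensor_one R H G"
  have l: "linear_map R T2 T3 ?f"
    by (rule linear_conj[OF _ algebra_homD(1)[OF comult_id_hom]]) simp_all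
  have "tensor_map R H T2 H T3 (\<lambda>x. x) ?f t =
    one_tensor3 (tensor_one R H F) \<otimes>\<^bsub>T4\<^esub> id_comult_id t \<otimes>\<^bsub>T4\<^esub> one_tensor3 (tensor_one R H G)"
    using assms
  proof (induction rule: T3_induct)
    case (pure a s)
    then show ?case
      by (simp add: tensor_map_pure l linear_map_id one_tensor3_def mult_pure_tensor T3 T4)
  next
    case (add x y)
    then show ?case by (simp add: tensor_map_add l linear_map_id T4)
  qed
  then show ?thesis
    by (subst tensor_map_cong[where f' = "\<lambda>x. x" and g' = ?f]) (simp_all add: comult_id_HF)
qed

lemma comult_id_id_HF:
  assumes "t \<in> C3"
  shows "tensor_reassoc R H H T2 (tensor_map R H T2 T2 T2 (comult HF) (\<lambda>x. x) t) =
    join22 F \<one>\<^bsub>T2\<^esub> \<otimes>\<^bsub>T4\<^esub> comult_id_id t \<otimes>\<^bsub>T4\<^esub> join22 G \<one>\<^bsub>T2\<^esub>"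
  using assms
proof (induction rule: T3_induct)
  case (pure a s)
  then show ?case
    by (simp add: tensor_map_pure algebra_homD(1)[OF comult_HF_hom] linear_map_id,
      simp add: HF_data(1) T2)
next
  case (add x y)
  then show ?case
    by (simp add: tensor_map_add tensor_map_closed algebra_homD(1)[OF comult_HF_hom] linear_map_id T4
      algebra_homD(3)[OF join22_hom, simplified] T2)
qed

text \<open>\<open>u \<otimes> 1 \<otimes> 1\<close> and \<open>1 \<otimes> 1 \<otimes> v\<close> commute, being supported on different factors.\<close>

lemma join22_commute:
  assumes "u \<in> C2" "v \<in> C2"
  shows "join22 u \<one>\<^bsub>T2\<^esub> \<otimes>\<^bsub>T4\<^esub> one_tensor3 (one_tensor R H v) = one_tensor3 (one_tensor R H v) \<otimes>\<^bsub>T4\<^esub> join22 u \<one>\<^bsub>T2\<^esub>"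
  using assms by (simp add: one_tensor3_pure(5) T2)

abbreviation "\<phi>F \<equiv> one_tensor R H F \<otimes>\<^bsub>T3\<^esub> (id_comult R H F \<otimes>\<^bsub>T3\<^esub> (\<phi> \<otimes>\<^bsub>T3\<^esub> (comult_id R H G \<otimes>\<^bsub>T3\<^esub> tensor_one R H G)))"

lemma coassociator_HF: "coassociator HF = \<phi>F"
  by (simp add: HF_data T3 assoc)

lemma phi_inv [simp]: "inv\<^bsub>T3\<^esub> \<phi> \<in> C3"
    "\<phi> \<otimes>\<^bsub>T3\<^esub> inv\<^bsub>T3\<^esub> \<phi> = \<one>\<^bsub>T3\<^esub>" "inv\<^bsub>T3\<^esub> \<phi> \<otimes>\<^bsub>T3\<^esub> \<phi> = \<one>\<^bsub>T3\<^esub>"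
    "x \<in> C3 \<Longrightarrow> \<phi> \<otimes>\<^bsub>T3\<^esub> (inv\<^bsub>T3\<^esub> \<phi> \<otimes>\<^bsub>T3\<^esub> x) = x"
    "x \<in> C3 \<Longrightarrow> inv\<^bsub>T3\<^esub> \<phi> \<otimes>\<^bsub>T3\<^esub> (\<phi> \<otimes>\<^bsub>T3\<^esub> x) = x"
proof -
  show 1: "inv\<^bsub>T3\<^esub> \<phi> \<in> C3"
    "\<phi> \<otimes>\<^bsub>T3\<^esub> inv\<^bsub>T3\<^esub> \<phi> = \<one>\<^bsub>T3\<^esub>" "inv\<^bsub>T3\<^esub> \<phi> \<otimes>\<^bsub>T3\<^esub> \<phi> = \<one>\<^bsub>T3\<^esub>"
    using monoid.Units_inv_closed[OF monoid_T3 \<phi>_unit] monoid.Units_r_inv[OF monoid_T3 \<phi>_unit]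
      monoid.Units_l_inv[OF monoid_T3 \<phi>_unit] by simp_all
  show "x \<in> C3 \<Longrightarrow> \<phi> \<otimes>\<^bsub>T3\<^esub> (inv\<^bsub>T3\<^esub> \<phi> \<otimes>\<^bsub>T3\<^esub> x) = x"
    "x \<in> C3 \<Longrightarrow> inv\<^bsub>T3\<^esub> \<phi> \<otimes>\<^bsub>T3\<^esub> (\<phi> \<otimes>\<^bsub>T3\<^esub> x) = x"
    using 1 by (simp_all add: T3(11)[symmetric] T3)
qed

lemma phiF_inv:
  shows "\<phi>F \<in> Units T3"
    and "inv\<^bsub>T3\<^esub> \<phi>F = tensor_one R H F \<otimes>\<^bsub>T3\<^esub> (comult_id R H F \<otimes>\<^bsub>T3\<^esub>
      (inv\<^bsub>T3\<^esub> \<phi> \<otimes>\<^bsub>T3\<^esub> (id_comult R H G \<otimes>\<^bsub>T3\<^esub> one_tensor R H G)))" (is "_ = ?i")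
proof -
  have c: "\<phi>F \<in> carrier T3" "?i \<in> carrier T3" by (simp_all add: T3)
  have i: "\<phi>F \<otimes>\<^bsub>T3\<^esub> ?i = \<one>\<^bsub>T3\<^esub>" "?i \<otimes>\<^bsub>T3\<^esub> \<phi>F = \<one>\<^bsub>T3\<^esub>"
    by (simp_all add: T3)
  then show "\<phi>F \<in> Units T3" using c unfolding Units_def by blast
  show "inv\<^bsub>T3\<^esub> \<phi>F = ?i" using monoid.inv_unique'[OF monoid_T3 c i] by simp
qed

lemma quasi_coassoc_HF:
  assumes h: "h \<in> carrier H"
  shows "id_comult R HF (comult HF h) \<otimes>\<^bsub>T3\<^esub> \<phi>F = \<phi>F \<otimes>\<^bsub>T3\<^esub> comult_id R HF (comult HF h)"
proof -
  have q: "id_comult R H (\<Delta> h) \<otimes>\<^bsub>T3\<^esub> (\<phi> \<otimes>\<^bsub>T3\<^esub> x) = \<phi> \<otimes>\<^bsub>T3\<^esub> (comult_id R H (\<Delta> h) \<otimes>\<^bsub>T3\<^esub> x)"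
    if "x \<in> C3" for x
    using that h quasi_coassoc[OF h] by (simp add: T3(11)[symmetric])
  have c: "comult HF h \<in> C2" using h by simp
  show ?thesis unfolding id_comult_HF[OF c] comult_id_HF[OF c] 
    unfolding HF_data using h by (simp add: T2 T3 q)
qed

text \<open>The homomorphism \<open>id \<otimes> \<epsilon> \<otimes> id\<close> sends \<open>1 \<otimes> F\<close>, \<open>G \<otimes> 1\<close> and \<open>\<phi>\<close> to \<open>1\<close>, and \<open>(id \<otimes> \<Delta>)(F)\<close> and \<open>(\<Delta> \<otimes> id)(G)\<close> to
  \<open>F\<close> and \<open>G\<close>.\<close>

lemma counit_phi_HF: "tensor_map R H T2 H H (\<lambda>x. x) (counit_left R H) \<phi>F = \<one>\<^bsub>T2\<^esub>"
proof -
  let ?m = "tensor_map R H T2 H H (\<lambda>x. x) (counit_left R H)"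
  have hom: "algebra_hom R T3 T2 ?m"
    by (rule algebra_hom_tensor_map) (simp_all add: algebra_hom_id counit_left_hom)
  note [simp] = algebra_homD(2-4)[OF hom, simplified]
  have pure: "?m (pure3 a s) = pure2 a (counit_left R H s)"
    if "a \<in> carrier H" "s \<in> C2" for a s
    using that by (simp add: tensor_map_pure linear_map_id algebra_homD(1)[OF counit_left_hom])
  have join21: "?m (join21 s b) = pure2 (counit_right R H s) b"
    if "s \<in> C2" "b \<in> carrier H" for s b
    using that(1)
    by (induction rule: T2_induct)
      (simp_all add: that pure smult_pure_tensor pure_tensor_smult_right pure_tensor_add_left)
  have "?m (one_tensor R H F) = \<one>\<^bsub>T2\<^esub>" "?m (tensor_one R H G) = \<one>\<^bsub>T2\<^esub>"
    by (simp_all add: one_tensor_def tensor_one_join21 pure join21 one_tensor_alg)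
  moreover have "?m (id_comult R H F) = F"
    using F_closed by (induction rule: T2_induct) (simp_all add: id_comult_pure pure)
  moreover have "?m (comult_id R H G) = G"
    using G_closed by (induction rule: T2_induct) (simp_all add: comult_id_pure join21)
  ultimately show ?thesis
    by (simp add: counit_phi T2 T3)
qed

text \<open>Write \<open>\<Delta>\<^sub>i\<close> for \<open>\<Delta>\<close> applied in the \<open>i\<close>-th of three factors. After conjugation the left side contains
  \<open>(\<Delta> \<otimes> \<Delta>)(G)\<close> and \<open>(\<Delta> \<otimes> \<Delta>)(F)\<close>, separated only by commuting images of \<open>F\<close> and \<open>G\<close> that cancel; what remains is
  \<open>A \<Delta>\<^sub>3(\<phi>) \<Delta>\<^sub>1(\<phi>) B\<close> with
  \<open>A = (1 \<otimes> 1 \<otimes> F) (1 \<otimes> (id \<otimes> \<Delta>)(F)) \<Delta>\<^sub>3((id \<otimes> \<Delta>)(F))\<close> and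
  \<open>B = \<Delta>\<^sub>1((\<Delta> \<otimes> id)(G)) ((\<Delta> \<otimes> id)(G) \<otimes> 1) (G \<otimes> 1 \<otimes> 1)\<close>.
  The right side becomes \<open>A (1 \<otimes> \<phi>) \<Delta>\<^sub>2(\<phi>) (\<phi> \<otimes> 1) B\<close> on moving \<open>1 \<otimes> \<phi>\<close> and \<open>\<phi> \<otimes> 1\<close> inwards, and
  the cocycle condition for \<open>\<phi>\<close> joins the two.\<close>

lemma cocycle_HF: "cocycle_lhs R HF = cocycle_rhs R HF"
proof -
  note c4 [simp] = hom_cancel[OF algebra_hom_compose[OF one_tensor_hom one_tensor3_hom], simplified]
     hom_cancel[OF algebra_hom_compose[OF tensor_one_hom one_tensor3_hom], simplified]
     hom_cancel[OF algebra_hom_compose[OF id_comult_hom comult_id_id_hom], simplified]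
     hom_cancel[OF algebra_hom_compose[OF comult_id_hom one_tensor3_hom], simplified]
     hom_cancel[OF algebra_hom_compose[OF id_comult_hom tensor3_one_hom], simplified]
     hom_cancel[OF algebra_hom_compose[OF tensor_one_hom tensor3_one_hom], simplified, unfolded tensor3_one_tensor_one[OF F_closed] tensor3_one_tensor_one[OF G_closed]]
  have one4 [simp]: "\<one>\<^bsub>T2\<^esub> \<in> C2" by (simp add: T2)
  have com: "join22 G \<one>\<^bsub>T2\<^esub> \<otimes>\<^bsub>T4\<^esub> (one_tensor3 (one_tensor R H G) \<otimes>\<^bsub>T4\<^esub> x) =
      one_tensor3 (one_tensor R H G) \<otimes>\<^bsub>T4\<^esub> (join22 G \<one>\<^bsub>T2\<^esub> \<otimes>\<^bsub>T4\<^esub> x)"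
    if "x \<in> C4" for x
    using that join22_commute[of G G] by (simp add: T4(11)[symmetric])
  have q1: "one_tensor3 \<phi> \<otimes>\<^bsub>T4\<^esub> (id_comult_id (id_comult R H F) \<otimes>\<^bsub>T4\<^esub> x)
      = id_id_comult (id_comult R H F) \<otimes>\<^bsub>T4\<^esub> (one_tensor3 \<phi> \<otimes>\<^bsub>T4\<^esub> x)"
    if "x \<in> C4" for x
    using that one_tensor3_phi_id_comult[of F] by (simp add: T4(11)[symmetric])
  have q2: "id_comult_id (comult_id R H G) \<otimes>\<^bsub>T4\<^esub> (tensor3_one \<phi> \<otimes>\<^bsub>T4\<^esub> x)
      = tensor3_one \<phi> \<otimes>\<^bsub>T4\<^esub> (comult_id_id (comult_id R H G) \<otimes>\<^bsub>T4\<^esub> x)"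
    if "x \<in> C4" for x
    using that comult_id_phi_one[of G] by (simp add: T4(11)[symmetric])
  have q3: "id_id_comult \<phi> \<otimes>\<^bsub>T4\<^esub> (comult_id_id \<phi> \<otimes>\<^bsub>T4\<^esub> x) =
      one_tensor3 \<phi> \<otimes>\<^bsub>T4\<^esub> (id_comult_id \<phi> \<otimes>\<^bsub>T4\<^esub> (tensor3_one \<phi> \<otimes>\<^bsub>T4\<^esub> x))"
    if "x \<in> C4" for x
    using that cocycle_fourfold by (simp add: T4(11)[symmetric] T4(5))
  have cl: "\<phi>F \<in> C3" by (simp add: T3)
  have l: "cocycle_lhs R HF = (one_tensor3 (one_tensor R H F) \<otimes>\<^bsub>T4\<^esub> id_id_comult \<phi>F \<otimes>\<^bsub>T4\<^esub> one_tensor3 (one_tensor R H G))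
     \<otimes>\<^bsub>T4\<^esub> (join22 F \<one>\<^bsub>T2\<^esub> \<otimes>\<^bsub>T4\<^esub> comult_id_id \<phi>F \<otimes>\<^bsub>T4\<^esub> join22 G \<one>\<^bsub>T2\<^esub>)"
    unfolding cocycle_lhs_def coassociator_HF alg_HF mod_HF
    by (simp only: id_id_comult_HF[OF cl] comult_id_id_HF[OF cl])
  have r: "cocycle_rhs R HF = one_tensor3 \<phi>F \<otimes>\<^bsub>T4\<^esub>
     (one_tensor3 (tensor_one R H F) \<otimes>\<^bsub>T4\<^esub> id_comult_id \<phi>F \<otimes>\<^bsub>T4\<^esub> one_tensor3 (tensor_one R H G)) \<otimes>\<^bsub>T4\<^esub> tensor3_one \<phi>F"
    unfolding cocycle_rhs_def coassociator_HF alg_HF mod_HF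
    by (simp only: id_comult_id_HF[OF cl] one_tensor3_def tensor3_one_def reassoc4_def HF_sel)
  note simps = one_tensor3_pure(1-4) comult_id_id_tensor_one id_comult_id_tensor_one id_id_comult_tensor_one
     tensor3_one_tensor_one id_id_comult_comult_id com q1 q2 q3
  show ?thesis unfolding l r
    by (simp add: T3 T4 simps)
qed

lemma algebra_HF: "unital_algebra R HF" "algebra_hom R HF B f = algebra_hom R H B f"
  "algebra_anti_automorphism R HF S"
proof -
  have m: "module R HF" by (rule module_cong[OF module_H]) simp_all
  interpret mF: module R HF by (rule m)
  have "ring HF"
    by (intro ringI monoidI mF.abelian_group_axioms) (simp_all add: H.m_assoc H.l_distr H.r_distr)
  then show "unital_algebra R HF"
    using m unital_algebraD(1)[OF algebra_H] by (simp add: unital_algebra_def)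
  show "algebra_hom R HF B f = algebra_hom R H B f" "algebra_anti_automorphism R HF S"
    using S_anti by (simp_all add: algebra_hom_def algebra_anti_automorphism_def linear_map_def)
qed

lemma counit_comult_HF:
  assumes "h \<in> carrier H"
  shows "counit_left R H (comult HF h) = h" "counit_right R H (comult HF h) = h"
  using assms by (simp_all add: HF_data T2)

lemma quasi_bialgebra_HF: "quasi_bialgebra R HF"
  unfolding quasi_bialgebra_def alg_HF mod_HF HF_ops HF_sel coassociator_HF algebra_HF(2)
  using algebra_HF(1) comult_HF_hom counit_hom phiF_inv(1) counit_comult_HF quasi_coassoc_HF
    cocycle_HF counit_phi_HF
  by blast

lemma antipode_comult_HF:
  assumes "h \<in> carrier H"
  shows "alpha_form (qalpha HF) (comult HF h) = \<epsilon> h \<odot>\<^bsub>H\<^esub> qalpha HF"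
    and "beta_form (qbeta HF) (comult HF h) = \<epsilon> h \<odot>\<^bsub>H\<^esub> qbeta HF"
  using assms by (simp_all add: HF_data alpha_form_twist beta_form_twist T2 alpha_beta_form_comult)

lemma zigzag_HF:
  "zigzag (qalpha HF) (qbeta HF) \<phi>F = \<one>\<^bsub>H\<^esub>"
  "zigzag_inv (qalpha HF) (qbeta HF) (inv\<^bsub>T3\<^esub> \<phi>F) = \<one>\<^bsub>H\<^esub>"
  unfolding phiF_inv(2) HF_data(3,4)
  by (simp_all add: zigzag_twist T3 zigzag_comult)

theorem quasi_hopf_HF: "quasi_hopf R HF"
  unfolding quasi_hopf_def alg_HF mod_HF HF_sel coassociator_HF
  using quasi_bialgebra_HF algebra_HF(3) antipode_comult_HF zigzag_HF
  unfolding alpha_form_def beta_form_def zigzag_def zigzag_inv_def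
  by (simp add: HF_data(3,4))

end

section \<open>Categories of modules\<close>

lemma is_category_prod:
  assumes C: "is_category C" and D: "is_category D"
  shows "is_category (prod_cat C D)"
  using C D unfolding is_category_def prod_cat_def by simp

lemma is_category_op:
  assumes C: "is_category C"
  shows "is_category (op_cat C)"
  using C unfolding is_category_def op_cat_def by simp

lemma twist_functor_id: "twist_functor = cfunctor_id"
  by (simp add: twist_functor_def cfunctor_id_def)

lemma cfunctor_comp_id: "cfunctor_comp T cfunctor_id = T" "cfunctor_comp cfunctor_id T = T"
  by (simp_all add: cfunctor_comp_def cfunctor_id_def fun_eq_iff)

lemma cfunctor_prod_id: "cfunctor_prod cfunctor_id cfunctor_id = cfunctor_id"
  by (simp add: cfunctor_prod_def cfunctor_id_def fun_eq_iff)

lemma is_functor_id: "is_category C \<Longrightarrow> is_functor C C cfunctor_id"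
  by (simp add: is_functor_def cfunctor_id_def is_category_def)

lemma is_isomorphism_id:
  assumes C: "is_category C" and X: "X \<in> cat_obj C"
  shows "is_isomorphism C (cat_id C X)"
proof -
  have i: "cat_id C X \<in> cat_arr C" "cat_dom C (cat_id C X) = X" "cat_cod C (cat_id C X) = X"
    using C X by (auto simp: is_category_def)
  have "cat_comp C (cat_id C X) (cat_id C (cat_dom C (cat_id C X))) = cat_id C X"
    using C i(1) unfolding is_category_def by blast
  then show ?thesis using i unfolding is_isomorphism_def by auto
qed

lemma equivalence_id:
  assumes C: "is_category C"
  shows "equivalence_of_categories C C cfunctor_id"
proof -
  have "natural_iso C C cfunctor_id cfunctor_id (cat_id C)"
    using C is_functor_id[OF C] is_isomorphism_id[OF C] unfolding natural_iso_def
    by (auto simp: cfunctor_id_def is_category_def)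
  then show ?thesis
    using is_functor_id[OF C] unfolding equivalence_of_categories_def
    by (metis cfunctor_comp_id(1))
qed

lemma prod_cat_sel [simp]:
  "cat_obj (prod_cat C D) = cat_obj C \<times> cat_obj D" "cat_arr (prod_cat C D) = cat_arr C \<times> cat_arr D"
  "cat_dom (prod_cat C D) (f, f') = (cat_dom C f, cat_dom D f')"
  "cat_cod (prod_cat C D) (f, f') = (cat_cod C f, cat_cod D f')"
  "cat_id (prod_cat C D) (X, Y) = (cat_id C X, cat_id D Y)"
  "cat_comp (prod_cat C D) (g, g') (f, f') = (cat_comp C g f, cat_comp D g' f')"
  by (simp_all add: prod_cat_def)

lemma op_cat_sel [simp]:
  "cat_obj (op_cat C) = cat_obj C" "cat_arr (op_cat C) = cat_arr C"
  "cat_dom (op_cat C) = cat_cod C" "cat_cod (op_cat C) = cat_dom C"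
  "cat_id (op_cat C) = cat_id C" "cat_comp (op_cat C) g f = cat_comp C f g"
  by (simp_all add: op_cat_def)

lemma module_cat_sel [simp]:
  "X \<in> cat_obj (module_cat R K) \<longleftrightarrow> left_module R K X"
  "a \<in> cat_arr (module_cat R K) \<longleftrightarrow> is_arrow R K a"
  "cat_dom (module_cat R K) a = fst a" "cat_cod (module_cat R K) a = snd (snd a)"
  "cat_id (module_cat R K) = id_arrow" "cat_comp (module_cat R K) = comp_arrow"
  by (simp_all add: module_cat_def)

lemma extend_sel [simp]:
  "carrier (module.extend M m) = carrier M" "add (module.extend M m) = add M"
  "ring.zero (module.extend M m) = ring.zero M" "smult (module.extend M m) = smult M"
  "act (module.extend M \<lparr>act = a\<rparr>) = a"
  by (simp_all add: module.extend_def)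

lemma same_module_extend [simp]: "same_module (module.extend M m) M"
  by (simp add: same_module_def)

lemma tensor_module_sel [simp]:
  "carrier (tensor_module R H V W) = carrier (tensor_mod R V W)"
  "add (tensor_module R H V W) = add (tensor_mod R V W)"
  "ring.zero (tensor_module R H V W) = ring.zero (tensor_mod R V W)"
  "smult (tensor_module R H V W) = smult (tensor_mod R V W)"
  "act (tensor_module R H V W) h = act2 R H V W (comult H h)"
  by (simp_all add: tensor_module_def)

lemma same_module_tensor [simp]: "same_module (tensor_module R H V W) (tensor_mod R V W)"
  by (simp add: same_module_def)

lemma carrier_hom_mod [simp]: "carrier (hom_mod R V W) = lin_hom R V W"
  by (simp add: hom_mod_def)

lemma hom_module_sel [simp]:
  "carrier (hom_module R H V W) = lin_hom R V W"
  "add (hom_module R H V W) = add (hom_mod R V W)"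
  "ring.zero (hom_module R H V W) = ring.zero (hom_mod R V W)"
  "smult (hom_module R H V W) = smult (hom_mod R V W)"
  "act (hom_module R H V W) h = hom_act R H V W (comult H h)"
  by (simp_all add: hom_module_def)

lemma tensor_module_flatten:
  "tensor_mod R (tensor_module R H V W) X = tensor_mod R (tensor_mod R V W) X"
  "tensor_mod R X (tensor_module R H V W) = tensor_mod R X (tensor_mod R V W)"
  "tensor_map R (tensor_module R H V W) X Y Z = tensor_map R (tensor_mod R V W) X Y Z"
  "tensor_map R X (tensor_module R H V W) Y Z = tensor_map R X (tensor_mod R V W) Y Z"
  "tensor_map R X Y (tensor_module R H V W) Z = tensor_map R X Y (tensor_mod R V W) Z"
  "tensor_map R X Y Z (tensor_module R H V W) = tensor_map R X Y Z (tensor_mod R V W)"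
  "tensor_act R A B (tensor_module R H V W) X = tensor_act R A B (tensor_mod R V W) X"
  "tensor_act R A B X (tensor_module R H V W) = tensor_act R A B X (tensor_mod R V W)"
  "lin_hom R (tensor_module R H V W) Y = lin_hom R (tensor_mod R V W) Y"
  "lin_hom R Y (tensor_module R H V W) = lin_hom R Y (tensor_mod R V W)"
  by (rule tensor_mod_cong tensor_map_module_cong tensor_act_cong lin_hom_cong; simp)+

lemma left_module_iff: "left_module R H V \<longleftrightarrow> algebra_action R H V (act V)"
  by (auto simp: left_module_def algebra_action_def bilinear_map_def)

lemma is_arrow_iff: "is_arrow R H (V, f, W) \<longleftrightarrow>
    left_module R H V \<and> left_module R H W \<and> f \<in> lin_hom R V W \<and>
    (\<forall>h\<in>carrier H. \<forall>v\<in>carrier V. f (act V h v) = act W h (f v))"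
  by (simp add: is_arrow_def)

lemma is_category_module_cat:
  fixes R :: "('k, 'r) ring_scheme" and H :: "('k, 'h) quasi_hopf_algebra"
  shows "is_category (module_cat R H :: ('k, 'h, 'v) hmod_cat)"
proof -
  have 1: "is_arrow R H (id_arrow V)" if "left_module R H V" for V :: "('k, 'h, 'v) hmodule"
  proof -
    interpret module R V using that by (simp add: left_module_def)
    show ?thesis using that algebra_actionD(5)[OF that[unfolded left_module_iff]]
      by (auto simp: id_arrow_def is_arrow_iff lin_hom_def linear_map_def)
  qed
  have 2: "is_arrow R H (V, compose (carrier V) g f, X)"
    if f: "is_arrow R H (V, f, W)" and g: "is_arrow R H (W, g, X)" for V W X :: "('k, 'h, 'v) hmodule" and f g
  proof -
    have V: "left_module R H V" using f by (simp add: is_arrow_iff)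
    interpret module R V using V by (simp add: left_module_def)
    have act: "act V h v \<in> carrier V" if "h \<in> carrier H" "v \<in> carrier V" for h v
      using algebra_actionD(5)[OF V[unfolded left_module_iff] that] .
    have fl: "linear_map R V W f" and gl: "linear_map R W X g"
      using f g by (simp_all add: is_arrow_iff lin_hom_def)
    have "linear_map R V X (compose (carrier V) g f)"
      using linear_map_compose[OF fl gl]
      by (subst linear_map_cong[OF module_axioms, of _ "\<lambda>v. g (f v)"]) (simp_all add: compose_def)
    moreover have "g (f (act V h v)) = act X h (g (f v))" if "h \<in> carrier H" "v \<in> carrier V" for h v
      using f g that linear_mapD(1)[OF fl] by (simp add: is_arrow_iff)
    ultimately show ?thesis using f g act by (simp add: is_arrow_iff lin_hom_def compose_def)
  qed
  have 3: "compose (carrier V) f (\<lambda>v\<in>carrier V. v) = f" "compose (carrier V) (\<lambda>v\<in>carrier W. v) f = f"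
    if "is_arrow R H (V, f, W)" for V W :: "('k, 'h, 'v) hmodule" and f
    using that by (auto simp: is_arrow_iff lin_hom_def linear_map_def compose_def Pi_iff extensional_def fun_eq_iff)
  have 4: "compose (carrier V) h (compose (carrier V) g f) = compose (carrier V) (compose (carrier W) h g) f"
    if "is_arrow R H (V, f, W)" for V W :: "('k, 'h, 'v) hmodule" and f and g h :: "'v \<Rightarrow> 'v"
    using that by (auto simp: is_arrow_iff lin_hom_def linear_map_def compose_def Pi_iff fun_eq_iff restrict_def)
  have arr: "left_module R H V \<and> left_module R H W" if "is_arrow R H (V, f, W)"
    for V W :: "('k, 'h, 'v) hmodule" and f using that by (simp add: is_arrow_iff)
  show ?thesis
    unfolding is_category_def module_cat_def cat.simps mem_Collect_eq Ball_def split_paired_All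
    using 1
    by (simp add: comp_arrow_def id_arrow_def 2 3 4 arr)
qed

context quasi_hopf_alg
begin

section \<open>Modules from actions of the tensor square\<close>

text \<open>Tensor product and internal hom are both of this form, so the module laws, and below the effect
  of a twist, are treated once for the two of them.\<close>

lemma left_module_extend:
  assumes t: "algebra_action R T2 M \<tau>"
  shows "left_module R H (module.extend M \<lparr>act = (\<lambda>h. \<tau> (\<Delta> h))\<rparr>)"
proof -
  have m: "module R (module.extend M \<lparr>act = (\<lambda>h. \<tau> (\<Delta> h))\<rparr>)"
    by (rule module_cong[OF algebra_actionD(1)[OF t]]) simp_all
  note b = bilinear_mapD[OF algebra_actionD(2)[OF t], simplified]
  show ?thesis
    unfolding left_module_iff algebra_action_def bilinear_map_def linear_map_def
    using m b algebra_actionD(3,4)[OF t, simplified]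
      linear_mapD(3)[OF algebra_homD(1)[OF comult_hom]]
    by (simp add: Pi_iff)
qed

lemma act2_action:
  assumes "left_module R H V" "left_module R H W"
  shows "algebra_action R T2 (tensor_mod R V W) (act2 R H V W)"
  unfolding act2_def using assms by (intro algebra_action_tensor) (simp_all add: left_module_iff)

lemma left_module_tensor:
  assumes "left_module R H V" "left_module R H W"
  shows "left_module R H (tensor_module R H V W)"
  unfolding tensor_module_def by (rule left_module_extend[OF act2_action[OF assms]])

lemma module_hom_mod:
  assumes V: "module R V" and W: "module R W"
  shows "module R (hom_mod R V W)"
proof -
  interpret V: module R V by (rule V)
  interpret W: module R W by (rule W)
  let ?M = "hom_mod R V W"
  have ext: "f = g" if "f \<in> lin_hom R V W" "g \<in> lin_hom R V W" "\<And>v. v \<in> carrier V \<Longrightarrow> f v = g v" for f g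
    using that by (rule lin_hom_eqI)
  have c: "carrier ?M = lin_hom R V W" by (simp add: hom_mod_def)
  have ap: "f v \<in> carrier W" if "f \<in> lin_hom R V W" "v \<in> carrier V" for f v
    by (rule linear_mapD(1)[OF lin_homD(1)[OF that(1)] that(2)])
  have add_v: "(f \<oplus>\<^bsub>?M\<^esub> g) v = f v \<oplus>\<^bsub>W\<^esub> g v" if "v \<in> carrier V" for f g v using that by (simp add: hom_mod_def)
  have sm_v: "(r \<odot>\<^bsub>?M\<^esub> f) v = r \<odot>\<^bsub>W\<^esub> f v" if "v \<in> carrier V" for f r v using that by (simp add: hom_mod_def)
  have z_v: "\<zero>\<^bsub>?M\<^esub> v = \<zero>\<^bsub>W\<^esub>" if "v \<in> carrier V" for v using that by (simp add: hom_mod_def)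
  have ext_c: "f \<oplus>\<^bsub>?M\<^esub> g \<in> extensional (carrier V)" "r \<odot>\<^bsub>?M\<^esub> f \<in> extensional (carrier V)"
    "\<zero>\<^bsub>?M\<^esub> \<in> extensional (carrier V)" for f g r
    by (simp_all add: hom_mod_def)
  have add_c: "f \<oplus>\<^bsub>?M\<^esub> g \<in> lin_hom R V W" if "f \<in> lin_hom R V W" "g \<in> lin_hom R V W" for f g
  proof -
    have "linear_map R V W (f \<oplus>\<^bsub>?M\<^esub> g)"
      by (rule linear_mapI)
        (use linear_mapD[OF lin_homD(1)[OF that(1)]] linear_mapD[OF lin_homD(1)[OF that(2)]] in
         \<open>simp_all add: add_v module_closed(5)[OF W] W.smult_r_distr\<close>)
    then show ?thesis by (simp add: lin_hom_def ext_c)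
  qed
  have sm_c: "r \<odot>\<^bsub>?M\<^esub> f \<in> lin_hom R V W" if "f \<in> lin_hom R V W" "r \<in> carrier R" for f r
  proof -
    have "linear_map R V W (r \<odot>\<^bsub>?M\<^esub> f)"
      by (rule linear_mapI)
        (use linear_mapD[OF lin_homD(1)[OF that(1)]] that in
         \<open>simp_all add: sm_v W.smult_r_distr module_closed(4)[OF W]\<close>)
    then show ?thesis by (simp add: lin_hom_def ext_c)
  qed
  have z_c: "\<zero>\<^bsub>?M\<^esub> \<in> lin_hom R V W"
    by (auto simp: lin_hom_def ext_c z_v intro!: linear_mapI)
  have neg: "\<exists>g\<in>lin_hom R V W. g \<oplus>\<^bsub>?M\<^esub> f = \<zero>\<^bsub>?M\<^esub>" if f: "f \<in> lin_hom R V W" for f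
  proof -
    \<comment> \<open>the negative of a linear map is its multiple by \<open>-1\<close>, hence again linear\<close>
    have "\<ominus>\<^bsub>R\<^esub> \<one>\<^bsub>R\<^esub> \<odot>\<^bsub>?M\<^esub> f \<oplus>\<^bsub>?M\<^esub> f = \<zero>\<^bsub>?M\<^esub>"
      by (rule ext) (use f in \<open>simp_all add: add_c sm_c z_c add_v sm_v z_v W.smult_l_minus ap W.M.l_neg\<close>)
    then show ?thesis using f sm_c by blast
  qed
  show ?thesis
    by (intro moduleI abelian_groupI unital_algebraD(1)[OF algebra_H]; unfold c)
      (auto intro!: ext neg simp: add_c sm_c z_c add_v sm_v z_v W.smult_l_distr W.smult_r_distr W.smult_assoc1 ap
       W.M.a_ac)
qed

lemma hom_act_aux:
  assumes V: "left_module R H V" and W: "left_module R H W"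
  shows hom_act_bilinear: "bilinear_map R T2 (hom_mod R V W) (hom_mod R V W) (hom_act R H V W)"
    and hom_act_pure: "\<lbrakk>a \<in> carrier H; b \<in> carrier H; L \<in> lin_hom R V W\<rbrakk> \<Longrightarrow>
      hom_act R H V W (pure2 a b) L = (\<lambda>v\<in>carrier V. act W a (L (act V (S b) v)))"
proof -
  let ?M = "hom_mod R V W"
  note Va = V[unfolded left_module_iff] and Wa = W[unfolded left_module_iff]
  note mV = algebra_actionD(1)[OF Va] and mW = algebra_actionD(1)[OF Wa]
  interpret V: module R V by (rule mV)
  interpret W: module R W by (rule mW)
  note bV = bilinear_mapD(3-)[OF algebra_actionD(2)[OF Va]] and bW = bilinear_mapD(3-)[OF algebra_actionD(2)[OF Wa]]
  let ?b = "\<lambda>L a b. \<lambda>v\<in>carrier V. act W a (L (act V (S b) v))"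
  note d = hom_mod_def lin_hom_def linear_map_def Pi_iff
  have b: "bilinear_map R H H ?M (?b L)" if "L \<in> lin_hom R V W" for L
    using that bV bW by (auto simp: bilinear_map_def d fun_eq_iff restrict_def extensional_def)
  have l: "linear_map R ?M ?M (\<lambda>L. ?b L a b)" if "a \<in> carrier H" "b \<in> carrier H" for a b
    using that bV bW by (auto simp: bilinear_map_def d fun_eq_iff restrict_def extensional_def)
  have c: "carrier ?M = lin_hom R V W" by (simp add: hom_mod_def)
  have "bilinear_map R (tensor_mod R H H) ?M ?M (hom_act R H V W)"
    unfolding hom_act_def
    by (rule bilinear_lift_param(2)) (simp_all add: module_hom_mod mV mW b l c)
  then show "bilinear_map R T2 ?M ?M (hom_act R H V W)"
    by (simp add: bilinear_map_cong[OF same_module_tensor_alg same_module_refl same_module_refl])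
  show "\<lbrakk>a \<in> carrier H; b \<in> carrier H; L \<in> lin_hom R V W\<rbrakk> \<Longrightarrow>
      hom_act R H V W (pure2 a b) L = ?b L a b"
    unfolding hom_act_def by (simp add: lift_pure module_hom_mod mV mW b)
qed

text \<open>That \<open>S\<close> is an anti-homomorphism makes the contravariant argument into a left action:
  \<open>a a' L S(b b') = a (a' L S(b')) S(b)\<close>.\<close>

lemma hom_act_action:
  assumes V: "left_module R H V" and W: "left_module R H W"
  shows "algebra_action R T2 (hom_mod R V W) (hom_act R H V W)"
proof -
  let ?M = "hom_mod R V W"
  note Va = V[unfolded left_module_iff] and Wa = W[unfolded left_module_iff]
  have m: "module R ?M" using algebra_actionD(1)[OF Va] algebra_actionD(1)[OF Wa] by (rule module_hom_mod)
  have c: "carrier ?M = lin_hom R V W" by (simp add: hom_mod_def)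
  note b = bilinear_mapD[OF hom_act_bilinear[OF V W], simplified]
  have pure: "hom_act R H V W (s \<otimes>\<^bsub>T2\<^esub> t) L = hom_act R H V W s (hom_act R H V W t L)"
    if s: "s \<in> C2" and t: "t \<in> C2" and L: "L \<in> lin_hom R V W" for s t L
    using s
  proof (induction rule: T2_induct)
    case (pure a1 b1)
    note ab = pure
    show ?case using t
    proof (induction rule: T2_induct)
      case (pure a2 b2)
      have "hom_act R H V W (pure2 a2 b2) L \<in> lin_hom R V W"
        using b(3) pure L by simp
      then show ?case using ab pure L algebra_actionD(3,5)[OF Va] algebra_actionD(3,5)[OF Wa] linear_mapD(1)[OF lin_homD(1)[OF L]]
        by (simp add: hom_act_pure[OF V W] mult_pure_tensor fun_eq_iff restrict_def)
    next
      case (add x y)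
      then show ?case using ab L by (simp add: b(3,4,5) T2)
    qed
  next
    case (add x y)
    then show ?case using t L by (simp add: b(3,4,5) T2)
  qed
  have unit: "hom_act R H V W \<one>\<^bsub>T2\<^esub> L = L" if "L \<in> lin_hom R V W" for L
    using that algebra_actionD(4)[OF Va] algebra_actionD(4)[OF Wa] linear_mapD(1)[OF lin_homD(1)[OF that]]
    by (auto simp: one_tensor_alg hom_act_pure[OF V W] lin_hom_def extensional_def fun_eq_iff restrict_def)
  show ?thesis unfolding algebra_action_def
    using m hom_act_bilinear[OF V W] pure unit by (simp add: c)
qed

lemma left_module_hom:
  assumes "left_module R H V" "left_module R H W"
  shows "left_module R H (hom_module R H V W)"
  unfolding hom_module_def by (rule left_module_extend[OF hom_act_action[OF assms]])

lemma unit_sel [simp]: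
  "carrier (unit_module R H) = carrier R" "add (unit_module R H) = add R"
  "ring.zero (unit_module R H) = ring.zero R" "smult (unit_module R H) = monoid.mult R"
  "act (unit_module R H) h c = \<epsilon> h \<otimes>\<^bsub>R\<^esub> c"
  by (simp_all add: unit_module_def base_algebra_def)

lemma left_module_unit: "left_module R H (unit_module R H)"
proof -
  have "module R (unit_module R H)"
    by (intro moduleI abelian_groupI unital_algebraD(1)[OF algebra_H])
      (auto simp: mod.R.a_ac mod.R.m_ac mod.R.l_distr mod.R.r_distr intro: mod.R.l_neg)
  then show ?thesis
    unfolding left_module_iff algebra_action_def bilinear_map_def linear_map_def
    by (simp add: Pi_iff mod.R.m_ac mod.R.l_distr mod.R.r_distr)
qed

lemma is_arrowD:
  assumes "is_arrow R H (V, f, W)"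
  shows "left_module R H V" "left_module R H W" "module R V" "module R W" "f \<in> lin_hom R V W" "linear_map R V W f"
    "\<lbrakk>h \<in> carrier H; v \<in> carrier V\<rbrakk> \<Longrightarrow> f (act V h v) = act W h (f v)"
    "v \<in> carrier V \<Longrightarrow> f v \<in> carrier W"
  using assms by (auto simp: is_arrow_iff lin_hom_def left_module_def linear_map_def)

lemma left_moduleD:
  assumes "left_module R H V"
  shows "module R V" "bilinear_map R H V V (act V)" "algebra_action R H V (act V)"
    "\<lbrakk>h \<in> carrier H; v \<in> carrier V\<rbrakk> \<Longrightarrow> act V h v \<in> carrier V"
    "v \<in> carrier V \<Longrightarrow> act V \<one>\<^bsub>H\<^esub> v = v"
  using assms algebra_actionD[of R H V "act V"] by (auto simp: left_module_iff)

lemma restrict_in_lin_hom: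
  assumes "module R V" "linear_map R V W f"
  shows "(\<lambda>v\<in>carrier V. f v) \<in> lin_hom R V W"
proof -
  have "linear_map R V W (\<lambda>v\<in>carrier V. f v) \<longleftrightarrow> linear_map R V W f"
    by (rule linear_map_cong[OF assms(1)]) simp
  then show ?thesis using assms(2) by (simp add: lin_hom_def)
qed

lemma act2_natural:
  assumes f: "is_arrow R H (V, f, V')" and g: "is_arrow R H (W, g, W')"
    and t: "t \<in> C2" and x: "x \<in> carrier (tensor_mod R V W)"
  shows "tensor_map R V W V' W' f g (act2 R H V W t x) = act2 R H V' W' t (tensor_map R V W V' W' f g x)"
  unfolding act2_def
  using t x by (intro tensor_map_act) (simp_all add: is_arrowD[OF f] is_arrowD[OF g] left_moduleD is_arrowD(1,2)[OF f, THEN left_moduleD(2)] is_arrowD(1,2)[OF g, THEN left_moduleD(2)])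

lemma hom_act_natural:
  assumes f: "is_arrow R H (V', f, V)" and g: "is_arrow R H (W, g, W')"
    and t: "t \<in> C2" and L: "L \<in> lin_hom R V W"
  shows "(\<lambda>v\<in>carrier V'. g (hom_act R H V W t L (f v))) = hom_act R H V' W' t (\<lambda>v\<in>carrier V'. g (L (f v)))"
proof -
  note V = is_arrowD(2)[OF f] and W = is_arrowD(1)[OF g] and V' = is_arrowD(1)[OF f] and W' = is_arrowD(2)[OF g]
  note b = bilinear_mapD[OF hom_act_bilinear[OF V W], simplified]
    and b' = bilinear_mapD[OF hom_act_bilinear[OF V' W'], simplified]
  have L': "(\<lambda>v\<in>carrier V'. g (L (f v))) \<in> lin_hom R V' W'"
    by (rule restrict_in_lin_hom[OF is_arrowD(3)[OF f]
        linear_map_compose[OF linear_map_compose[OF is_arrowD(6)[OF f] lin_homD(1)[OF L]] is_arrowD(6)[OF g]]])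
  show ?thesis using t
  proof (induction rule: T2_induct)
    case (pure a b)
    then show ?case
      using L L' left_moduleD(4)[OF V] left_moduleD(4)[OF V'] is_arrowD(7,8)[OF f] is_arrowD(7,8)[OF g] linear_mapD(1)[OF lin_homD(1)[OF L]]
      by (simp add: hom_act_pure[OF V W] hom_act_pure[OF V' W'] fun_eq_iff restrict_def)
  next
    case (add x y)
    have "hom_act R H V W x L \<in> lin_hom R V W" "hom_act R H V W y L \<in> lin_hom R V W"
      using add by (auto intro: b(3) L)
    note cl = linear_mapD(1)[OF lin_homD(1)[OF this(1)]] linear_mapD(1)[OF lin_homD(1)[OF this(2)]]
    have "(\<lambda>v\<in>carrier V'. g (hom_act R H V W (x \<oplus>\<^bsub>tensor_mod R H H\<^esub> y) L (f v))) =
      (\<lambda>v\<in>carrier V'. g (hom_act R H V W x L (f v))) \<oplus>\<^bsub>hom_mod R V' W'\<^esub> (\<lambda>v\<in>carrier V'. g (hom_act R H V W y L (f v)))"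
      unfolding b(4)[OF add.hyps L] using cl is_arrowD(8)[OF f] linear_mapD(2)[OF is_arrowD(6)[OF g]]
      by (simp add: hom_mod_def fun_eq_iff restrict_def)
    then show ?case unfolding b'(4)[OF add.hyps L'] add.IH .
  qed
qed

lemma tensor_arrow_arrow:
  assumes f: "is_arrow R H (V, f, V')" and g: "is_arrow R H (W, g, W')"
  shows "is_arrow R H (tensor_module R H V W, tensor_map R V W V' W' f g, tensor_module R H V' W')"
  using left_module_tensor[OF is_arrowD(1)[OF f] is_arrowD(1)[OF g]] left_module_tensor[OF is_arrowD(2)[OF f] is_arrowD(2)[OF g]]
    tensor_map_in_lin_hom[OF is_arrowD(3)[OF f] is_arrowD(3)[OF g] is_arrowD(4)[OF f] is_arrowD(4)[OF g] is_arrowD(6)[OF f] is_arrowD(6)[OF g]]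
  by (simp add: is_arrow_iff tensor_module_flatten act2_natural[OF f g])

lemma hom_arrow_arrow:
  assumes f: "is_arrow R H (V', f, V)" and g: "is_arrow R H (W, g, W')"
  shows "is_arrow R H (hom_module R H V W, \<lambda>L\<in>lin_hom R V W. \<lambda>v\<in>carrier V'. g (L (f v)), hom_module R H V' W')"
proof -
  note V = is_arrowD(2)[OF f] and W = is_arrowD(1)[OF g] and V' = is_arrowD(1)[OF f] and W' = is_arrowD(2)[OF g]
  let ?f = "\<lambda>L\<in>lin_hom R V W. \<lambda>v\<in>carrier V'. g (L (f v))"
  have L': "(\<lambda>v\<in>carrier V'. g (L (f v))) \<in> lin_hom R V' W'" if L: "L \<in> lin_hom R V W" for L
    by (rule restrict_in_lin_hom[OF is_arrowD(3)[OF f]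
        linear_map_compose[OF linear_map_compose[OF is_arrowD(6)[OF f] lin_homD(1)[OF L]] is_arrowD(6)[OF g]]])
  have c: "carrier (hom_mod R V W) = lin_hom R V W" by (simp add: hom_mod_def)
  interpret M: module R "hom_mod R V W" by (rule module_hom_mod[OF left_moduleD(1)[OF V] left_moduleD(1)[OF W]])
  have cl: "L v \<in> carrier W" if "L \<in> lin_hom R V W" "v \<in> carrier V" for L v
    using linear_mapD(1)[OF lin_homD(1)[OF that(1)] that(2)] .
  have "linear_map R (hom_module R H V W) (hom_module R H V' W') ?f"
  proof (rule linear_mapI)
    fix x y assume "x \<in> carrier (hom_module R H V W)" "y \<in> carrier (hom_module R H V W)"
    then show "?f (x \<oplus>\<^bsub>hom_module R H V W\<^esub> y) = ?f x \<oplus>\<^bsub>hom_module R H V' W'\<^esub> ?f y"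
      using M.M.add.m_closed[of x y] cl is_arrowD(8)[OF f] linear_mapD(2)[OF is_arrowD(6)[OF g]]
      by (simp add: c) (simp add: hom_mod_def fun_eq_iff restrict_def)
  next
    fix r x assume "r \<in> carrier R" "x \<in> carrier (hom_module R H V W)"
    then show "?f (r \<odot>\<^bsub>hom_module R H V W\<^esub> x) = r \<odot>\<^bsub>hom_module R H V' W'\<^esub> ?f x"
      using M.smult_closed[of r x] cl is_arrowD(8)[OF f] linear_mapD(3)[OF is_arrowD(6)[OF g]]
      by (simp add: c) (simp add: hom_mod_def fun_eq_iff restrict_def)
  qed (simp add: L')
  moreover have "?f (act (hom_module R H V W) h L) = act (hom_module R H V' W') h (?f L)"
    if "h \<in> carrier H" "L \<in> lin_hom R V W" for h L
    using that left_moduleD(4)[OF left_module_hom[OF V W], of h L] by (simp add: hom_act_natural[OF f g])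
  ultimately show ?thesis
    using left_module_hom[OF V W] left_module_hom[OF V' W'] by (simp add: is_arrow_iff lin_hom_def)
qed

lemma comp_arrow_simp: "(W, g, X) \<circ>\<^sub>a (V, f, W') = (V, compose (carrier V) g f, X)"
  by (simp add: comp_arrow_def)

lemma tensor_map_restrict_id:
  assumes "module R V" "module R W"
  shows "tensor_map R V W V W (\<lambda>v\<in>carrier V. v) (\<lambda>w\<in>carrier W. w) = (\<lambda>t\<in>carrier (tensor_mod R V W). t)"
  using tensor_map_id[OF assms] tensor_map_cong[of V "\<lambda>v\<in>carrier V. v" "\<lambda>v. v" W "\<lambda>w\<in>carrier W. w" "\<lambda>w. w" R V W]
  by simp

lemma tensor_map_compose_arrows:
  assumes f: "is_arrow R H (V, f, V')" and g: "is_arrow R H (W, g, W')"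
    and f': "is_arrow R H (V', f', V'')" and g': "is_arrow R H (W', g', W'')"
  shows "tensor_map R V W V'' W'' (compose (carrier V) f' f) (compose (carrier W) g' g) =
    compose (carrier (tensor_mod R V W)) (tensor_map R V' W' V'' W'' f' g') (tensor_map R V W V' W' f g)"
proof -
  have e: "tensor_map R V W V'' W'' (compose (carrier V) f' f) (compose (carrier W) g' g) =
    tensor_map R V W V'' W'' (\<lambda>v. f' (f v)) (\<lambda>w. g' (g w))"
    by (rule tensor_map_cong) (simp_all add: compose_def)
  have l: "tensor_map R V W V'' W'' (\<lambda>v. f' (f v)) (\<lambda>w. g' (g w)) \<in> lin_hom R (tensor_mod R V W) (tensor_mod R V'' W'')"
    by (rule tensor_map_in_lin_hom)
      (simp_all add: is_arrowD(3)[OF f] is_arrowD(3)[OF g] is_arrowD(4)[OF f'] is_arrowD(4)[OF g']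
        linear_map_compose[OF is_arrowD(6)[OF f] is_arrowD(6)[OF f']] linear_map_compose[OF is_arrowD(6)[OF g] is_arrowD(6)[OF g']])
  show ?thesis unfolding e
    by (rule extensionalityI[of _ "carrier (tensor_mod R V W)"])
      (use lin_homD(2)[OF l] in \<open>simp_all add: compose_def tensor_map_compose is_arrowD(3)[OF f] is_arrowD(3)[OF g]
        is_arrowD(4)[OF f] is_arrowD(4)[OF g] is_arrowD(4)[OF f'] is_arrowD(4)[OF g'] is_arrowD(6)[OF f] is_arrowD(6)[OF f'] is_arrowD(6)[OF g] is_arrowD(6)[OF g']\<close>)
qed

section \<open>The functors\<close>

lemma is_functor_tensor:
  "is_functor (prod_cat (module_cat R H :: ('k, 'h, 'v) hmod_cat) (module_cat R H :: ('k, 'h, 'w) hmod_cat))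
     (module_cat R H) (tensor_functor R H)"
  unfolding is_functor_def
  by (intro conjI is_category_prod is_category_module_cat)
    (auto simp: tensor_functor_def left_module_tensor tensor_arrow_def tensor_arrow_arrow id_arrow_def
    tensor_map_restrict_id left_moduleD(1) comp_arrow_simp tensor_map_compose_arrows)

lemma is_functor_hom:
  "is_functor (prod_cat (op_cat (module_cat R H :: ('k, 'h, 'v) hmod_cat)) (module_cat R H :: ('k, 'h, 'w) hmod_cat))
     (module_cat R H) (hom_functor R H)"
proof -
  have i: "(\<lambda>L\<in>lin_hom R V W. \<lambda>v\<in>carrier V. if L (if v \<in> carrier V then v else undefined) \<in> carrier W
        then L (if v \<in> carrier V then v else undefined) else undefined) = (\<lambda>L\<in>lin_hom R V W. L)"
    for V :: "('k, 'h, 'v) hmodule" and W :: "('k, 'h, 'w) hmodule"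
    by (auto simp: fun_eq_iff restrict_def lin_hom_def linear_map_def extensional_def Pi_iff)
  have c: "(\<lambda>L\<in>lin_hom R V W. \<lambda>v\<in>carrier V''. compose (carrier W) g' g (L (compose (carrier V'') f f' v))) =
      compose (lin_hom R V W) (\<lambda>L\<in>lin_hom R V' W'. \<lambda>v\<in>carrier V''. g' (L (f' v))) (\<lambda>L\<in>lin_hom R V W. \<lambda>v\<in>carrier V'. g (L (f v)))"
    if f: "is_arrow R H (V', f, V)" and g: "is_arrow R H (W, g, W')"
      and f': "is_arrow R H (V'', f', V')" and g': "is_arrow R H (W', g', W'')"
    for V V' V'' :: "('k, 'h, 'v) hmodule" and W W' W'' :: "('k, 'h, 'w) hmodule" and f f' g g'
  proof (rule extensionalityI[of _ "lin_hom R V W"])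
    fix L assume L: "L \<in> lin_hom R V W"
    have L': "(\<lambda>v\<in>carrier V'. g (L (f v))) \<in> lin_hom R V' W'"
      using is_arrowD(8)[OF hom_arrow_arrow[OF f g], of L] L by simp
    show "(\<lambda>L\<in>lin_hom R V W. \<lambda>v\<in>carrier V''. compose (carrier W) g' g (L (compose (carrier V'') f f' v))) L =
      compose (lin_hom R V W) (\<lambda>L\<in>lin_hom R V' W'. \<lambda>v\<in>carrier V''. g' (L (f' v))) (\<lambda>L\<in>lin_hom R V W. \<lambda>v\<in>carrier V'. g (L (f v))) L"
      using L L' is_arrowD(8)[OF f] is_arrowD(8)[OF f'] linear_mapD(1)[OF lin_homD(1)[OF L]]
      by (simp add: compose_def fun_eq_iff restrict_def)
  qed simp_all
  show ?thesis
    unfolding is_functor_def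
    by (intro conjI is_category_prod is_category_op is_category_module_cat)
      (auto simp: hom_functor_def left_module_hom hom_arrow_arrow id_arrow_def
      i comp_arrow_simp c)
qed

end

context twisted_quasi_hopf
begin

section \<open>The coherence maps\<close>

lemma quasi_hopf_alg_HF: "quasi_hopf_alg R HF"
  by (rule quasi_hopf_alg.intro[OF quasi_hopf_HF])

lemma left_module_HF [simp]: "left_module R HF V \<longleftrightarrow> left_module R H V"
  by (simp add: left_module_def linear_map_def)

lemma is_arrow_HF [simp]: "is_arrow R HF a \<longleftrightarrow> is_arrow R H a"
  by (simp add: is_arrow_def)

lemma module_cat_HF [simp]: "module_cat R HF = module_cat R H"
  by (simp add: module_cat_def)

lemma act2_HF [simp]: "act2 R HF V W = act2 R H V W"
  by (simp add: act2_def tensor_act_cong[of HF H HF H V V W W])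

lemma hom_act_HF [simp]: "hom_act R HF V W = hom_act R H V W"
  by (intro ext) (simp add: hom_act_def)

lemma unit_HF [simp]: "unit_module R HF = unit_module R H"
  by (simp add: unit_module_def)

text \<open>The one computation behind the coherence maps: \<open>G \<Delta>\<^sub>F(h) = \<Delta>(h) G\<close>, so that \<open>G\<close> acts as a homomorphism
  from the twisted to the untwisted structure, and \<open>F\<close> in the opposite direction.\<close>

lemma twist_isomorphism:
  assumes t: "algebra_action R T2 M \<tau>"
  defines "S' \<equiv> module.extend M \<lparr>act = (\<lambda>h. \<tau> (comult HF h))\<rparr>"
    and "T' \<equiv> module.extend M \<lparr>act = (\<lambda>h. \<tau> (\<Delta> h))\<rparr>"
  shows "is_isomorphism (module_cat R H) (S', \<lambda>x\<in>carrier M. \<tau> G x, T')"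
proof -
  have S': "left_module R H S'"
    using quasi_hopf_alg.left_module_extend[OF quasi_hopf_alg_HF, of M \<tau>] t by (simp add: S'_def)
  have T': "left_module R H T'"
    unfolding T'_def by (rule left_module_extend[OF t])
  note a = algebra_actionD[OF t, simplified]
  note b = bilinear_mapD[OF a(2), simplified]
  have l: "(\<lambda>x\<in>carrier M. \<tau> u x) \<in> lin_hom R M M" if "u \<in> C2" for u
    using that by (intro restrict_in_lin_hom a(1) b(1))
  have lh: "lin_hom R S' T' = lin_hom R M M" "lin_hom R T' S' = lin_hom R M M"
    unfolding S'_def T'_def by (rule lin_hom_cong; simp)+
  have "\<tau> G (\<tau> (F \<otimes>\<^bsub>T2\<^esub> \<Delta> h \<otimes>\<^bsub>T2\<^esub> G) x) = \<tau> (\<Delta> h) (\<tau> G x)" if "h \<in> carrier H" "x \<in> carrier M" for h x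
    using that by (simp add: a(3)[symmetric] T2)
  then have 1: "is_arrow R H (S', \<lambda>x\<in>carrier M. \<tau> G x, T')"
    using S' T' l[of G] a(5) by (simp add: is_arrow_iff lh) (simp add: S'_def T'_def HF_data T2)
  have "\<tau> F (\<tau> (\<Delta> h) x) = \<tau> (F \<otimes>\<^bsub>T2\<^esub> \<Delta> h \<otimes>\<^bsub>T2\<^esub> G) (\<tau> F x)" if "h \<in> carrier H" "x \<in> carrier M" for h x
    using that by (simp add: a(3)[symmetric] T2)
  then have 2: "is_arrow R H (T', \<lambda>x\<in>carrier M. \<tau> F x, S')"
    using S' T' l[of F] a(5) by (simp add: is_arrow_iff lh) (simp add: S'_def T'_def HF_data T2)
  have 3: "\<tau> F (\<tau> G x) = x" "\<tau> G (\<tau> F x) = x" if "x \<in> carrier M" for x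
    using that by (simp_all add: a(3)[symmetric] a(4))
  have c: "carrier S' = carrier M" "carrier T' = carrier M" by (simp_all add: S'_def T'_def)
  show ?thesis unfolding is_isomorphism_def
    using 1 2 by (auto intro!: bexI[of _ "(T', \<lambda>x\<in>carrier M. \<tau> F x, S')"]
      simp: comp_arrow_simp id_arrow_def c compose_def 3 a(5) restrict_def fun_eq_iff)
qed

lemma tensor_module_HF: "tensor_module R HF V W = module.extend (tensor_mod R V W) \<lparr>act = (\<lambda>h. act2 R H V W (comult HF h))\<rparr>"
  by (simp add: tensor_module_def)

lemma hom_module_HF: "hom_module R HF V W = module.extend (hom_mod R V W) \<lparr>act = (\<lambda>h. hom_act R H V W (comult HF h))\<rparr>"
  by (simp add: hom_module_def)

lemma twist_phi_iso:
  assumes "left_module R H V" "left_module R H W"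
  shows "is_isomorphism (module_cat R H) (twist_phi R H F V W)"
  using twist_isomorphism[OF act2_action[OF assms]]
  by (simp add: twist_phi_def tensor_module_HF[symmetric] tensor_module_def[symmetric])

lemma twist_gamma_iso:
  assumes "left_module R H V" "left_module R H W"
  shows "is_isomorphism (module_cat R H) (twist_gamma R H F V W)"
  using twist_isomorphism[OF hom_act_action[OF assms]]
  by (simp add: twist_gamma_def hom_module_HF[symmetric] hom_module_def[symmetric])

lemma natural_iso_phi:
  "natural_iso
      (prod_cat (module_cat R H :: ('k, 'h, 'v) hmod_cat) (module_cat R H :: ('k, 'h, 'w) hmod_cat))
      (module_cat R H) (tensor_functor R HF) (tensor_functor R H) (\<lambda>(V, W). twist_phi R H F V W)"
proof -
  have f: "is_functor (prod_cat (module_cat R H :: ('k, 'h, 'v) hmod_cat) (module_cat R H :: ('k, 'h, 'w) hmod_cat))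
     (module_cat R H) (tensor_functor R HF)"
    using quasi_hopf_alg.is_functor_tensor[OF quasi_hopf_alg_HF, unfolded module_cat_HF] .
  have n: "compose (carrier (tensor_mod R V W)) (tensor_map R V W V' W' f g) (\<lambda>t\<in>carrier (tensor_mod R V W). act2 R H V W G t)
      = compose (carrier (tensor_mod R V W)) (\<lambda>t\<in>carrier (tensor_mod R V' W'). act2 R H V' W' G t) (tensor_map R V W V' W' f g)"
    if f: "is_arrow R H (V, f, V')" and g: "is_arrow R H (W, g, W')"
    for V V' :: "('k, 'h, 'v) hmodule" and W W' :: "('k, 'h, 'w) hmodule" and f g
    unfolding compose_def
    by (rule restrict_ext)
      (simp add: act2_natural[OF f g] tensor_map_closed is_arrowD[OF f] is_arrowD[OF g])
  show ?thesis unfolding natural_iso_def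
    by (intro conjI f is_functor_tensor)
      (auto simp: tensor_functor_def tensor_arrow_def twist_phi_iso comp_arrow_simp n,
       auto simp: twist_phi_def Let_def comp_arrow_simp n)
qed

lemma natural_iso_gamma:
  "natural_iso
      (prod_cat (op_cat (module_cat R H :: ('k, 'h, 'v) hmod_cat)) (module_cat R H :: ('k, 'h, 'w) hmod_cat))
      (module_cat R H) (hom_functor R HF) (hom_functor R H) (\<lambda>(V, W). twist_gamma R H F V W)"
proof -
  have f: "is_functor (prod_cat (op_cat (module_cat R H :: ('k, 'h, 'v) hmod_cat)) (module_cat R H :: ('k, 'h, 'w) hmod_cat))
     (module_cat R H) (hom_functor R HF)"
    using quasi_hopf_alg.is_functor_hom[OF quasi_hopf_alg_HF, unfolded module_cat_HF] .
  have n: "compose (lin_hom R V W) (\<lambda>L\<in>lin_hom R V W. \<lambda>v\<in>carrier V'. g (L (f v))) (\<lambda>L\<in>lin_hom R V W. hom_act R H V W G L)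
      = compose (lin_hom R V W) (\<lambda>L\<in>lin_hom R V' W'. hom_act R H V' W' G L) (\<lambda>L\<in>lin_hom R V W. \<lambda>v\<in>carrier V'. g (L (f v)))"
    if f: "is_arrow R H (V', f, V)" and g: "is_arrow R H (W, g, W')"
    for V V' :: "('k, 'h, 'v) hmodule" and W W' :: "('k, 'h, 'w) hmodule" and f g
    unfolding compose_def
  proof (rule restrict_ext)
    fix L assume L: "L \<in> lin_hom R V W"
    have "hom_act R H V W G L \<in> lin_hom R V W"
      using bilinear_mapD(3)[OF hom_act_bilinear[OF is_arrowD(2)[OF f] is_arrowD(1)[OF g]], of G L] L by simp
    moreover have "(\<lambda>v\<in>carrier V'. g (L (f v))) \<in> lin_hom R V' W'"
      using is_arrowD(8)[OF hom_arrow_arrow[OF f g], of L] L by simp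
    ultimately show "(\<lambda>L\<in>lin_hom R V W. \<lambda>v\<in>carrier V'. g (L (f v))) ((\<lambda>L\<in>lin_hom R V W. hom_act R H V W G L) L) =
      (\<lambda>L\<in>lin_hom R V' W'. hom_act R H V' W' G L) ((\<lambda>L\<in>lin_hom R V W. \<lambda>v\<in>carrier V'. g (L (f v))) L)"
      using L hom_act_natural[OF f g _ L, of G] by simp
  qed
  show ?thesis unfolding natural_iso_def
    by (intro conjI f is_functor_hom)
      (auto simp: hom_functor_def twist_gamma_iso comp_arrow_simp n,
       auto simp: twist_gamma_def Let_def comp_arrow_simp n)
qed

lemma twist_psi_id: "twist_psi R H F = id_arrow (unit_module R H)"
  by (simp add: twist_psi_def id_arrow_def)

text \<open>Both composites are the rebracketing map followed by the action of one element of \<open>H\<^sup>\<otimes>\<^sup>3\<close>: on the left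
  \<open>\<phi> (\<Delta> \<otimes> id)(G) (G \<otimes> 1)\<close>, once its last two factors have been carried across the rebracketing map, and on the right
  \<open>(id \<otimes> \<Delta>)(G) (1 \<otimes> G) \<phi>\<^sub>F\<close>. By the definition of \<open>\<phi>\<^sub>F\<close> these are equal.\<close>

lemma associator_coherence:
  assumes V: "left_module R H V" and W: "left_module R H W" and X: "left_module R H X"
  shows "associator R H V W X \<circ>\<^sub>a twist_phi R H F (tensor_module R H V W) X
         \<circ>\<^sub>a tensor_arrow R HF (twist_phi R H F V W) (id_arrow X) =
       twist_phi R H F V (tensor_module R H W X)
         \<circ>\<^sub>a tensor_arrow R HF (id_arrow V) (twist_phi R H F W X) \<circ>\<^sub>a associator R HF V W X"
proof -
  let ?VW = "tensor_mod R V W" and ?WX = "tensor_mod R W X"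
  let ?S = "tensor_mod R ?VW X" and ?T = "tensor_mod R V ?WX"
  note m = left_moduleD(1)[OF V] left_moduleD(1)[OF W] left_moduleD(1)[OF X]
  have mVW: "module R ?VW" and mWX: "module R ?WX" using m by simp_all
  note aVW = act2_action[OF V W] and aWX = act2_action[OF W X]
  let ?L = "tensor_act R T2 H ?VW X (act2 R H V W) (act X)"
  let ?R = "tensor_act R H T2 V ?WX (act V) (act2 R H W X)"
  have aL: "algebra_action R (tensor_alg R T2 H) ?S ?L"
    by (rule algebra_action_tensor) (simp_all add: aVW left_moduleD[OF X])
  have aR: "algebra_action R T3 ?T ?R"
    by (rule algebra_action_tensor) (simp_all add: aWX left_moduleD[OF V])
  note L = algebra_actionD[OF aL, simplified] and R = algebra_actionD[OF aR, simplified]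
  note bV = left_moduleD(2)[OF V] and bX = left_moduleD(2)[OF X]
  have bVW: "bilinear_map R T2 ?VW ?VW (act2 R H V W)" and bWX: "bilinear_map R T2 ?WX ?WX (act2 R H W X)"
    using algebra_actionD(2)[OF aVW] algebra_actionD(2)[OF aWX] .
  let ?re = "tensor_reassoc R V W X"
  have re_cl: "?re x \<in> carrier ?T" if "x \<in> carrier ?S" for x
    using that m by (simp add: tensor_reassoc_closed)
  have re: "?re (?L t x) = ?R (tensor_reassoc R H H H t) (?re x)"
    if "t \<in> carrier (tensor_mod R T2 H)" "x \<in> carrier ?S" for t x
    using tensor_reassoc_act[OF algebra_H algebra_H algebra_H left_moduleD(3)[OF V] left_moduleD(3)[OF W] left_moduleD(3)[OF X]] that
    by (simp add: act2_def)

  \<comment> \<open>each arrow of the diagram is the action of an element of a threefold tensor power\<close>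
  have p1: "tensor_map R ?VW X ?VW X (\<lambda>t\<in>carrier ?VW. act2 R H V W G t) (\<lambda>x\<in>carrier X. x) x =
      ?L (pure_tensor R T2 H G \<one>\<^bsub>H\<^esub>) x" if "x \<in> carrier ?S" for x
    using that tensor_act_pure_left[OF _ module_H mVW m(3) bVW bX, of G "\<one>\<^bsub>H\<^esub>" x]
      tensor_map_cong[of ?VW "\<lambda>t\<in>carrier ?VW. act2 R H V W G t" "act2 R H V W G" X "\<lambda>x\<in>carrier X. x" "act X \<one>\<^bsub>H\<^esub>" R ?VW X]
    by (simp add: left_moduleD(5)[OF X])
  have p2: "tensor_act R H H ?VW X (\<lambda>h. act2 R H V W (\<Delta> h)) (act X) G x =
      ?L (tensor_map R H H T2 H \<Delta> (\<lambda>x. x) G) x" if "x \<in> carrier ?S" for x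
    using that tensor_act_pullback[OF module_H module_H _ module_H mVW m(3) bVW bX algebra_homD(1)[OF comult_hom] linear_map_id, of G x]
    by simp
  have p3: "tensor_map R V ?WX V ?WX (\<lambda>v\<in>carrier V. v) (\<lambda>t\<in>carrier ?WX. act2 R H W X G t) x =
      ?R (one_tensor R H G) x" if "x \<in> carrier ?T" for x
    using that tensor_act_pure_left[OF module_H _ m(1) mWX bV bWX, of "\<one>\<^bsub>H\<^esub>" G x]
      tensor_map_cong[of V "\<lambda>v\<in>carrier V. v" "act V \<one>\<^bsub>H\<^esub>" ?WX "\<lambda>t\<in>carrier ?WX. act2 R H W X G t" "act2 R H W X G" R V ?WX]
    by (simp add: left_moduleD(5)[OF V] one_tensor_def)
  have p4: "tensor_act R H H V ?WX (act V) (\<lambda>h. act2 R H W X (\<Delta> h)) G x =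
      ?R (id_comult R H G) x" if "x \<in> carrier ?T" for x
    using that tensor_act_pullback[OF module_H module_H module_H _ m(1) mWX bV bWX linear_map_id algebra_homD(1)[OF comult_hom], of G x]
    by (simp add: id_comult_def)
  have t1: "tensor_reassoc R H H H (tensor_map R H H T2 H \<Delta> (\<lambda>x. x) G) = comult_id R H G"
    "tensor_reassoc R H H H (pure_tensor R T2 H G \<one>\<^bsub>H\<^esub>) = tensor_one R H G"
    by (simp_all add: comult_id_def tensor_one_def)
  have tc: "tensor_map R H H T2 H \<Delta> (\<lambda>x. x) G \<in> carrier (tensor_mod R T2 H)"
    "pure_tensor R T2 H G \<one>\<^bsub>H\<^esub> \<in> carrier (tensor_mod R T2 H)"
    by (simp_all add: tensor_map_closed algebra_homD(1)[OF comult_hom] linear_map_id)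
  have main: "?R \<phi> (?re (?L (tensor_map R H H T2 H \<Delta> (\<lambda>x. x) G) (?L (pure_tensor R T2 H G \<one>\<^bsub>H\<^esub>) x))) =
    ?R (id_comult R H G) (?R (one_tensor R H G) (?R \<phi>F (?re x)))" if x: "x \<in> carrier ?S" for x
  proof -
    have "?R \<phi> (?re (?L (tensor_map R H H T2 H \<Delta> (\<lambda>x. x) G) (?L (pure_tensor R T2 H G \<one>\<^bsub>H\<^esub>) x))) =
      ?R (\<phi> \<otimes>\<^bsub>T3\<^esub> (comult_id R H G \<otimes>\<^bsub>T3\<^esub> tensor_one R H G)) (?re x)"
      using x by (simp add: re L(5) tc t1 R(3) R(5) re_cl T3)
    also have "\<phi> \<otimes>\<^bsub>T3\<^esub> (comult_id R H G \<otimes>\<^bsub>T3\<^esub> tensor_one R H G) = id_comult R H G \<otimes>\<^bsub>T3\<^esub> (one_tensor R H G \<otimes>\<^bsub>T3\<^esub> \<phi>F)"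
      by (simp add: T3)
    also have "?R \<dots> (?re x) = ?R (id_comult R H G) (?R (one_tensor R H G) (?R \<phi>F (?re x)))"
      using x R(3) re_cl[OF x] T3(5) by (simp del: cancel)
    finally show ?thesis .
  qed
  have assocHF: "associator R HF V W X = (tensor_module R HF (tensor_module R HF V W) X,
      \<lambda>t\<in>carrier ?S. ?R \<phi>F (?re t), tensor_module R HF V (tensor_module R HF W X))"
    by (simp add: associator_def Let_def tensor_module_flatten coassociator_HF tensor_act_cong[of HF H T2 T2 V V ?WX ?WX])
  have assocH: "associator R H V W X = (tensor_module R H (tensor_module R H V W) X,
      \<lambda>t\<in>carrier ?S. ?R \<phi> (?re t), tensor_module R H V (tensor_module R H W X))"
    by (simp add: associator_def Let_def tensor_module_flatten)
  have act2L: "act2 R H (tensor_module R H V W) X = tensor_act R H H ?VW X (\<lambda>h. act2 R H V W (\<Delta> h)) (act X)"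
    and act2R: "act2 R H V (tensor_module R H W X) = tensor_act R H H V ?WX (act V) (\<lambda>h. act2 R H W X (\<Delta> h))"
    by (simp_all add: act2_def tensor_module_flatten tensor_module_sel(5)[abs_def])
  show ?thesis
    unfolding assocHF assocH twist_phi_def Let_def tensor_arrow_def id_arrow_def prod.case comp_arrow_simp
    using main
    by (simp add: tensor_module_flatten act2L act2R compose_def p1 p2 p3 p4 L(5) R(5) tc re_cl T3 cong: restrict_cong)
qed

text \<open>The left unitor turns the action of \<open>t\<close> on \<open>k \<otimes> V\<close> into that of \<open>(\<epsilon> \<otimes> id)(t)\<close> on \<open>V\<close>, and
  \<open>(\<epsilon> \<otimes> id)(G) = 1\<close>; likewise on the right.\<close>

lemma unitor_coherence:
  assumes V: "left_module R H V"
  shows "left_unitor R H V \<circ>\<^sub>a twist_phi R H F (unit_module R H) V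
         \<circ>\<^sub>a tensor_arrow R HF (twist_psi R H F) (id_arrow V) = left_unitor R HF V"
    and "right_unitor R H V \<circ>\<^sub>a twist_phi R H F V (unit_module R H)
         \<circ>\<^sub>a tensor_arrow R HF (id_arrow V) (twist_psi R H F) = right_unitor R HF V"
proof -
  let ?I = "unit_module R H"
  note mI = left_moduleD(1)[OF left_module_unit] and mV = left_moduleD(1)[OF V]
  interpret V: module R V by (rule mV)
  note bI = left_moduleD(2)[OF left_module_unit] and bV = left_moduleD(2)[OF V]
  note bVD = bilinear_mapD[OF bV]
  let ?l = "tensor_lift R ?I V V (\<lambda>c v. c \<odot>\<^bsub>V\<^esub> v)" and ?r = "tensor_lift R V ?I V (\<lambda>v c. c \<odot>\<^bsub>V\<^esub> v)"
  have bl: "bilinear_map R ?I V V (\<lambda>c v. c \<odot>\<^bsub>V\<^esub> v)" "bilinear_map R V ?I V (\<lambda>v c. c \<odot>\<^bsub>V\<^esub> v)"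
    by (auto simp: bilinear_map_def linear_map_def V.smult_l_distr V.smult_r_distr V.smult_assoc1[symmetric] mod.R.m_comm)
  note ll = lift_in_lin_hom[OF mI mV mV bl(1)] lift_in_lin_hom[OF mV mI mV bl(2)]
  note lp = lift_pure[OF mI mV mV bl(1)] lift_pure[OF mV mI mV bl(2)]
  note lD = linear_mapD[OF lin_homD(1)[OF ll(1)]] and rD = linear_mapD[OF lin_homD(1)[OF ll(2)]]
  note aD = bilinear_mapD[OF algebra_actionD(2)[OF act2_action[OF left_module_unit V]], simplified]
    and aD' = bilinear_mapD[OF algebra_actionD(2)[OF act2_action[OF V left_module_unit]], simplified]
  have l: "?l (act2 R H ?I V t x) = act V (counit_left R H t) (?l x)"
    if t: "t \<in> C2" and x: "x \<in> carrier (tensor_mod R ?I V)" for t x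
    using t
  proof (induction rule: T2_induct)
    case (pure a b)
    note ab = pure
    show ?case using mI mV x
    proof (induction rule: pure_tensor_induct)
      case (pure c v)
      then show ?case using ab
        by (simp add: act2_def tensor_act_pure mI mV bI bV lp bVD(3,6,7) V.smult_assoc1 module_closed(4)[OF mV])
    next
      case (add p q)
      then show ?case using ab by (simp add: mI mV aD(3,5) lD(1,2) bVD(5))
    qed
  next
    case (add p q)
    then show ?case using x by (simp add: aD(3,4) lD(1,2) bVD(4))
  qed
  have r: "?r (act2 R H V ?I t x) = act V (counit_right R H t) (?r x)"
    if t: "t \<in> C2" and x: "x \<in> carrier (tensor_mod R V ?I)" for t x
    using t
  proof (induction rule: T2_induct)
    case (pure a b)
    note ab = pure
    show ?case using mV mI x
    proof (induction rule: pure_tensor_induct)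
      case (pure v c)
      then show ?case using ab
        by (simp add: act2_def tensor_act_pure mI mV bI bV lp bVD(3,6,7) V.smult_assoc1 module_closed(4)[OF mV])
    next
      case (add p q)
      then show ?case using ab by (simp add: mI mV aD'(3,5) rD(1,2) bVD(5))
    qed
  next
    case (add p q)
    then show ?case using x by (simp add: aD'(3,4) rD(1,2) bVD(4))
  qed
  have "(\<lambda>x\<in>carrier (tensor_mod R ?I V). ?l x) = ?l" "(\<lambda>x\<in>carrier (tensor_mod R V ?I). ?r x) = ?r"
    using lin_homD(2)[OF ll(1)] lin_homD(2)[OF ll(2)] by (simp_all add: extensional_restrict)
  note e = this
  have c1: "compose (carrier (tensor_mod R ?I V)) ?l (compose (carrier (tensor_mod R ?I V))
      (\<lambda>t\<in>carrier (tensor_mod R ?I V). act2 R H ?I V G t) (\<lambda>t\<in>carrier (tensor_mod R ?I V). t)) = ?l"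
    by (rule trans[OF _ e(1)], unfold compose_def, rule restrict_ext)
      (simp add: l lD(1) left_moduleD(5)[OF V])
  have c2: "compose (carrier (tensor_mod R V ?I)) ?r (compose (carrier (tensor_mod R V ?I))
      (\<lambda>t\<in>carrier (tensor_mod R V ?I). act2 R H V ?I G t) (\<lambda>t\<in>carrier (tensor_mod R V ?I). t)) = ?r"
    by (rule trans[OF _ e(2)], unfold compose_def, rule restrict_ext)
      (simp add: r rD(1) left_moduleD(5)[OF V])
  show "left_unitor R H V \<circ>\<^sub>a twist_phi R H F (unit_module R H) V
         \<circ>\<^sub>a tensor_arrow R HF (twist_psi R H F) (id_arrow V) = left_unitor R HF V"
    using c1 tensor_map_restrict_id[OF mI mV]
    by (simp add: left_unitor_def twist_phi_def Let_def twist_psi_id id_arrow_def tensor_arrow_def comp_arrow_simp)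
  show "right_unitor R H V \<circ>\<^sub>a twist_phi R H F V (unit_module R H)
         \<circ>\<^sub>a tensor_arrow R HF (id_arrow V) (twist_psi R H F) = right_unitor R HF V"
    using c2 tensor_map_restrict_id[OF mV mI]
    by (simp add: right_unitor_def twist_phi_def Let_def twist_psi_id id_arrow_def tensor_arrow_def comp_arrow_simp)
qed

end

section \<open>The equivalence\<close>

theorem theorem2p15:
  fixes R :: "('k, 'r) ring_scheme"
    and H :: "('k, 'h) quasi_hopf_algebra"
    and F :: "('h, 'h) tens"
  assumes "quasi_hopf R H"
    and "cochain_twist R H F"
  defines "H\<^sub>F \<equiv> twisted_algebra R H F"
  shows "quasi_hopf R H\<^sub>F \<and>
    equivalence_of_categories
      (module_cat R H :: ('k, 'h, 'v) hmod_cat) (module_cat R H\<^sub>F) twist_functor \<and>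
    natural_iso
      (prod_cat (module_cat R H :: ('k, 'h, 'v) hmod_cat) (module_cat R H :: ('k, 'h, 'w) hmod_cat))
      (module_cat R H\<^sub>F)
      (cfunctor_comp (tensor_functor R H\<^sub>F) (cfunctor_prod twist_functor twist_functor))
      (cfunctor_comp twist_functor (tensor_functor R H))
      (\<lambda>(V, W). twist_phi R H F V W) \<and>
    is_isomorphism (module_cat R H\<^sub>F) (twist_psi R H F) \<and>
    (\<forall>(V :: ('k, 'h, 'v) hmodule) (W :: ('k, 'h, 'w) hmodule) (X :: ('k, 'h, 'x) hmodule).
       left_module R H V \<and> left_module R H W \<and> left_module R H X \<longrightarrow>
       associator R H V W X \<circ>\<^sub>a twist_phi R H F (tensor_module R H V W) X
         \<circ>\<^sub>a tensor_arrow R H\<^sub>F (twist_phi R H F V W) (id_arrow X) =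
       twist_phi R H F V (tensor_module R H W X)
         \<circ>\<^sub>a tensor_arrow R H\<^sub>F (id_arrow V) (twist_phi R H F W X) \<circ>\<^sub>a associator R H\<^sub>F V W X) \<and>
    (\<forall>V :: ('k, 'h, 'v) hmodule. left_module R H V \<longrightarrow>
       left_unitor R H V \<circ>\<^sub>a twist_phi R H F (unit_module R H) V
         \<circ>\<^sub>a tensor_arrow R H\<^sub>F (twist_psi R H F) (id_arrow V) = left_unitor R H\<^sub>F V \<and>
       right_unitor R H V \<circ>\<^sub>a twist_phi R H F V (unit_module R H)
         \<circ>\<^sub>a tensor_arrow R H\<^sub>F (id_arrow V) (twist_psi R H F) = right_unitor R H\<^sub>F V) \<and>
    natural_iso
      (prod_cat (op_cat (module_cat R H :: ('k, 'h, 'v) hmod_cat)) (module_cat R H :: ('k, 'h, 'w) hmod_cat))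
      (module_cat R H\<^sub>F)
      (cfunctor_comp (hom_functor R H\<^sub>F) (cfunctor_prod (cfunctor_op twist_functor) twist_functor))
      (cfunctor_comp twist_functor (hom_functor R H))
      (\<lambda>(V, W). twist_gamma R H F V W)"
proof -
  interpret twisted_quasi_hopf R H F
    using assms(1,2) by unfold_locales
  show ?thesis
    unfolding H\<^sub>F_def twist_functor_id cfunctor_op_def cfunctor_prod_id cfunctor_comp_id module_cat_HF
    using quasi_hopf_HF equivalence_id[OF is_category_module_cat] natural_iso_phi natural_iso_gamma
      is_isomorphism_id[OF is_category_module_cat, of "unit_module R H"] left_module_unit
      associator_coherence unitor_coherence
    by (intro conjI allI impI) (auto simp: twist_psi_id)
qed

end
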